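(* Let $\mathcal V$ be an algebra of differential functions in the variables $u_1,\dots,u_\ell$, which is a domain, and let $\mathcal K$ be its field of fractions. Let $H=(H_{ij})_{i,j\in I}\in\mathrm{Mat}_{\ell\times\ell}\mathcal V((\partial^{-1}))$. Consider the formula $$\{f_\lambda g\}_H=\sum_{i,j\in I}\sum_{m,n\in\mathbb Z_+}\frac{\partial g}{\partial u_j^{(n)}}(\lambda+\partial)^nH_{ji}(\lambda+\partial)(-\lambda-\partial)^m\frac{\partial f}{\partial u_i^{(m)}}\in\mathcal V((\lambda^{-1})),\qquad f,g\in\mathcal V.\qquad(\mathrm{MF})$$ Then: (a) Formula (MF) gives a well-defined non-local $\lambda$-bracket on $\mathcal V$. (b) This non-local $\lambda$-bracket is skewsymmetric if and only if $H$ is a skewadjoint matrix pseudodifferential operator. (c) If $H\in\mathrm{Mat}_{\ell\times\ell}\mathcal V(\partial)$ is a rational matrix pseudodifferential operator with coefficients in $\mathcal V$, then the corresponding non-local $\lambda$-bracket $\{\cdot\,_\lambda\,\cdot\}_H:\mathcal V\times\mathcal V\to\mathcal V((\lambda^{-1}))$ is admissible. (d) Let $H\in\mathrm{Mat}_{\ell\times\ell}\mathcal V(\partial)$ be a skewadjoint rational matrix pseudodifferential operator with coefficients in $\mathcal V$. Then the non-local $\lambda$-bracket $\{\cdot\,_\lambda\,\cdot\}_H$ is a Poisson non-local $\lambda$-bracket, i.e. it satisfies the Jacobi identity $$\{a_\lambda\{b_\mu c\}_H\}_H-\{b_\mu\{a_\lambda c\}_H\}_H=\{\{a_\lambda b\}_H{}_{\,\lambda+\mu}c\}_H\quad\text{for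 all }a,b,c\in\mathcal V,$$ if and only if the Jacobi identity holds on generators: for all $i,j,k\in I$, $$\{{u_i}_\lambda\{{u_j}_\mu u_k\}_H\}_H-\{{u_j}_\mu\{{u_i}_\lambda u_k\}_H\}_H-\{\{{u_i}_\lambda u_j\}_H{}_{\,\lambda+\mu}u_k\}_H=0,$$ where the equalities hold in the space $\mathcal V_{\lambda,\mu}$.
   Context: All vector spaces are over a field $\mathbb F$ of characteristic zero; $I=\{1,\dots,\ell\}$. A differential algebra is a unital commutative associative algebra with a derivation $\partial$. Let $R_\ell=\mathbb F[u_i^{(n)}\mid i\in I,n\in\mathbb Z_+]$ with $\partial u_i^{(n)}=u_i^{(n+1)}$, $u_i^{(0)}=u_i$. An algebra of differential functions is a differential algebra extension $\mathcal V$ of $R_\ell$ with commuting derivations $\frac{\partial}{\partial u_i^{(n)}}$ of $\mathcal V$ extending the usual partial derivatives of $R_\ell$, such that for each $f\in\mathcal V$ only finitely many $\frac{\partial f}{\partial u_i^{(n)}}$ are nonzero, and $[\frac{\partial}{\partial u_i^{(n)}},\partial]=\frac{\partial}{\partial u_i^{(n-1)}}$ (zero if $n=0$). Pseudodifferential operators: $\mathcal V((\partial^{-1}))$ consists of $\sum_{n\le N}a_n\partial^n$, $a_n\in\mathcal V$, with product determined by $\partial^n\circ a=\sum_{j\ge0}\binom nj a^{(j)}\partial^{n-j}$; the symbol of $A=\sum a_n\partial^n$ is $A(\lambda)=\sum a_n\lambda^n$. The adjoint is given by $(a\partial^n)^*=(-\partial)^n\circ a$, for matrices $(H^* )_{ij}=(H_{ji})^*$,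 and $H$ is skewadjoint if $H^*=-H$. $\mathcal K(\partial)$ is the smallest subskewfield of $\mathcal K((\partial^{-1}))$ containing $\mathcal V[\partial]$, and $\mathcal V(\partial)=\mathcal K(\partial)\cap\mathcal V((\partial^{-1}))$; elements of $\mathrm{Mat}_{\ell\times\ell}\mathcal V(\partial)$ are called rational matrix pseudodifferential operators with coefficients in $\mathcal V$. Throughout, $(\lambda+\partial)^n$, $n\in\mathbb Z$, is expanded in non-negative powers of $\partial$: $(\lambda+\partial)^n=\sum_{j\ge0}\binom nj\lambda^{n-j}\partial^j$. A non-local $\lambda$-bracket on the differential algebra $\mathcal V$ is a linear map $\{\cdot\,_\lambda\,\cdot\}:\mathcal V\otimes\mathcal V\to\mathcal V((\lambda^{-1}))$ such that $\{\partial a_\lambda b\}=-\lambda\{a_\lambda b\}$, $\{a_\lambda\partial b\}=(\lambda+\partial)\{a_\lambda b\}$, $\{a_\lambda bc\}=b\{a_\lambda c\}+c\{a_\lambda b\}$, $\{ab_\lambda c\}=\{a_{\lambda+\partial}c\}_\to b+\{b_{\lambda+\partial}c\}_\to a$, where if $\{a_\lambda c\}=\sum_n d_n\lambda^n$ then $\{a_{\lambda+\partial}c\}_\to b=\sum_n d_n(\lambda+\partial)^nb$. It is skewsymmetric if $\{b_\lambda a\}=-\{a_{-\lambda-\partial}b\}$, where for $\{a_\lambda b\}=\sum c_n\lambda^n$ one sets $\{a_{-\lambda-\partial}b\}=\sum(-\lambda-\partial)^nc_n$. For a vector space $V$, $V_{\lambda,\mu}=V[[\lambda^{-1},\mu^{-1},(\lambda+\mu)^{-1}]][\lambda,\mu]$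 is the quotient of $V[[\lambda^{-1},\mu^{-1},\nu^{-1}]][\lambda,\mu,\nu]$ by $(\nu-\lambda-\mu)V[[\lambda^{-1},\mu^{-1},\nu^{-1}]][\lambda,\mu,\nu]$. It embeds in $V((\lambda^{-1}))((\mu^{-1}))$ (expanding negative powers of $\lambda+\mu$ for $|\mu|>|\lambda|$), in $V((\mu^{-1}))((\lambda^{-1}))$ (for $|\lambda|>|\mu|$), and in $V(((\lambda+\mu)^{-1}))((\lambda^{-1}))$ (expanding negative powers of $\mu=(\lambda+\mu)-\lambda$ for $|\lambda|>|\lambda+\mu|$). Brackets with Laurent series are taken coefficientwise: $\{a_\lambda\{b_\mu c\}\}\in\mathcal V((\lambda^{-1}))((\mu^{-1}))$, $\{b_\mu\{a_\lambda c\}\}\in\mathcal V((\mu^{-1}))((\lambda^{-1}))$, $\{\{a_\lambda b\}_{\lambda+\mu}c\}\in\mathcal V(((\lambda+\mu)^{-1}))((\lambda^{-1}))$. The $\lambda$-bracket is admissible if $\{a_\lambda\{b_\mu c\}\}\in\mathcal V_{\lambda,\mu}$ (viewed inside $\mathcal V((\lambda^{-1}))((\mu^{-1}))$) for all $a,b,c$; for a skewsymmetric admissible bracket the other two expressions also lie in $\mathcal V_{\lambda,\mu}$ via the corresponding embeddings, and the Jacobi identity is an identity in $\mathcal V_{\lambda,\mu}$. *)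

theory Defs
  imports
    "HOL-Analysis.Finite_Cartesian_Product"
    "HOL-Computational_Algebra.Formal_Laurent_Series"
    "HOL-Computational_Algebra.Fraction_Field"
    "HOL-Computational_Algebra.Polynomial_Factorial"
    "HOL-Library.Poly_Mapping"
    "HOL-Library.Groups_Big_Fun"
begin

section \<open>The algebra of differential polynomials\<close>

text \<open>
  Differential polynomials over \<open>'f\<close> in the variables \<open>u i\<close> with \<open>i :: 'i\<close>: the polynomial
  ring in the variables \<open>u i n\<close>, indexed by pairs \<open>(i, n)\<close>.  The finite type \<open>'i\<close> plays the
  role of the index set \<open>I\<close>, so that the number of variables is \<open>CARD('i)\<close>.
\<close>

type_synonym ('i, 'f) diff_poly = "('i \<times> nat \<Rightarrow>\<^sub>0 nat) \<Rightarrow>\<^sub>0 'f"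

definition dp_const :: "'f \<Rightarrow> ('i, 'f::field_char_0) diff_poly" where
  "dp_const c = Poly_Mapping.single 0 c"

definition dp_var :: "'i \<Rightarrow> nat \<Rightarrow> ('i, 'f::field_char_0) diff_poly" where
  "dp_var i n = Poly_Mapping.single (Poly_Mapping.single (i, n) 1) 1"

definition dp_partial :: "'i \<Rightarrow> nat \<Rightarrow> ('i, 'f::field_char_0) diff_poly \<Rightarrow> ('i, 'f) diff_poly" where
  "dp_partial i n p = (\<Sum>m\<in>Poly_Mapping.keys p.
     Poly_Mapping.single (m - Poly_Mapping.single (i, n) 1)
       (of_nat (Poly_Mapping.lookup m (i, n)) * Poly_Mapping.lookup p m))"

text \<open>The derivation sending \<open>u i n\<close> to \<open>u i (n + 1)\<close>; the sum runs over the variables occurring in \<open>p\<close>.\<close>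

definition dp_deriv :: "('i, 'f::field_char_0) diff_poly \<Rightarrow> ('i, 'f) diff_poly" where
  "dp_deriv p = (\<Sum>(i, n)\<in>(\<Union>m\<in>Poly_Mapping.keys p. Poly_Mapping.keys m).
     dp_var i (Suc n) * dp_partial i n p)"

lemma dp_deriv_var: "dp_deriv (dp_var i n) = (dp_var i (Suc n) :: ('i, 'f::field_char_0) diff_poly)"
  by (simp add: dp_deriv_def dp_var_def dp_partial_def mult_single)


section \<open>Algebras of differential functions\<close>

definition derivation :: "('f::field \<Rightarrow> 'v::comm_ring_1 \<Rightarrow> 'v) \<Rightarrow> ('v \<Rightarrow> 'v) \<Rightarrow> bool" where
  "derivation scl d \<longleftrightarrow>
     Vector_Spaces.linear scl scl d \<and> (\<forall>a b. d (a * b) = d a * b + a * d b)"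

locale differential_algebra = vector_space scl
  for scl :: "'f::field_char_0 \<Rightarrow> 'v::comm_ring_1 \<Rightarrow> 'v" +
  fixes D :: "'v \<Rightarrow> 'v"
  assumes scl_mult: "scl c (a * b) = scl c a * b"
    and derivation_D: "derivation scl D"

text \<open>
  The extension of the differential polynomial ring is given by an embedding \<open>\<iota>\<close>, and
  \<open>pd i n\<close> is the derivation extending the partial derivative with respect to \<open>u i n\<close>.
\<close>

locale algebra_of_differential_functions = differential_algebra scl D
  for scl :: "'f::field_char_0 \<Rightarrow> 'v::comm_ring_1 \<Rightarrow> 'v" and D :: "'v \<Rightarrow> 'v" +
  fixes \<iota> :: "('i::finite, 'f) diff_poly \<Rightarrow> 'v"
    and pd :: "'i \<Rightarrow> nat \<Rightarrow> 'v \<Rightarrow> 'v"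
  assumes inj_\<iota>: "inj \<iota>"
    and \<iota>_const: "\<iota> (dp_const c) = scl c 1"
    and \<iota>_add: "\<iota> (p + q) = \<iota> p + \<iota> q"
    and \<iota>_mult: "\<iota> (p * q) = \<iota> p * \<iota> q"
    and \<iota>_deriv: "\<iota> (dp_deriv p) = D (\<iota> p)"
    and derivation_pd: "derivation scl (pd i n)"
    and \<iota>_partial: "\<iota> (dp_partial i n p) = pd i n (\<iota> p)"
    and pd_commute: "pd i n (pd j m f) = pd j m (pd i n f)"
    and finite_pd: "finite {(i, n). pd i n f \<noteq> 0}"
    and pd_D: "pd i n (D f) - D (pd i n f) = (if n = 0 then 0 else pd i (n - 1) f)"


section \<open>Laurent series in the inverse of a variable\<close>

text \<open>
  A series in \<open>V((\<lambda>\<inverse>))\<close> is a formal Laurent series \<open>'v fls\<close> whose variable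
  \<^const>\<open>fls_X\<close> is \<open>\<lambda>\<inverse>\<close>.  Thus \<open>\<lambda>\<close> itself is \<^const>\<open>fls_X_inv\<close>, and the coefficient of
  \<open>\<lambda>\<close> to the power \<open>n\<close> is stored at index \<open>-n\<close>.
\<close>

definition lcoef :: "'a::zero fls \<Rightarrow> int \<Rightarrow> 'a" where
  "lcoef A n = fls_nth A (- n)"

definition lseries :: "(int \<Rightarrow> 'a::zero) \<Rightarrow> 'a fls" where
  "lseries c = Abs_fls (\<lambda>n. c (- n))"

lemma lcoef_lseries:
  assumes "\<And>n. N < n \<Longrightarrow> c n = 0"
  shows "lcoef (lseries c) n = c n"
  unfolding lcoef_def lseries_def
  by (subst nth_Abs_fls_lower_bound[of "- N"]) (use assms in auto)

lemma lcoef_bound: "\<exists>N. \<forall>n>N. lcoef A n = 0"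
proof -
  obtain N where "\<forall>n<N. fls_nth A n = 0"
    by (rule fls_nth_vanishes_belowE)
  then show ?thesis
    by (intro exI[of _ "- N"]) (auto simp: lcoef_def)
qed

lemma lseries_eqI: "(\<And>n. lcoef A n = lcoef B n) \<Longrightarrow> A = B"
  unfolding lcoef_def by (metis fls_eqI minus_minus)

definition fls_map :: "('a::zero \<Rightarrow> 'b::zero) \<Rightarrow> 'a fls \<Rightarrow> 'b fls" where
  "fls_map f A = lseries (\<lambda>n. f (lcoef A n))"

lemma lcoef_fls_map: "f 0 = 0 \<Longrightarrow> lcoef (fls_map f A) n = f (lcoef A n)"
  unfolding fls_map_def using lcoef_bound[of A] by (metis (mono_tags, lifting) lcoef_lseries)


section \<open>Pseudodifferential operators\<close>

text \<open>
  Binomial coefficients with integer upper argument, as integers (the division is exact), so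
  that they act on rings that are not fields.
\<close>

definition ibinom :: "int \<Rightarrow> nat \<Rightarrow> int" where
  "ibinom m j = (\<Prod>i=0..<j. m - int i) div fact j"

lemma of_int_ibinom: "(of_int (ibinom m j) :: 'a::field_char_0) = of_int m gchoose j"
proof -
  have *: "fact j dvd (\<Prod>i=0..<j. m - int i)"
    using fact_dvd_pochhammer[of j "m - int j + 1"] by (simp only: falling_fact_pochhammer')
  have "(of_int (ibinom m j) :: 'a) * fact j = of_int (ibinom m j * fact j)"
    by simp
  also have "\<dots> = (\<Prod>i=0..<j. of_int m - of_nat i)"
    using * by (simp add: ibinom_def)
  also have "\<dots> = (of_int m gchoose j) * fact j"
    by (simp add: gbinomial_mult_fact')
  finally show ?thesis by simp
qed

lemma ibinom_0 [simp]: "ibinom m 0 = 1"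
  by (simp add: ibinom_def)

lemma ibinom_Suc: "ibinom (m + 1) (Suc j) = ibinom m j + ibinom m (Suc j)"
proof -
  have "(of_int (ibinom (m + 1) (Suc j)) :: rat) = of_int (ibinom m j + ibinom m (Suc j))"
    unfolding of_int_add of_int_ibinom by (simp add: gbinomial_Suc_Suc)
  then show ?thesis by (simp only: of_int_eq_iff)
qed

text \<open>
  A pseudodifferential operator is identified with its symbol, so it is a series of type
  \<open>'v fls\<close> with \<^const>\<open>fls_X_inv\<close> in the role of \<open>\<partial>\<close>.  The multiplication of the type \<open>'v fls\<close>
  is the commutative one of symbols; composition of operators is \<open>psdo_mult\<close>, obtained by
  expanding \<open>a\<partial>\<^sup>m \<circ> b\<partial>\<^sup>n = \<Sum>j\<ge>0. binom(m,j) a b\<^bsup>(j)\<^esup> \<partial>\<^bsup>m+n-j\<^esup>\<close>.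
  Since \<open>(\<lambda>+\<partial>)\<^sup>m (b\<lambda>\<^sup>n) = \<Sum>j\<ge>0. binom(m,j) b\<^bsup>(j)\<^esup> \<lambda>\<^bsup>m+n-j\<^esup>\<close>, the same operation gives \<open>A(\<lambda>+\<partial>)F\<close>
  for \<open>A\<close> and \<open>F\<close> in \<open>V((\<lambda>\<inverse>))\<close>, that is, a series in \<open>\<lambda>+\<partial>\<close> with coefficients on the
  left applied to \<open>F\<close>; \<open>at_lambda_plus\<close> is its name in that reading.
\<close>

definition psdo_index :: "'a::zero fls \<Rightarrow> 'b::zero fls \<Rightarrow> int \<Rightarrow> (int \<times> int) set" where
  "psdo_index A B k = {(m, n). lcoef A m \<noteq> 0 \<and> lcoef B n \<noteq> 0 \<and> k \<le> m + n}"

definition psdo_mult :: "('a::comm_ring_1 \<Rightarrow> 'a) \<Rightarrow> 'a fls \<Rightarrow> 'a fls \<Rightarrow> 'a fls" where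
  "psdo_mult D A B = lseries (\<lambda>k::int.
     \<Sum>(m, n)\<in>psdo_index A B k.
       of_int (ibinom m (nat (m + n - k))) * lcoef A m * (D ^^ nat (m + n - k)) (lcoef B n))"

abbreviation at_lambda_plus :: "('a::comm_ring_1 \<Rightarrow> 'a) \<Rightarrow> 'a fls \<Rightarrow> 'a fls \<Rightarrow> 'a fls" where
  "at_lambda_plus D A F \<equiv> psdo_mult D A F"

lemma psdo_index_finite: "finite (psdo_index A B k)"
proof -
  obtain M N where MN: "\<forall>m>M. lcoef A m = 0" "\<forall>n>N. lcoef B n = 0"
    using lcoef_bound by metis
  have "psdo_index A B k \<subseteq> {k - N..M} \<times> {k - M..N}"
    unfolding psdo_index_def
  proof clarify
    fix m n assume "lcoef A m \<noteq> 0" "lcoef B n \<noteq> 0" "k \<le> m + n"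
    then have "m \<le> M" "n \<le> N" using MN by (meson not_less)+
    with \<open>k \<le> m + n\<close> show "m \<in> {k - N..M} \<and> n \<in> {k - M..N}" by auto
  qed
  then show ?thesis by (rule finite_subset) simp
qed

lemma lcoef_psdo_mult:
  "lcoef (psdo_mult D A B) k =
     (\<Sum>(m, n)\<in>psdo_index A B k.
       of_int (ibinom m (nat (m + n - k))) * lcoef A m * (D ^^ nat (m + n - k)) (lcoef B n))"
proof -
  obtain M N where MN: "\<forall>m>M. lcoef A m = 0" "\<forall>n>N. lcoef B n = 0"
    using lcoef_bound by metis
  have empty: "psdo_index A B k = {}" if "M + N < k" for k
  proof -
    have False if "lcoef A m \<noteq> 0" "lcoef B n \<noteq> 0" "k \<le> m + n" for m n
    proof -
      have "m \<le> M" "n \<le> N" using MN that by (meson not_less)+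
      then show False using \<open>M + N < k\<close> \<open>k \<le> m + n\<close> by linarith
    qed
    then show ?thesis by (auto simp: psdo_index_def)
  qed
  then show ?thesis
    unfolding psdo_mult_def by (subst lcoef_lseries[where N = "M + N"]) simp_all
qed

text \<open>
  The adjoint, \<open>(a\<partial>\<^sup>n)\<^sup>* = (-\<partial>)\<^sup>n \<circ> a\<close>.  On symbols it maps \<open>\<Sum>n. c\<^sub>n \<lambda>\<^sup>n\<close> to \<open>\<Sum>n. (-\<lambda>-\<partial>)\<^sup>n c\<^sub>n\<close>, so it
  also gives the substitution of \<open>-\<lambda>-\<partial>\<close> for \<open>\<lambda>\<close> (with \<open>\<partial>\<close> acting on the coefficients),
  \<open>at_minus_lambda_minus\<close>.
\<close>

definition psdo_adj :: "('a::comm_ring_1 \<Rightarrow> 'a) \<Rightarrow> 'a fls \<Rightarrow> 'a fls" where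
  "psdo_adj D A = lseries (\<lambda>k::int. \<Sum>n | lcoef A n \<noteq> 0 \<and> k \<le> n.
     (- 1) ^ nat \<bar>n\<bar> * of_int (ibinom n (nat (n - k))) * (D ^^ nat (n - k)) (lcoef A n))"

abbreviation at_minus_lambda_minus :: "('a::comm_ring_1 \<Rightarrow> 'a) \<Rightarrow> 'a fls \<Rightarrow> 'a fls" where
  "at_minus_lambda_minus D F \<equiv> psdo_adj D F"

lemma psdo_adj_index_finite:
  fixes A :: "'a::zero fls"
  shows "finite {n. lcoef A n \<noteq> 0 \<and> k \<le> n}"
proof -
  obtain N where "\<forall>n>N. lcoef A n = 0" using lcoef_bound by metis
  then have "{n. lcoef A n \<noteq> 0 \<and> k \<le> n} \<subseteq> {k..N}" by (auto simp: not_less[symmetric])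
  then show ?thesis by (rule finite_subset) simp
qed

lemma lcoef_psdo_adj:
  "lcoef (psdo_adj D A) k = (\<Sum>n | lcoef A n \<noteq> 0 \<and> k \<le> n.
     (- 1) ^ nat \<bar>n\<bar> * of_int (ibinom n (nat (n - k))) * (D ^^ nat (n - k)) (lcoef A n))"
proof -
  obtain N where "\<forall>n>N. lcoef A n = 0" using lcoef_bound by metis
  then have empty: "{n. lcoef A n \<noteq> 0 \<and> k \<le> n} = {}" if "N < k" for k using that by auto
  show ?thesis
    unfolding psdo_adj_def by (rule lcoef_lseries[where N = N]) (simp only: empty sum.empty)
qed

definition psdo_mat_adj :: "('a::comm_ring_1 \<Rightarrow> 'a) \<Rightarrow> 'a fls ^ 'i ^ 'i \<Rightarrow> 'a fls ^ 'i ^ 'i" where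
  "psdo_mat_adj D H = (\<chi> i j. psdo_adj D (H $ j $ i))"

definition skewadjoint :: "('a::comm_ring_1 \<Rightarrow> 'a) \<Rightarrow> 'a fls ^ 'i ^ 'i \<Rightarrow> bool" where
  "skewadjoint D H \<longleftrightarrow> psdo_mat_adj D H = - H"


section \<open>Rational pseudodifferential operators\<close>

text \<open>The extension of a derivation to the field of fractions, by the quotient rule.\<close>

definition fract_deriv :: "('a::idom \<Rightarrow> 'a) \<Rightarrow> 'a fract \<Rightarrow> 'a fract" where
  "fract_deriv D q = (THE r. \<exists>a b. b \<noteq> 0 \<and> q = Fract a b \<and> r = Fract (D a * b - a * D b) (b * b))"

definition subskewfield :: "('k::field \<Rightarrow> 'k) \<Rightarrow> 'k fls set \<Rightarrow> bool" where
  "subskewfield D S \<longleftrightarrow>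
     1 \<in> S \<and>
     (\<forall>A\<in>S. \<forall>B\<in>S. A - B \<in> S \<and> psdo_mult D A B \<in> S) \<and>
     (\<forall>A\<in>S. A \<noteq> 0 \<longrightarrow> (\<exists>B\<in>S. psdo_mult D A B = 1 \<and> psdo_mult D B A = 1))"

definition differential_operators :: "'a::zero fls set" where
  "differential_operators = {A. \<forall>n<0. lcoef A n = 0}"

definition rational_psdo_fract :: "('a::idom \<Rightarrow> 'a) \<Rightarrow> 'a fract fls set" where
  "rational_psdo_fract D =
     \<Inter> {S. subskewfield (fract_deriv D) S \<and> fls_map to_fract ` differential_operators \<subseteq> S}"

definition rational_psdo :: "('a::idom \<Rightarrow> 'a) \<Rightarrow> 'a fls set" where
  "rational_psdo D = {A. fls_map to_fract A \<in> rational_psdo_fract D}"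

definition rational_mat_psdo :: "('a::idom \<Rightarrow> 'a) \<Rightarrow> ('a fls ^ 'i ^ 'i) set" where
  "rational_mat_psdo D = {H. \<forall>i j. H $ i $ j \<in> rational_psdo D}"


section \<open>Non-local lambda-brackets\<close>

definition nonlocal_lambda_bracket ::
    "('f::field \<Rightarrow> 'v::comm_ring_1 \<Rightarrow> 'v) \<Rightarrow> ('v \<Rightarrow> 'v) \<Rightarrow> ('v \<Rightarrow> 'v \<Rightarrow> 'v fls) \<Rightarrow> bool" where
  "nonlocal_lambda_bracket scl D br \<longleftrightarrow>
     (\<forall>a. Vector_Spaces.linear scl (\<lambda>c. fls_map (scl c)) (\<lambda>b. br a b)) \<and>
     (\<forall>b. Vector_Spaces.linear scl (\<lambda>c. fls_map (scl c)) (\<lambda>a. br a b)) \<and>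
     (\<forall>a b. br (D a) b = - (fls_X_inv * br a b)) \<and>
     (\<forall>a b. br a (D b) = at_lambda_plus D fls_X_inv (br a b)) \<and>
     (\<forall>a b c. br a (b * c) = fls_const b * br a c + fls_const c * br a b) \<and>
     (\<forall>a b c. br (a * b) c =
        at_lambda_plus D (br a c) (fls_const b) + at_lambda_plus D (br b c) (fls_const a))"

definition skewsymmetric_bracket :: "('v::comm_ring_1 \<Rightarrow> 'v) \<Rightarrow> ('v \<Rightarrow> 'v \<Rightarrow> 'v fls) \<Rightarrow> bool" where
  "skewsymmetric_bracket D br \<longleftrightarrow> (\<forall>a b. br b a = - at_minus_lambda_minus D (br a b))"


section \<open>The space of series in lambda, mu and lambda + mu\<close>

text \<open>
  \<open>V[[\<lambda>\<inverse>,\<mu>\<inverse>,\<nu>\<inverse>]][\<lambda>,\<mu>,\<nu>]\<close>: the value at \<open>a b c\<close> is the coefficient of \<open>\<lambda>\<^sup>a \<mu>\<^sup>b \<nu>\<^sup>c\<close>, where the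
  exponents of each variable are bounded above.
\<close>

typedef (overloaded) 'v tri_series =
  "{f :: int \<Rightarrow> int \<Rightarrow> int \<Rightarrow> 'v::ab_group_add. \<exists>N. \<forall>a b c. N < a \<or> N < b \<or> N < c \<longrightarrow> f a b c = 0}"
  morphisms tcoef Abs_tri_series
  by (rule exI[of _ "\<lambda>_ _ _. 0"]) simp

setup_lifting type_definition_tri_series

lemma tri_bounds_max:
  assumes "\<exists>N::int. \<forall>a b c. N < a \<or> N < b \<or> N < c \<longrightarrow> f a b c = z"
    and "\<exists>N::int. \<forall>a b c. N < a \<or> N < b \<or> N < c \<longrightarrow> g a b c = w"
  shows "\<exists>N::int. \<forall>a b c. N < a \<or> N < b \<or> N < c \<longrightarrow> f a b c = z \<and> g a b c = w"
proof -
  obtain M N where "\<forall>a b c. M < a \<or> M < b \<or> M < c \<longrightarrow> f a b c = z"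
      "\<forall>a b c. N < a \<or> N < b \<or> N < c \<longrightarrow> g a b c = w"
    using assms by blast
  then show ?thesis by (intro exI[of _ "max M N"]) auto
qed

instantiation tri_series :: (ab_group_add) ab_group_add
begin

lift_definition zero_tri_series :: "'a tri_series" is "\<lambda>_ _ _. 0" by simp

lift_definition plus_tri_series :: "'a tri_series \<Rightarrow> 'a tri_series \<Rightarrow> 'a tri_series"
  is "\<lambda>f g a b c. f a b c + g a b c"
  subgoal for f g using tri_bounds_max[of f 0 g 0] by (elim exE) (metis add.right_neutral)
  done

lift_definition uminus_tri_series :: "'a tri_series \<Rightarrow> 'a tri_series" is "\<lambda>f a b c. - f a b c"
  by simp

lift_definition minus_tri_series :: "'a tri_series \<Rightarrow> 'a tri_series \<Rightarrow> 'a tri_series"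
  is "\<lambda>f g a b c. f a b c - g a b c"
  subgoal for f g using tri_bounds_max[of f 0 g 0] by (elim exE) (metis diff_zero)
  done

instance
  by (standard; transfer) (auto simp: fun_eq_iff algebra_simps)

end

text \<open>Multiplication by \<open>\<nu> - \<lambda> - \<mu>\<close>.\<close>

lift_definition tri_rel :: "'a::ab_group_add tri_series \<Rightarrow> 'a tri_series"
  is "\<lambda>h a b c. h a b (c - 1) - h (a - 1) b c - h a (b - 1) c"
proof -
  fix h :: "int \<Rightarrow> int \<Rightarrow> int \<Rightarrow> 'a"
  assume "\<exists>N. \<forall>a b c. N < a \<or> N < b \<or> N < c \<longrightarrow> h a b c = 0"
  then obtain N where "\<forall>a b c. N < a \<or> N < b \<or> N < c \<longrightarrow> h a b c = 0" by blast
  then show "\<exists>N. \<forall>a b c. N < a \<or> N < b \<or> N < c \<longrightarrow>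
      h a b (c - 1) - h (a - 1) b c - h a (b - 1) c = 0"
    by (intro exI[of _ "N + 1"]) auto
qed

lemma tri_rel_add: "tri_rel (f + g) = tri_rel f + tri_rel g"
  by transfer (simp add: fun_eq_iff)

lemma tri_rel_minus: "tri_rel (- f) = - tri_rel f"
  by transfer (simp add: fun_eq_iff)

lemma tri_rel_0: "tri_rel 0 = 0"
  by transfer (simp add: fun_eq_iff)

definition tri_equiv :: "'a::ab_group_add tri_series \<Rightarrow> 'a tri_series \<Rightarrow> bool" where
  "tri_equiv f g \<longleftrightarrow> (\<exists>h. f - g = tri_rel h)"

lemma equivp_tri_equiv: "equivp (tri_equiv :: 'a::ab_group_add tri_series \<Rightarrow> _)"
proof (rule equivpI)
  show "reflp (tri_equiv :: 'a tri_series \<Rightarrow> _)"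
    by (metis tri_equiv_def reflpI diff_self tri_rel_0)
  show "symp (tri_equiv :: 'a tri_series \<Rightarrow> _)"
    by (metis tri_equiv_def sympI minus_diff_eq tri_rel_minus)
  show "transp (tri_equiv :: 'a tri_series \<Rightarrow> _)"
  proof (rule transpI)
    fix f g k :: "'a tri_series"
    assume "tri_equiv f g" "tri_equiv g k"
    then obtain h h' where "f - g = tri_rel h" "g - k = tri_rel h'"
      by (auto simp: tri_equiv_def)
    then have "(f - g) + (g - k) = tri_rel (h + h')"
      by (simp only: tri_rel_add)
    then show "tri_equiv f k" by (auto simp: tri_equiv_def)
  qed
qed

text \<open>\<open>'v lm_space\<close> is the space \<open>V\<^bsub>\<lambda>,\<mu>\<^esub>\<close>.\<close>

quotient_type (overloaded) 'v lm_space = "'v::ab_group_add tri_series" / tri_equiv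
  by (rule equivp_tri_equiv)

instantiation lm_space :: (ab_group_add) ab_group_add
begin

lift_definition zero_lm_space :: "'a lm_space" is 0 .

lift_definition plus_lm_space :: "'a lm_space \<Rightarrow> 'a lm_space \<Rightarrow> 'a lm_space" is "(+)"
  unfolding tri_equiv_def by (metis tri_rel_add add_diff_add)

lift_definition uminus_lm_space :: "'a lm_space \<Rightarrow> 'a lm_space" is uminus
  unfolding tri_equiv_def by (metis tri_rel_minus minus_diff_minus)

lift_definition minus_lm_space :: "'a lm_space \<Rightarrow> 'a lm_space \<Rightarrow> 'a lm_space" is "(-)"
  unfolding tri_equiv_def
  by (metis (no_types, opaque_lifting) tri_rel_add tri_rel_minus add_diff_add minus_diff_minus
      diff_conv_add_uminus)

instance
proof
  fix a b c :: "'a lm_space"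
  show "a + b + c = a + (b + c)"
    by transfer (simp add: add.assoc equivp_reflp[OF equivp_tri_equiv])
  show "a + b = b + a"
    by transfer (simp add: add.commute equivp_reflp[OF equivp_tri_equiv])
  show "0 + a = a" by transfer (simp add: equivp_reflp[OF equivp_tri_equiv])
  show "- a + a = 0" by transfer (simp add: equivp_reflp[OF equivp_tri_equiv])
  show "a - b = a + - b" by transfer (simp add: equivp_reflp[OF equivp_tri_equiv])
qed

end


text \<open>
  \<open>xy_expand G p q\<close> is the coefficient of \<open>x\<^sup>p y\<^sup>q\<close> in the series \<open>\<Sum>a b c. G a b c x\<^sup>a y\<^sup>b (x+y)\<^sup>c\<close>,
  where \<open>(x+y)\<^sup>c = \<Sum>k\<ge>0. binom(c,k) x\<^sup>k y\<^bsup>c-k\<^esup>\<close>.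
\<close>

definition xy_expand :: "(int \<Rightarrow> int \<Rightarrow> int \<Rightarrow> 'v::comm_ring_1) \<Rightarrow> int \<Rightarrow> int \<Rightarrow> 'v" where
  "xy_expand G p q =
     (\<Sum>(k, c)\<in>{(k, c). G (p - int k) (q + int k - c) c \<noteq> 0}.
        of_int (ibinom c k) * G (p - int k) (q + int k - c) c)"

definition tri_bounded :: "int \<Rightarrow> (int \<Rightarrow> int \<Rightarrow> int \<Rightarrow> 'v::zero) \<Rightarrow> bool" where
  "tri_bounded N G \<longleftrightarrow> (\<forall>a b c. N < a \<or> N < b \<or> N < c \<longrightarrow> G a b c = 0)"

lemma tri_bounded_mono: "tri_bounded M G \<Longrightarrow> M \<le> N \<Longrightarrow> tri_bounded N G"
  unfolding tri_bounded_def by (meson le_less_trans)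

lemma tri_bounded_tcoef: "\<exists>N. tri_bounded N (tcoef f)"
  unfolding tri_bounded_def using tcoef[of f] by simp

lemma xy_expand_box:
  assumes "tri_bounded N G" "2 * N - q < int K" "L \<le> q - N" "N \<le> U"
  shows "xy_expand G p q =
    (\<Sum>k<K. \<Sum>c=L..U. of_int (ibinom c k) * G (p - int k) (q + int k - c) c)"
proof -
  have "{(k, c). G (p - int k) (q + int k - c) c \<noteq> 0} \<subseteq> {..<K} \<times> {L..U}"
  proof clarify
    fix k c assume "G (p - int k) (q + int k - c) c \<noteq> 0"
    then have "q + int k - c \<le> N" "c \<le> N"
      using assms(1) unfolding tri_bounded_def by (meson not_less)+
    then show "k \<in> {..<K} \<and> c \<in> {L..U}" using assms by auto
  qed
  then show ?thesis
    unfolding xy_expand_def sum.cartesian_product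
    by (intro sum.mono_neutral_left) auto
qed

lemma xy_expand_diff:
  assumes "tri_bounded M F" "tri_bounded N G"
  shows "xy_expand (\<lambda>a b c. F a b c - G a b c) p q = xy_expand F p q - xy_expand G p q"
proof -
  let ?N = "max M N"
  have b: "tri_bounded ?N F" "tri_bounded ?N G" "tri_bounded ?N (\<lambda>a b c. F a b c - G a b c)"
    using assms by (auto simp: tri_bounded_def)
  let ?K = "nat (2 * ?N - q) + 1"
  note box = xy_expand_box[where N = ?N and K = ?K and L = "q - ?N" and U = ?N]
  show ?thesis
    using b by (simp add: box sum_subtractf right_diff_distrib del: of_nat_Suc)
qed

lemma xy_expand_uminus: "xy_expand (\<lambda>a b c. - G a b c) p q = - xy_expand G p q"
  by (simp add: xy_expand_def sum_negf case_prod_unfold)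

lemma xy_expand_eq_0: 
  assumes "tri_bounded N G" and "2 * N < q \<or> N + nat (2 * N - q) < p"
  shows "xy_expand G p q = 0"
proof -
  have "G (p - int k) (q + int k - c) c = 0" for k c
  proof (rule ccontr)
    assume "G (p - int k) (q + int k - c) c \<noteq> 0"
    then have "p - int k \<le> N" "q + int k - c \<le> N" "c \<le> N"
      using assms(1) unfolding tri_bounded_def by (meson not_less)+
    then show False using assms(2) by auto
  qed
  then show ?thesis by (simp add: xy_expand_def)
qed

lemma xy_expand_rel:
  assumes "tri_bounded N G"
  shows "xy_expand (\<lambda>a b c. G a b (c - 1) - G (a - 1) b c - G a (b - 1) c) p q = 0"
proof -
  let ?R = "\<lambda>a b c. G a b (c - 1) - G (a - 1) b c - G a (b - 1) c"
  have zero: "G a b c = 0" if "N < a \<or> N < b \<or> N < c" for a b c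
    using assms that unfolding tri_bounded_def by blast
  have R: "tri_bounded (N + 1) ?R"
    by (simp add: tri_bounded_def zero)
  define K where "K = nat (2 * N - q) + 3"
  define L where "L = q - N - 2"
  define U where "U = N + 2"
  define g1 where "g1 k c = G (p - int k) (q + int k - c - 1) c" for k c
  define g2 where "g2 k c = G (p - int k - 1) (q + int k - c) c" for k c
  have K: "2 * N - q + 2 < int K" "0 < K" unfolding K_def by auto
  have g2_Suc: "g1 (Suc k) c = g2 k c" for k c
    by (simp add: g1_def g2_def algebra_simps)
  have g2_K: "g2 k c = 0" if "K = Suc k" for k c
    unfolding g2_def by (rule zero) (use K that in auto)
  have shift: "(\<Sum>c=L..U. of_int (ibinom c k) * G (p - int k) (q + int k - c) (c - 1)) =
      (\<Sum>c=L..U. of_int (ibinom (c + 1) k) * g1 k c)" for k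
  proof -
    have "(\<Sum>c=L..U. of_int (ibinom c k) * G (p - int k) (q + int k - c) (c - 1)) =
        (\<Sum>c=L-1..U-1. of_int (ibinom (c + 1) k) * g1 k c)"
      by (rule sum.reindex_bij_witness[of _ "\<lambda>c. c + 1" "\<lambda>c. c - 1"])
        (auto simp: g1_def algebra_simps)
    also have "\<dots> = (\<Sum>c=L-1..U. of_int (ibinom (c + 1) k) * g1 k c)"
      by (rule sum.mono_neutral_left) (auto simp: g1_def U_def zero)
    also have "\<dots> = (\<Sum>c=L..U. of_int (ibinom (c + 1) k) * g1 k c)"
      by (rule sum.mono_neutral_right) (auto simp: g1_def L_def zero)
    finally show ?thesis .
  qed
  obtain K' where K': "K = Suc K'" using K by (cases K) auto
  have "(\<Sum>k<K. \<Sum>c=L..U. of_int (ibinom (c + 1) k) * g1 k c) =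
      (\<Sum>c=L..U. g1 0 c) + (\<Sum>k<K'. \<Sum>c=L..U. of_int (ibinom (c + 1) (Suc k)) * g1 (Suc k) c)"
    unfolding K' sum.lessThan_Suc_shift by simp
  also have "\<dots> = (\<Sum>c=L..U. g1 0 c) +
      (\<Sum>k<K'. \<Sum>c=L..U. of_int (ibinom c (Suc k)) * g1 (Suc k) c) +
      (\<Sum>k<K'. \<Sum>c=L..U. of_int (ibinom c k) * g2 k c)"
    by (simp add: ibinom_Suc g2_Suc distrib_right sum.distrib)
  also have "(\<Sum>c=L..U. g1 0 c) + (\<Sum>k<K'. \<Sum>c=L..U. of_int (ibinom c (Suc k)) * g1 (Suc k) c) =
      (\<Sum>k<K. \<Sum>c=L..U. of_int (ibinom c k) * g1 k c)"
    unfolding K' sum.lessThan_Suc_shift by simp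
  also have "(\<Sum>k<K'. \<Sum>c=L..U. of_int (ibinom c k) * g2 k c) =
      (\<Sum>k<K. \<Sum>c=L..U. of_int (ibinom c k) * g2 k c)"
    unfolding K' by (simp add: g2_K[OF K'])
  finally have pascal: "(\<Sum>k<K. \<Sum>c=L..U. of_int (ibinom (c + 1) k) * g1 k c) =
      (\<Sum>k<K. \<Sum>c=L..U. of_int (ibinom c k) * g1 k c) +
      (\<Sum>k<K. \<Sum>c=L..U. of_int (ibinom c k) * g2 k c)" .
  have "xy_expand ?R p q =
      (\<Sum>k<K. \<Sum>c=L..U. of_int (ibinom c k) * ?R (p - int k) (q + int k - c) c)"
    by (rule xy_expand_box[OF R]) (use K in \<open>auto simp: L_def U_def\<close>)
  also have "\<dots> = (\<Sum>k<K. \<Sum>c=L..U. of_int (ibinom c k) * G (p - int k) (q + int k - c) (c - 1)) -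
      (\<Sum>k<K. \<Sum>c=L..U. of_int (ibinom c k) * g2 k c) -
      (\<Sum>k<K. \<Sum>c=L..U. of_int (ibinom c k) * g1 k c)"
    by (simp add: right_diff_distrib sum_subtractf g1_def g2_def)
  also have "\<dots> = 0"
    unfolding shift pascal by simp
  finally show ?thesis .
qed

text \<open>
  The expansions of a series in \<open>\<lambda>\<close>, \<open>\<mu>\<close> and \<open>\<nu> = \<lambda>+\<mu>\<close>.  In a type \<open>'v fls fls\<close> the outer
  series is in the inverse of the second variable of \<open>V((x\<inverse>))((y\<inverse>))\<close>, and the coefficients are
  series in the inverse of the first one.

  \<^item> \<open>tri_lm\<close> takes values in \<open>V((\<lambda>\<inverse>))((\<mu>\<inverse>))\<close>, with \<open>\<nu> = \<lambda>+\<mu>\<close> expanded for \<open>|\<mu>| > |\<lambda>|\<close>;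
  \<^item> \<open>tri_ml\<close> takes values in \<open>V((\<mu>\<inverse>))((\<lambda>\<inverse>))\<close>, with \<open>\<nu> = \<mu>+\<lambda>\<close> expanded for \<open>|\<lambda>| > |\<mu>|\<close>;
  \<^item> \<open>tri_nl\<close> takes values in \<open>V((\<nu>\<inverse>))((\<lambda>\<inverse>))\<close>, with \<open>\<mu> = \<nu>+(-\<lambda>)\<close> expanded for \<open>|\<lambda>| > |\<nu>|\<close>.

  In the last case \<open>\<lambda>\<^sup>a = (-1)\<^sup>a (-\<lambda>)\<^sup>a\<close>, whence the two signs.
\<close>

definition tri_lm :: "'v::comm_ring_1 tri_series \<Rightarrow> 'v fls fls" where
  "tri_lm f = lseries (\<lambda>q. lseries (\<lambda>p. xy_expand (\<lambda>a b c. tcoef f a b c) p q))"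

definition tri_ml :: "'v::comm_ring_1 tri_series \<Rightarrow> 'v fls fls" where
  "tri_ml f = lseries (\<lambda>p. lseries (\<lambda>q. xy_expand (\<lambda>b a c. tcoef f a b c) q p))"

definition tri_nl :: "'v::comm_ring_1 tri_series \<Rightarrow> 'v fls fls" where
  "tri_nl f = lseries (\<lambda>p. lseries (\<lambda>r.
     (- 1) ^ nat \<bar>p\<bar> * xy_expand (\<lambda>c a b. (- 1) ^ nat \<bar>a\<bar> * tcoef f a b c) r p))"

lemma tri_bounded_perm:
  assumes "tri_bounded N (tcoef f)"
  shows "tri_bounded N (\<lambda>b a c. tcoef f a b c)"
    and "tri_bounded N (\<lambda>c a b. (- 1) ^ nat \<bar>a\<bar> * tcoef f a b c :: 'v::comm_ring_1)"
  using assms by (auto simp: tri_bounded_def)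

lemma lcoef_lseries2:
  assumes "tri_bounded N G"
  shows "lcoef (lcoef (lseries (\<lambda>q. lseries (\<lambda>p. s q * xy_expand G p q))) q) p = s q * xy_expand G p q"
proof -
  have "lseries (\<lambda>p. s q * xy_expand G p q) = 0" if "2 * N < q" for q
    using xy_expand_eq_0[OF assms] that
    by (intro lseries_eqI) (simp add: lcoef_lseries, simp add: lcoef_def)
  then have "lcoef (lseries (\<lambda>q. lseries (\<lambda>p. s q * xy_expand G p q))) q =
      lseries (\<lambda>p. s q * xy_expand G p q)"
    by (rule lcoef_lseries)
  moreover have "lcoef (lseries (\<lambda>p. s q * xy_expand G p q)) p = s q * xy_expand G p q"
    using xy_expand_eq_0[OF assms] by (intro lcoef_lseries[where N = "N + nat (2 * N - q)"]) simp
  ultimately show ?thesis by simp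
qed

lemma lcoef_tri_lm: "lcoef (lcoef (tri_lm f) q) p = xy_expand (tcoef f) p q"
proof -
  obtain N where "tri_bounded N (tcoef f)" using tri_bounded_tcoef by blast
  from lcoef_lseries2[OF this, where s = "\<lambda>_. 1"] show ?thesis
    unfolding tri_lm_def by simp
qed

lemma lcoef_tri_ml: "lcoef (lcoef (tri_ml f) p) q = xy_expand (\<lambda>b a c. tcoef f a b c) q p"
proof -
  obtain N where "tri_bounded N (tcoef f)" using tri_bounded_tcoef by blast
  from lcoef_lseries2[OF tri_bounded_perm(1)[OF this], where s = "\<lambda>_. 1"] show ?thesis
    unfolding tri_ml_def by simp
qed

lemma lcoef_tri_nl: "lcoef (lcoef (tri_nl f) p) r =
    (- 1) ^ nat \<bar>p\<bar> * xy_expand (\<lambda>c a b. (- 1) ^ nat \<bar>a\<bar> * tcoef f a b c) r p"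
proof -
  obtain N where "tri_bounded N (tcoef f)" using tri_bounded_tcoef by blast
  from lcoef_lseries2[OF tri_bounded_perm(2)[OF this], where s = "\<lambda>p. (- 1) ^ nat \<bar>p\<bar>"]
  show ?thesis unfolding tri_nl_def .
qed

lemma minus_one_power_pred: "(- 1 :: 'v::comm_ring_1) ^ nat \<bar>a - 1\<bar> = - ((- 1) ^ nat \<bar>a\<bar>)"
  by (auto simp: minus_one_power_iff even_nat_iff)

lemma xy_expand_equiv:
  fixes f g :: "'v::comm_ring_1 tri_series"
  assumes "tri_equiv f g"
  shows "xy_expand (\<lambda>a b c. tcoef f a b c) p q = xy_expand (\<lambda>a b c. tcoef g a b c) p q"
    and "xy_expand (\<lambda>b a c. tcoef f a b c) p q = xy_expand (\<lambda>b a c. tcoef g a b c) p q"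
    and "xy_expand (\<lambda>c a b. (- 1) ^ nat \<bar>a\<bar> * tcoef f a b c) p q =
      xy_expand (\<lambda>c a b. (- 1) ^ nat \<bar>a\<bar> * tcoef g a b c) p q"
proof -
  obtain h where "f - g = tri_rel h" using assms by (auto simp: tri_equiv_def)
  then have *: "tcoef f a b c - tcoef g a b c =
      tcoef h a b (c - 1) - tcoef h (a - 1) b c - tcoef h a (b - 1) c" for a b c
    by (metis minus_tri_series.rep_eq tri_rel.rep_eq)
  obtain F where F: "tri_bounded F (tcoef f)" using tri_bounded_tcoef by blast
  obtain G where G: "tri_bounded G (tcoef g)" using tri_bounded_tcoef by blast
  obtain N where N: "tri_bounded N (tcoef h)" using tri_bounded_tcoef by blast
  show "xy_expand (\<lambda>a b c. tcoef f a b c) p q = xy_expand (\<lambda>a b c. tcoef g a b c) p q"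
    using xy_expand_diff[OF F G, of p q] xy_expand_rel[OF N, of p q] by (simp add: *)
  show "xy_expand (\<lambda>b a c. tcoef f a b c) p q = xy_expand (\<lambda>b a c. tcoef g a b c) p q"
    using xy_expand_diff[OF tri_bounded_perm(1)[OF F] tri_bounded_perm(1)[OF G], of p q]
      xy_expand_rel[OF tri_bounded_perm(1)[OF N], of p q]
    by (simp add: * algebra_simps)
  have "(- 1) ^ nat \<bar>a\<bar> * tcoef f a b c - (- 1) ^ nat \<bar>a\<bar> * tcoef g a b c =
      - ((- 1) ^ nat \<bar>a\<bar> * tcoef h a (b - 1) c - (- 1) ^ nat \<bar>a\<bar> * tcoef h a b (c - 1) -
         (- 1) ^ nat \<bar>a - 1\<bar> * tcoef h (a - 1) b c)" for a b c
    unfolding right_diff_distrib[symmetric] * minus_one_power_pred by (simp add: algebra_simps)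
  then show "xy_expand (\<lambda>c a b. (- 1) ^ nat \<bar>a\<bar> * tcoef f a b c) p q =
      xy_expand (\<lambda>c a b. (- 1) ^ nat \<bar>a\<bar> * tcoef g a b c) p q"
    using xy_expand_diff[OF tri_bounded_perm(2)[OF F] tri_bounded_perm(2)[OF G], of p q]
      xy_expand_rel[OF tri_bounded_perm(2)[OF N], of p q]
    by (simp add: xy_expand_uminus del: minus_diff_eq)
qed

lift_definition embed_lm :: "'v::comm_ring_1 lm_space \<Rightarrow> 'v fls fls" is tri_lm
  unfolding tri_lm_def by (simp only: xy_expand_equiv(1))

lift_definition embed_ml :: "'v::comm_ring_1 lm_space \<Rightarrow> 'v fls fls" is tri_ml
  unfolding tri_ml_def by (simp only: xy_expand_equiv(2))

lift_definition embed_nl :: "'v::comm_ring_1 lm_space \<Rightarrow> 'v fls fls" is tri_nl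
  unfolding tri_nl_def by (simp only: xy_expand_equiv(3))


section \<open>Admissibility and the Jacobi identity\<close>

text \<open>
  The three double brackets, of types \<open>V((\<lambda>\<inverse>))((\<mu>\<inverse>))\<close>, \<open>V((\<mu>\<inverse>))((\<lambda>\<inverse>))\<close> and \<open>V((\<nu>\<inverse>))((\<lambda>\<inverse>))\<close>
  with \<open>\<nu> = \<lambda>+\<mu>\<close>: \<open>{a\<^sub>\<lambda> {b\<^sub>\<mu> c}}\<close>, \<open>{b\<^sub>\<mu> {a\<^sub>\<lambda> c}}\<close> and \<open>{{a\<^sub>\<lambda> b}\<^bsub>\<lambda>+\<mu>\<^esub> c}\<close>.
\<close>

definition bracket_lm :: "('v \<Rightarrow> 'v \<Rightarrow> 'v fls) \<Rightarrow> 'v::comm_ring_1 \<Rightarrow> 'v \<Rightarrow> 'v \<Rightarrow> 'v fls fls" where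
  "bracket_lm br a b c = fls_map (\<lambda>d. br a d) (br b c)"

definition bracket_ml :: "('v \<Rightarrow> 'v \<Rightarrow> 'v fls) \<Rightarrow> 'v::comm_ring_1 \<Rightarrow> 'v \<Rightarrow> 'v \<Rightarrow> 'v fls fls" where
  "bracket_ml br a b c = fls_map (\<lambda>d. br b d) (br a c)"

definition bracket_nl :: "('v \<Rightarrow> 'v \<Rightarrow> 'v fls) \<Rightarrow> 'v::comm_ring_1 \<Rightarrow> 'v \<Rightarrow> 'v \<Rightarrow> 'v fls fls" where
  "bracket_nl br a b c = fls_map (\<lambda>d. br d c) (br a b)"

definition admissible_bracket :: "('v::comm_ring_1 \<Rightarrow> 'v \<Rightarrow> 'v fls) \<Rightarrow> bool" where
  "admissible_bracket br \<longleftrightarrow> (\<forall>a b c. bracket_lm br a b c \<in> range embed_lm)"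

text \<open>
  The identity is one between the elements of \<open>V\<^bsub>\<lambda>,\<mu>\<^esub>\<close> represented by the three double brackets.
\<close>

definition jacobi_identity ::
    "('v::comm_ring_1 \<Rightarrow> 'v \<Rightarrow> 'v fls) \<Rightarrow> 'v \<Rightarrow> 'v \<Rightarrow> 'v \<Rightarrow> bool" where
  "jacobi_identity br a b c \<longleftrightarrow>
     (\<exists>P Q R. embed_lm P = bracket_lm br a b c \<and> embed_ml Q = bracket_ml br a b c \<and>
        embed_nl R = bracket_nl br a b c \<and> P - Q = R)"

definition poisson_bracket ::
    "('f::field \<Rightarrow> 'v::comm_ring_1 \<Rightarrow> 'v) \<Rightarrow> ('v \<Rightarrow> 'v) \<Rightarrow> ('v \<Rightarrow> 'v \<Rightarrow> 'v fls) \<Rightarrow> bool" where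
  "poisson_bracket scl D br \<longleftrightarrow>
     nonlocal_lambda_bracket scl D br \<and> skewsymmetric_bracket D br \<and> admissible_bracket br \<and>
     (\<forall>a b c. jacobi_identity br a b c)"


section \<open>The bracket associated with a matrix pseudodifferential operator\<close>

text \<open>
  The summand of the master formula,
  \<open>\<partial>g/\<partial>u\<^sub>j\<^bsup>(n)\<^esup> (\<lambda>+\<partial>)\<^sup>n H\<^sub>j\<^sub>i(\<lambda>+\<partial>) (-\<lambda>-\<partial>)\<^sup>m \<partial>f/\<partial>u\<^sub>i\<^bsup>(m)\<^esup>\<close>.
\<close>

definition master_term :: "('v::comm_ring_1 \<Rightarrow> 'v) \<Rightarrow> ('i \<Rightarrow> nat \<Rightarrow> 'v \<Rightarrow> 'v) \<Rightarrow> 'v fls ^ 'i ^ 'i \<Rightarrow>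
    'v \<Rightarrow> 'v \<Rightarrow> 'i \<Rightarrow> 'i \<Rightarrow> nat \<Rightarrow> nat \<Rightarrow> 'v fls" where
  "master_term D pd H f g i j m n =
     fls_const (pd j n g) *
       at_lambda_plus D (fls_X_inv ^ n)
         (at_lambda_plus D (H $ j $ i)
           (at_lambda_plus D ((- fls_X_inv) ^ m) (fls_const (pd i m f))))"

text \<open>\<^const>\<open>Sum_any\<close> is the sum over all \<open>m\<close> and \<open>n\<close> of a family with finite support.\<close>

definition master_bracket :: "('v::comm_ring_1 \<Rightarrow> 'v) \<Rightarrow> ('i::finite \<Rightarrow> nat \<Rightarrow> 'v \<Rightarrow> 'v) \<Rightarrow>
    'v fls ^ 'i ^ 'i \<Rightarrow> 'v \<Rightarrow> 'v \<Rightarrow> 'v fls" where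
  "master_bracket D pd H f g =
     (\<Sum>i\<in>UNIV. \<Sum>j\<in>UNIV. Sum_any (\<lambda>(m, n). master_term D pd H f g i j m n))"

end

theory Submission
  imports Defs
begin

text \<open>
  With \<open>L\<^sub>j(g) = \<Sum>n. \<partial>g/\<partial>u\<^sub>j\<^bsup>(n)\<^esup> \<partial>\<^sup>n\<close> the master formula reads \<open>{f\<^sub>\<lambda> g} = \<Sum>i j. L\<^sub>j(g) \<circ> H\<^sub>j\<^sub>i \<circ> L\<^sub>i(f)\<^sup>*\<close>, so the axioms of a
  bracket and the equivalence of skewsymmetry with \<open>H\<^sup>* = -H\<close> follow from the associativity of the composition
  and the antimultiplicativity of the adjoint.

  For fixed \<open>a\<close> the map \<open>X = {a\<^sub>\<lambda> \<cdot>}\<close> is a derivation with \<open>X(\<partial>b) = (\<lambda>+\<partial>)X(b)\<close>; it extends to the field of fractions,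
  and \<open>X(A \<circ> B) = X(A)(\<lambda>,\<mu>+\<partial>)B(\<mu>) + A(\<lambda>+\<mu>+\<partial>)X(B)(\<mu>)\<close>.  The space of series in \<open>\<lambda>\<close>, \<open>\<mu>\<close>, \<open>\<lambda>+\<mu>\<close> is stable under the
  two actions of operators occurring here.  Hence the operators \<open>A\<close> for which \<open>X(A)\<close> lies in that space form a
  skewfield containing the differential operators, so they include all rational operators, in particular \<open>{b\<^sub>\<mu> c}\<close>.

  For a skewsymmetric bracket, the Jacobi identity for \<open>a, b, c\<close> is preserved by permutations: exchanging \<open>a\<close> and \<open>b\<close>
  exchanges \<open>\<lambda>\<close> and \<open>\<mu>\<close>, and exchanging \<open>b\<close> and \<open>c\<close> substitutes \<open>-\<lambda>-\<mu>-\<partial>\<close> for \<open>\<mu>\<close>.  Since the master formula derives it for all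
  \<open>c\<close> from the case where \<open>c\<close> is a generator, it propagates from the generators to all arguments.
\<close>

text \<open>Two obstacles shape the development. Operators are infinite series, so identities
  between them cannot be expanded as finite sums. However, each coefficient of a composite depends
  on finitely many coefficients of its arguments, so an additive identity can be tested on
  monomials. Moreover \<lambda>+\<partial> is injective on Laurent series in the inverse of
  \<lambda>, so an identity for one power passes to the next lower one by cancellation, which
  reaches the negative powers.

  The other obstacle is that V_{\<lambda>,\<mu>} is a quotient with three expansions, in which
  different variables dominate. Each symmetry is therefore realised on representatives by an
  operation that preserves multiples of \<nu>-\<lambda>-\<mu>, and is then matched with an operation
  on every expansion. These operations are again compositions and adjoints, but with \<partial>
  replaced by \<lambda>+\<partial>, by the coefficientwise \<partial>, or by multiplication by
  -\<nu>. Hence \<open>psdo_mult\<close> and \<open>psdo_adj\<close> are studied for additive maps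
  in place of a single derivation, with mixed Leibniz rules relating several of them.\<close>

lemma lcoef_0 [simp]: "lcoef 0 n = 0"
  by (simp add: lcoef_def)

lemma lcoef_add [simp]: "lcoef (A + B) n = lcoef A n + lcoef B n"
  by (simp add: lcoef_def)

lemma lcoef_diff [simp]: "lcoef (A - B) n = lcoef A n - lcoef B n"
  by (simp add: lcoef_def)

lemma lcoef_uminus [simp]: "lcoef (- A) n = - lcoef A n"
  by (simp add: lcoef_def)

lemma lcoef_sum: "lcoef (\<Sum>i\<in>I. A i) n = (\<Sum>i\<in>I. lcoef (A i) n)"
  by (induction I rule: infinite_finite_induct) auto

lemma lcoef_const: "lcoef (fls_const a) n = (if n = 0 then a else 0)"
  by (simp add: lcoef_def fls_const_nth)

lemma lcoef_1: "lcoef 1 n = (if n = 0 then 1 else 0)"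
  by (simp add: lcoef_def)

lemma lcoef_const_mult [simp]:
  "lcoef (fls_const a * A) n = (a :: 'a::comm_ring_1) * lcoef A n"
  by (simp add: lcoef_def fls_mult_const_nth)

lemma lcoef_X_inv_mult [simp]:
  "lcoef (fls_X_inv * A) n = lcoef (A :: 'a::comm_ring_1 fls) (n - 1)"
  by (simp add: lcoef_def fls_X_inv_times_conv_shift)

section \<open>Monomials, degree bounds and the locality principle\<close>

definition lmonom :: "'a::zero \<Rightarrow> int \<Rightarrow> 'a fls" where
  "lmonom a m = fls_shift m (fls_const a)"

lemma lcoef_lmonom [simp]: "lcoef (lmonom a m) n = (if n = m then a else 0)"
  by (auto simp: lmonom_def lcoef_def)

lemma lmonom_0 [simp]: "lmonom 0 m = 0"
  by (rule lseries_eqI) simp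

lemma lmonom_const: "lmonom a 0 = fls_const a"
  by (rule lseries_eqI) (simp add: lcoef_const)

lemma lmonom_eq_const_mult: "lmonom a m = fls_const a * lmonom (1 :: 'a::comm_ring_1) m"
  by (rule lseries_eqI) simp

lemma X_inv_lmonom: "fls_X_inv * lmonom a m = lmonom (a :: 'a::comm_ring_1) (m + 1)"
  by (rule lseries_eqI) auto

lemma lmonom_X_inv: "fls_X_inv = lmonom (1 :: 'a::comm_ring_1) 1"
  using X_inv_lmonom[of "1 :: 'a" 0] by (simp add: lmonom_const)

lemma lmonom_X_inv_power: "fls_X_inv ^ n = lmonom (1 :: 'a::comm_ring_1) (int n)"
  by (induction n) (auto simp: lmonom_const X_inv_lmonom add.commute)

lemma X_inv_mult_cancel [simp]:
  "fls_X_inv * A = fls_X_inv * B \<longleftrightarrow> A = (B :: 'a::comm_ring_1 fls)"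
proof
  assume *: "fls_X_inv * A = fls_X_inv * B"
  show "A = B"
  proof (rule lseries_eqI)
    fix n
    show "lcoef A n = lcoef B n"
      using arg_cong[OF *, of "\<lambda>C. lcoef C (n + 1)"] by simp
  qed
qed simp

definition lbound :: "int \<Rightarrow> 'a::zero fls \<Rightarrow> bool" where
  "lbound N A \<longleftrightarrow> (\<forall>n>N. lcoef A n = 0)"

lemma lbound_exists: "\<exists>N. lbound N A"
  using lcoef_bound[of A] by (simp add: lbound_def)

lemma lboundD: "lbound N A \<Longrightarrow> N < n \<Longrightarrow> lcoef A n = 0"
  by (auto simp: lbound_def)

lemma additive_lcoef: "additive (\<lambda>A. lcoef A n)"
  by (simp add: additive_def)

lemma additive_comp: "additive f \<Longrightarrow> additive g \<Longrightarrow> additive (\<lambda>x. f (g x))"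
  by (simp add: additive_def)

lemma additive_diff: "additive f \<Longrightarrow> additive g \<Longrightarrow> additive (\<lambda>x. f x - g x :: 'b::ab_group_add)"
  by (simp add: additive_def)

lemma additive_funpow: "additive f \<Longrightarrow> additive (f ^^ n)" for f :: "'a::ab_group_add \<Rightarrow> 'a"
  by (induction n) (auto simp: additive_def)

lemma additive_of_int_mult:
  fixes f :: "'a::comm_ring_1 \<Rightarrow> 'b::comm_ring_1"
  assumes "additive f"
  shows "f (of_int i * x) = of_int i * f x"
proof -
  interpret additive f by fact
  have n: "f (of_nat n * x) = of_nat n * f x" for n
    by (induction n) (auto simp: zero add distrib_right)
  then show ?thesis by (cases i rule: int_cases2) (auto simp: minus)
qed

lemma lmonom_decomp:
  assumes "lbound N A"
  obtains B where "lbound (e - 1) B" "A = (\<Sum>n=e..N. lmonom (lcoef A n) n) + (B :: 'a::ab_group_add fls)"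
proof
  let ?B = "A - (\<Sum>n=e..N. lmonom (lcoef A n) n)"
  show "A = (\<Sum>n=e..N. lmonom (lcoef A n) n) + ?B" by simp
  show "lbound (e - 1) ?B"
    using assms by (auto simp: lbound_def lcoef_sum not_le)
qed

text \<open>Above degree \<open>e\<close> a series has finitely many terms, so it is a finite sum of
  monomials plus a remainder that \<open>T\<close> kills. Additivity is then enough, and no
  convergence argument enters.\<close>

lemma fls_local_eq_0:
  fixes T :: "'a::ab_group_add fls \<Rightarrow> 'b::ab_group_add"
  assumes "additive T" "\<And>a m. T (lmonom a m) = 0" "\<And>A. lbound e A \<Longrightarrow> T A = 0"
  shows "T A = 0"
proof -
  interpret additive T by fact
  obtain N where "lbound N A" using lbound_exists by blast
  then obtain B where "lbound (e + 1 - 1) B" and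
    A: "A = (\<Sum>n=e+1..N. lmonom (lcoef A n) n) + B"
    by (rule lmonom_decomp)
  from A have "T A = T (\<Sum>n=e+1..N. lmonom (lcoef A n) n) + T B"
    using add by metis
  then show ?thesis
    using assms(2,3) \<open>lbound (e + 1 - 1) B\<close> by (simp add: sum)
qed

lemma fls_local_eq:
  fixes S T :: "'a::ab_group_add fls \<Rightarrow> 'b::ab_group_add"
  assumes "additive S" "additive T" "\<And>a m. S (lmonom a m) = T (lmonom a m)"
    and "\<And>A. lbound e A \<Longrightarrow> S A = 0" "\<And>A. lbound e A \<Longrightarrow> T A = 0"
  shows "S A = T A"
  using fls_local_eq_0[OF additive_diff[OF assms(1,2)], of e A] assms(3-) by simp

text \<open>The form suits exponents: the upward step applies an operator such as
  \<lambda>+\<partial>, and the downward step cancels it by injectivity.\<close>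

lemma int_up_down [case_names 0 up down]:
  fixes n :: int
  assumes "P 0" "\<And>n. P n \<Longrightarrow> P (n + 1)" "\<And>n. P (n + 1) \<Longrightarrow> P n"
  shows "P n"
proof (induction n rule: int_induct[where k = 0])
  case (step2 i) then show ?case using assms(3)[of "i - 1"] by simp
qed (use assms in auto)

lemma lcoef_fls_map_additive: "additive f \<Longrightarrow> lcoef (fls_map f A) n = f (lcoef A n)"
  by (simp add: lcoef_fls_map additive.zero)

lemma additive_fls_map: "additive f \<Longrightarrow> additive (fls_map f)"
  by (auto simp: additive_def lcoef_fls_map_additive[unfolded additive_def] intro!: lseries_eqI)

lemma fls_map_comp:
  "additive f \<Longrightarrow> additive g \<Longrightarrow> fls_map f (fls_map g A) = fls_map (\<lambda>x. f (g x)) A"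
  by (rule lseries_eqI) (simp add: lcoef_fls_map_additive additive_comp)

lemma fls_map_lmonom: "additive f \<Longrightarrow> fls_map f (lmonom a m) = lmonom (f a) m"
  by (rule lseries_eqI) (auto simp: lcoef_fls_map_additive additive.zero)

lemma fls_map_const: "additive f \<Longrightarrow> fls_map f (fls_const a) = fls_const (f a)"
  by (metis fls_map_lmonom lmonom_const)

lemma fls_map_X_inv_mult:
  "additive f \<Longrightarrow> fls_map f (fls_X_inv * A) = fls_X_inv * fls_map f A"
  for f :: "'a::comm_ring_1 \<Rightarrow> 'b::comm_ring_1"
  by (rule lseries_eqI) (simp add: lcoef_fls_map_additive)

lemma fls_map_const_mult:
  "additive f \<Longrightarrow> (\<And>b. f (a * b) = c * f b) \<Longrightarrow>
    fls_map f (fls_const a * A) = fls_const c * fls_map f A"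
  for f :: "'a::comm_ring_1 \<Rightarrow> 'b::comm_ring_1"
  by (rule lseries_eqI) (simp add: lcoef_fls_map_additive)

section \<open>Composition of symbols\<close>

text \<open>Replaces the support of the two factors by a rectangle with free sides \<open>L\<close>,
  \<open>U\<close>, \<open>J\<close>, so that different products can be compared over one index set.
  The index \<open>j\<close> is the number of derivatives falling on \<open>B\<close>.\<close>

lemma lcoef_psdo_mult_box:
  assumes D: "additive D" and A: "lbound M A" and B: "lbound N B"
    and "L \<le> k - N" "M \<le> U" "M + N - k < int J"
  shows "lcoef (psdo_mult D A B) k =
    (\<Sum>m=L..U. \<Sum>j<J. of_int (ibinom m j) * lcoef A m * (D ^^ j) (lcoef B (k - m + int j)))"
proof -
  let ?g = "\<lambda>(m, j). of_int (ibinom m j) * lcoef A m * (D ^^ j) (lcoef B (k - m + int j))"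
  let ?S = "{(m, j). lcoef A m \<noteq> 0 \<and> lcoef B (k - m + int j) \<noteq> 0}"
  have sub: "?S \<subseteq> {L..U} \<times> {..<J}"
  proof clarify
    fix m j assume "lcoef A m \<noteq> 0" "lcoef B (k - m + int j) \<noteq> 0"
    then have "m \<le> M" "k - m + int j \<le> N"
      using A B by (meson lboundD not_less)+
    then show "m \<in> {L..U} \<and> j \<in> {..<J}" using assms(4-) by auto
  qed
  have "lcoef (psdo_mult D A B) k = sum ?g ?S"
    unfolding lcoef_psdo_mult psdo_index_def
    by (rule sum.reindex_bij_witness[of _ "\<lambda>(m, j). (m, k - m + int j)" "\<lambda>(m, n). (m, nat (m + n - k))"])
      auto
  also have "\<dots> = sum ?g ({L..U} \<times> {..<J})"
    by (rule sum.mono_neutral_left[OF _ sub])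
      (use additive.zero[OF additive_funpow[OF D]] in auto)
  finally show ?thesis by (simp add: sum.cartesian_product)
qed

lemma lbound_psdo_mult:
  assumes D: "additive D" and A: "lbound M A" and B: "lbound N B"
  shows "lbound (M + N) (psdo_mult D A B)"
  unfolding lbound_def
proof clarify
  fix k assume k: "M + N < k"
  show "lcoef (psdo_mult D A B) k = 0"
    by (subst lcoef_psdo_mult_box[OF D A B, of "k - N" k M 0]) (use k in auto)
qed

lemma psdo_mult_add_left:
  assumes D: "additive D"
  shows "psdo_mult D (A + A') B = psdo_mult D A B + psdo_mult D A' B"
proof (rule lseries_eqI)
  fix k
  obtain M M' N where b: "lbound M A" "lbound M' A'" "lbound N B"
    using lbound_exists by metis
  define m where "m = max M M'"
  have b: "lbound m A" "lbound m A'" "lbound m (A + A')" "lbound N B"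
    using b by (auto simp: m_def lbound_def)
  note box = lcoef_psdo_mult_box[OF D, where k = k and L = "k - N" and U = m and J = "nat (m + N - k) + 1" and M = m and N = N]
  show "lcoef (psdo_mult D (A + A') B) k = lcoef (psdo_mult D A B + psdo_mult D A' B) k"
    using b by (simp add: box algebra_simps sum.distrib)
qed

lemma psdo_mult_add_right:
  assumes D: "additive D"
  shows "psdo_mult D A (B + B') = psdo_mult D A B + psdo_mult D A B'"
proof (rule lseries_eqI)
  fix k
  obtain M M' N where b: "lbound M B" "lbound M' B'" "lbound N A"
    using lbound_exists by metis
  define m where "m = max M M'"
  have b: "lbound m B" "lbound m B'" "lbound m (B + B')" "lbound N A"
    using b by (auto simp: m_def lbound_def)
  note box = lcoef_psdo_mult_box[OF D, where k = k and L = "k - m" and U = N and J = "nat (m + N - k) + 1" and M = N and N = m]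
  show "lcoef (psdo_mult D A (B + B')) k = lcoef (psdo_mult D A B + psdo_mult D A B') k"
    using b by (simp add: box algebra_simps sum.distrib additive.add[OF additive_funpow[OF D]])
qed

lemma additive_psdo_mult_left: "additive D \<Longrightarrow> additive (\<lambda>A. psdo_mult D A B)"
  by (simp add: additive_def psdo_mult_add_left[unfolded additive_def])

lemma additive_psdo_mult_right: "additive D \<Longrightarrow> additive (psdo_mult D A)"
  by (simp add: additive_def psdo_mult_add_right[unfolded additive_def])

lemma lcoef_psdo_mult_lmonom:
  assumes D: "additive D" and B: "lbound N B" and "m + N - k < int J"
  shows "lcoef (psdo_mult D (lmonom a m) B) k =
    a * (\<Sum>j<J. of_int (ibinom m j) * (D ^^ j) (lcoef B (k - m + int j)))"
proof -
  define L where "L = min m (k - N)"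
  have *: "lbound m (lmonom a m)" by (simp add: lbound_def)
  have "(\<Sum>i=L..m. \<Sum>j<J. of_int (ibinom i j) * lcoef (lmonom a m) i * (D ^^ j) (lcoef B (k - i + int j)))
    = (\<Sum>i\<in>{m}. \<Sum>j<J. of_int (ibinom i j) * lcoef (lmonom a m) i * (D ^^ j) (lcoef B (k - i + int j)))"
    by (rule sum.mono_neutral_right) (auto simp: L_def)
  then show ?thesis
    by (subst lcoef_psdo_mult_box[OF D * B, of L k m J])
      (use assms(3) in \<open>auto simp: L_def sum_distrib_left mult_ac\<close>)
qed

lemma ibinom_0_left: "ibinom 0 j = (if j = 0 then 1 else 0)"
proof -
  have "(of_int (ibinom 0 j) :: rat) = of_int (if j = 0 then 1 else 0)"
    unfolding of_int_ibinom by (cases j) auto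
  then show ?thesis by (simp only: of_int_eq_iff)
qed

lemma psdo_mult_const_left:
  assumes "additive D"
  shows "psdo_mult D (fls_const a) B = fls_const a * B"
proof (rule lseries_eqI)
  fix k
  obtain N where N: "lbound N B" using lbound_exists by blast
  have "(\<Sum>j<nat (N - k) + 1. of_int (ibinom 0 j) * (D ^^ j) (lcoef B (k + int j))) =
     (\<Sum>j\<in>{0}. of_int (ibinom 0 j) * (D ^^ j) (lcoef B (k + int j)))"
    by (rule sum.mono_neutral_right) (auto simp: ibinom_0_left)
  then show "lcoef (psdo_mult D (fls_const a) B) k = lcoef (fls_const a * B) k"
    unfolding lmonom_const[symmetric]
    by (subst lcoef_psdo_mult_lmonom[OF assms N, of _ _ "nat (N - k) + 1"])
      (auto simp: lmonom_const)
qed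

lemma psdo_mult_1_left: "additive D \<Longrightarrow> psdo_mult D 1 B = B"
  using psdo_mult_const_left[of D 1 B] by simp

lemma psdo_mult_lmonom_const:
  assumes "additive D"
  shows "psdo_mult D (lmonom (a * b) m) B = fls_const a * psdo_mult D (lmonom b m) B"
proof (rule lseries_eqI)
  fix k
  obtain N where N: "lbound N B" using lbound_exists by blast
  show "lcoef (psdo_mult D (lmonom (a * b) m) B) k = lcoef (fls_const a * psdo_mult D (lmonom b m) B) k"
    using lcoef_psdo_mult_lmonom[OF assms N, of m k "nat (m + N - k) + 1"]
    by (simp add: mult.assoc)
qed

text \<open>Pascal's rule: \<open>(\<lambda>+\<partial>)\<^bsup>m+1\<^esup> = (\<lambda>+\<partial>)\<^bsup>m\<^esup> (\<lambda>+\<partial>)\<close>, also for negative \<open>m\<close>.\<close>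

lemma psdo_mult_lmonom_Suc:
  assumes D: "additive D"
  shows "psdo_mult D (lmonom a (m + 1)) B = psdo_mult D (lmonom a m) (fls_X_inv * B + fls_map D B)"
proof (rule lseries_eqI)
  fix k
  obtain N where N: "lbound N B" using lbound_exists by blast
  define J where "J = nat (m + N + 1 - k) + 1"
  let ?d = "\<lambda>j. (D ^^ j) (lcoef B (k - m - 1 + int j))"
  interpret D: additive D by fact
  have idx: "k - m + int j - 1 = k - m - 1 + int j" "k - m - 1 + int (Suc j) = k - m + int j" for j
    by simp_all
  have N': "lbound (N + 1) (fls_X_inv * B + fls_map D B)"
    using N by (auto simp: lbound_def lcoef_fls_map_additive D D.zero)
  have 1: "lcoef (psdo_mult D (lmonom a (m + 1)) B) k = a * (\<Sum>j<Suc J. of_int (ibinom (m + 1) j) * ?d j)"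
    by (subst lcoef_psdo_mult_lmonom[OF D N, of _ _ "Suc J"]) (auto simp: J_def algebra_simps)
  have 2: "lcoef (psdo_mult D (lmonom a m) (fls_X_inv * B + fls_map D B)) k =
      a * (\<Sum>j<J. of_int (ibinom m j) * (?d j + ?d (Suc j)))"
  proof -
    have "(D ^^ j) (lcoef (fls_X_inv * B + fls_map D B) (k - m + int j)) = ?d j + ?d (Suc j)" for j
      by (simp only: lcoef_add lcoef_X_inv_mult lcoef_fls_map_additive[OF D] idx
          additive.add[OF additive_funpow[OF D]] funpow_Suc_right o_apply)
    then show ?thesis
      by (subst lcoef_psdo_mult_lmonom[OF D N', of _ _ J]) (simp_all add: J_def)
  qed
  \<comment> \<open>\<open>J\<close> is chosen so that this index exceeds the degree of
    \<open>B\<close>; the sum can then be lengthened by one term before it is shifted.\<close>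
  have 3: "?d J = 0"
    using lboundD[OF N, of "k - m - 1 + int J"] additive.zero[OF additive_funpow[OF D], of J]
    by (simp add: J_def del: funpow.simps)
  have "(\<Sum>j<J. of_int (ibinom m j) * ?d j) = (\<Sum>j<Suc J. of_int (ibinom m j) * ?d j)"
    using 3 by simp
  also have "\<dots> = ?d 0 + (\<Sum>j<J. of_int (ibinom m (Suc j)) * ?d (Suc j))"
    by (subst sum.lessThan_Suc_shift) simp
  finally have 4: "(\<Sum>j<J. of_int (ibinom m j) * ?d j) = \<dots>" .
  have "(\<Sum>j<Suc J. of_int (ibinom (m + 1) j) * ?d j) =
      ?d 0 + (\<Sum>j<J. of_int (ibinom m j + ibinom m (Suc j)) * ?d (Suc j))"
    by (subst sum.lessThan_Suc_shift) (simp add: ibinom_Suc del: of_int_add)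
  also have "\<dots> = (\<Sum>j<J. of_int (ibinom m j) * ?d j) + (\<Sum>j<J. of_int (ibinom m j) * ?d (Suc j))"
    unfolding 4 by (simp add: distrib_right sum.distrib)
  also have "\<dots> = (\<Sum>j<J. of_int (ibinom m j) * (?d j + ?d (Suc j)))"
    by (simp add: distrib_left sum.distrib)
  finally show "lcoef (psdo_mult D (lmonom a (m + 1)) B) k =
      lcoef (psdo_mult D (lmonom a m) (fls_X_inv * B + fls_map D B)) k"
    unfolding 1 2 by simp
qed

lemma psdo_mult_X_inv:
  assumes D: "additive D"
  shows "psdo_mult D fls_X_inv B = fls_X_inv * B + fls_map D B"
  using psdo_mult_lmonom_Suc[OF D, of 1 0 B]
  by (simp add: lmonom_X_inv[symmetric] lmonom_const psdo_mult_1_left[OF D])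

lemma lcoef_psdo_mult_X_inv:
  "additive D \<Longrightarrow> lcoef (psdo_mult D fls_X_inv B) n = lcoef B (n - 1) + D (lcoef B n)"
  by (simp add: psdo_mult_X_inv lcoef_fls_map_additive)

text \<open>Beyond the degree bound all coefficients vanish, and the recurrence carries the zeros
  downwards.\<close>

lemma X_inv_plus_inj:
  fixes A :: "'a::comm_ring_1 fls"
  assumes "\<And>n. lcoef A (n - 1) = T (lcoef A n)" "T 0 = 0"
  shows "A = 0"
proof (rule lseries_eqI)
  fix n
  obtain N where N: "lbound N A" using lbound_exists by blast
  have "lcoef A (N + 1 - int i) = 0" for i
  proof (induction i)
    case 0 show ?case using N by (auto simp: lbound_def)
  next
    case (Suc i) show ?case using assms(1)[of "N + 1 - int i"] Suc assms(2) by (simp add: algebra_simps)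
  qed
  from this[of "nat (N + 1 - n)"] show "lcoef A n = lcoef 0 n"
    using N by (cases "n \<le> N + 1") (auto simp: lbound_def)
qed

lemma psdo_mult_X_inv_inj:
  assumes D: "additive D" and eq: "psdo_mult D fls_X_inv A = psdo_mult D fls_X_inv B"
  shows "A = B"
proof -
  interpret D: additive D by fact
  have *: "lcoef (A - B) (n - 1) = - D (lcoef (A - B) n)" for n
    using arg_cong[OF eq, of "\<lambda>C. lcoef C n"]
    by (simp add: lcoef_psdo_mult_X_inv[OF D] D.diff algebra_simps add_eq_0_iff)
  have "A - B = 0"
    by (rule X_inv_plus_inj[where T = "\<lambda>x. - D x", OF *]) (simp add: D.zero)
  then show ?thesis by simp
qed

text \<open>The expansion of (\<lambda>+\<partial>)^m has integer coefficients, so it commutes with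
  both \<lambda> and \<partial>.\<close>

lemma psdo_mult_commute_X_inv:
  assumes D: "additive D"
  shows "psdo_mult D (lmonom 1 m) (fls_X_inv * B) = fls_X_inv * psdo_mult D (lmonom 1 m) B"
    and "psdo_mult D (lmonom 1 m) (fls_map D B) = fls_map D (psdo_mult D (lmonom 1 m) B)"
proof -
  obtain N where N: "lbound N B" using lbound_exists by blast
  interpret D: additive D by fact
  have N': "lbound (N + 1) (fls_X_inv * B)" "lbound N (fls_map D B)"
    using N by (auto simp: lbound_def lcoef_fls_map_additive D D.zero)
  have J: "m + (N + 1) - k < int (nat (m + N + 1 - k) + 1)" "m + N - (k - 1) < int (nat (m + N + 1 - k) + 1)"
     "m + N - k < int (nat (m + N + 1 - k) + 1)" for k by auto
  show "psdo_mult D (lmonom 1 m) (fls_X_inv * B) = fls_X_inv * psdo_mult D (lmonom 1 m) B"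
  proof (rule lseries_eqI)
    fix k
    have "k - m + int j - 1 = k - 1 - m + int j" for j by simp
    then show "lcoef (psdo_mult D (lmonom 1 m) (fls_X_inv * B)) k = lcoef (fls_X_inv * psdo_mult D (lmonom 1 m) B) k"
      by (simp only: lcoef_psdo_mult_lmonom[OF D N'(1) J(1)[of k]] lcoef_psdo_mult_lmonom[OF D N J(2)[of k]]
          lcoef_X_inv_mult)
  qed
  show "psdo_mult D (lmonom 1 m) (fls_map D B) = fls_map D (psdo_mult D (lmonom 1 m) B)"
    by (rule lseries_eqI)
      (simp add: lcoef_psdo_mult_lmonom[OF D N'(2) J(3)] lcoef_psdo_mult_lmonom[OF D N J(3)]
        lcoef_fls_map_additive D D.add D.sum additive_of_int_mult funpow_swap1)
qed

lemma psdo_mult_lmonom_Suc':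
  assumes D: "additive D"
  shows "psdo_mult D (lmonom 1 (m + 1)) B = psdo_mult D fls_X_inv (psdo_mult D (lmonom 1 m) B)"
  unfolding psdo_mult_lmonom_Suc[OF D] psdo_mult_X_inv[OF D] psdo_mult_add_right[OF D]
    psdo_mult_commute_X_inv[OF D] ..

lemma psdo_mult_const_mult_left:
  assumes "additive D"
  shows "psdo_mult D (fls_const a * B) C = fls_const a * psdo_mult D B C"
proof (rule lseries_eqI)
  fix k
  obtain N where N: "lbound N C" using lbound_exists by blast
  obtain M where M: "lbound M B" using lbound_exists by blast
  have M': "lbound M (fls_const a * B)" using M by (simp add: lbound_def)
  define J where "J = nat (M + N - k) + 1"
  have J: "M + N - k < int J" by (simp add: J_def)
  have m: "x * (a * y) * z = a * (x * y * z)" for x y z :: 'a by (simp add: mult_ac)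
  show "lcoef (psdo_mult D (fls_const a * B) C) k = lcoef (fls_const a * psdo_mult D B C) k"
    by (simp only: lcoef_psdo_mult_box[OF assms M' N order_refl order_refl J] lcoef_const_mult
        lcoef_psdo_mult_box[OF assms M N order_refl order_refl J] m sum_distrib_left[symmetric])
qed

text \<open>
  The three derivations may differ, so that besides the composition of operators the lemma covers
  the actions of operators on modules with a connection.
\<close>

lemma psdo_mult_assoc:
  assumes P: "additive P" and Q: "additive Q" and R: "additive R"
    and leib: "\<And>b c. P (b * c) = R b * c + b * Q c"
  shows "psdo_mult P A (psdo_mult Q B C) = psdo_mult Q (psdo_mult R A B) C"
proof -
  \<comment> \<open>The case A = \<partial>. The Leibniz rule enters here; powers of \<partial> and
    then arbitrary \<open>A\<close> follow from this case.\<close>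
  have X: "psdo_mult P fls_X_inv (psdo_mult Q B C) = psdo_mult Q (psdo_mult R fls_X_inv B) C" for B C
  proof (rule lseries_eqI)
    fix k
    obtain N where N: "lbound N C" using lbound_exists by blast
    show "lcoef (psdo_mult P fls_X_inv (psdo_mult Q B C)) k =
      lcoef (psdo_mult Q (psdo_mult R fls_X_inv B) C) k"
    \<comment> \<open>The factor \<partial> raises the degree by one and \<open>C\<close> by at most
      \<open>N\<close>, so from this bound on \<open>B\<close> both sides have degree at most k -
      1.\<close>
    proof (rule fls_local_eq[where e = "k - N - 2" and A = B and
          S = "\<lambda>B. lcoef (psdo_mult P fls_X_inv (psdo_mult Q B C)) k" and
          T = "\<lambda>B. lcoef (psdo_mult Q (psdo_mult R fls_X_inv B) C) k"])
      fix b m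
      have "psdo_mult R fls_X_inv (lmonom b m) = lmonom b (m + 1) + lmonom (R b) m"
        by (simp add: psdo_mult_X_inv R X_inv_lmonom fls_map_lmonom)
      moreover have "psdo_mult P fls_X_inv (psdo_mult Q (lmonom b m) C) =
          psdo_mult Q (lmonom b (m + 1)) C + psdo_mult Q (lmonom (R b) m) C"
      proof -
        let ?Z = "psdo_mult Q (lmonom 1 m) C"
        have 2: "psdo_mult Q (lmonom y (m + 1)) C = fls_const y * psdo_mult Q fls_X_inv ?Z" for y
          using psdo_mult_lmonom_const[OF Q, of y 1] by (simp add: psdo_mult_lmonom_Suc'[OF Q])
        have Z: "psdo_mult Q (lmonom y m) C = fls_const y * ?Z" for y
          using psdo_mult_lmonom_const[OF Q, of y 1] by simp
        show ?thesis
          unfolding 2 Z[of b] Z[of "R b"] by (rule lseries_eqI)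
           (simp add: lcoef_psdo_mult_X_inv P Q leib algebra_simps)
      qed
      ultimately show "lcoef (psdo_mult P fls_X_inv (psdo_mult Q (lmonom b m) C)) k =
          lcoef (psdo_mult Q (psdo_mult R fls_X_inv (lmonom b m)) C) k"
        by (simp add: psdo_mult_add_left Q)
    next
      fix B :: "'a fls" assume B: "lbound (k - N - 2) B"
      have X: "lbound 1 (fls_X_inv :: 'a fls)" by (simp add: lbound_def lmonom_X_inv)
      show "lcoef (psdo_mult P fls_X_inv (psdo_mult Q B C)) k = 0"
        using lbound_psdo_mult[OF P X lbound_psdo_mult[OF Q B N]] by (rule lboundD) simp
      show "lcoef (psdo_mult Q (psdo_mult R fls_X_inv B) C) k = 0"
        using lbound_psdo_mult[OF Q lbound_psdo_mult[OF R X B] N] by (rule lboundD) simp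
    qed (auto intro!: additive_comp[OF additive_lcoef] additive_comp[OF additive_psdo_mult_right]
        additive_comp[OF additive_psdo_mult_left] additive_psdo_mult_left additive_psdo_mult_right P Q R)
  qed
  have mon: "psdo_mult P (lmonom 1 m) (psdo_mult Q B C) = psdo_mult Q (psdo_mult R (lmonom 1 m) B) C" for m
  proof (induction m rule: int_up_down)
    case 0
    show ?case by (simp add: lmonom_const psdo_mult_1_left P R)
  next
    case (up n)
    then show ?case by (simp add: psdo_mult_lmonom_Suc' P R X)
  next
    case (down n)
    then have "psdo_mult P fls_X_inv (psdo_mult P (lmonom 1 n) (psdo_mult Q B C)) =
        psdo_mult P fls_X_inv (psdo_mult Q (psdo_mult R (lmonom 1 n) B) C)"
      by (simp add: psdo_mult_lmonom_Suc' P R X)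
    then show ?case by (rule psdo_mult_X_inv_inj[OF P])
  qed
  show ?thesis
  proof (rule lseries_eqI)
    fix k
    obtain N where N: "lbound N C" using lbound_exists by blast
    obtain M where M: "lbound M B" using lbound_exists by blast
    show "lcoef (psdo_mult P A (psdo_mult Q B C)) k = lcoef (psdo_mult Q (psdo_mult R A B) C) k"
    proof (rule fls_local_eq[where e = "k - M - N - 1" and A = A and
          S = "\<lambda>A. lcoef (psdo_mult P A (psdo_mult Q B C)) k" and
          T = "\<lambda>A. lcoef (psdo_mult Q (psdo_mult R A B) C) k"])
      fix a m
      show "lcoef (psdo_mult P (lmonom a m) (psdo_mult Q B C)) k =
          lcoef (psdo_mult Q (psdo_mult R (lmonom a m) B) C) k"
        using psdo_mult_lmonom_const[OF P, of a 1] psdo_mult_lmonom_const[OF R, of a 1]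
        by (simp add: mon psdo_mult_const_mult_left Q)
    next
      fix A :: "'a fls" assume A: "lbound (k - M - N - 1) A"
      show "lcoef (psdo_mult P A (psdo_mult Q B C)) k = 0"
        using lbound_psdo_mult[OF P A lbound_psdo_mult[OF Q M N]] by (rule lboundD) simp
      show "lcoef (psdo_mult Q (psdo_mult R A B) C) k = 0"
        using lbound_psdo_mult[OF Q lbound_psdo_mult[OF R A M] N] by (rule lboundD) simp
    qed (auto intro!: additive_comp[OF additive_lcoef] additive_comp[OF additive_psdo_mult_right]
        additive_comp[OF additive_psdo_mult_left] additive_psdo_mult_left additive_psdo_mult_right P Q R)
  qed
qed

text \<open>Since D 1 = 0, every term with a derivative falling on the right factor vanishes;
  composing with \<partial>^n on the right only shifts exponents.\<close>

lemma psdo_mult_lmonom_right: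
  assumes D: "additive D" and D1: "D 1 = 0"
  shows "lcoef (psdo_mult D A (lmonom 1 n)) k = lcoef A (k - n)"
proof -
  obtain M where M: "lbound M A" using lbound_exists by blast
  \<comment> \<open>Raised to at least k - n so that the one surviving index lies in the range of
    summation.\<close>
  define U where "U = max M (k - n)"
  have U: "lbound U A" using M by (auto simp: lbound_def U_def)
  have N: "lbound n (lmonom (1 :: 'a) n)" by (simp add: lbound_def)
  define J where "J = nat (U + n - k) + 1"
  have J: "U + n - k < int J" by (simp add: J_def)
  have D_pow: "(D ^^ j) (if b then 1 else 0) = (if b \<and> j = 0 then 1 else 0)" for j b
    using additive.zero[OF additive_funpow[OF D]] additive.zero[OF D] D1
    by (cases b; cases j) (simp_all add: funpow_Suc_right del: funpow.simps(2))
  have "lcoef (psdo_mult D A (lmonom 1 n)) k =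
      (\<Sum>m=k-n..U. \<Sum>j<J. of_int (ibinom m j) * lcoef A m * (D ^^ j) (lcoef (lmonom 1 n) (k - m + int j)))"
    by (rule lcoef_psdo_mult_box[OF D U N order_refl order_refl J])
  also have "\<dots> = (\<Sum>m=k-n..U. \<Sum>j\<in>{0}. of_int (ibinom m j) * lcoef A m * (D ^^ j) (lcoef (lmonom 1 n) (k - m + int j)))"
    by (intro sum.cong refl sum.mono_neutral_right) (auto simp: J_def D_pow)
  also have "\<dots> = (\<Sum>m\<in>{k-n}. lcoef A m)"
    by (subst sum.mono_neutral_right[where S = "{k - n}" and T = "{k - n..U}"]) (auto simp: U_def)
  finally show ?thesis by simp
qed

lemma psdo_mult_X_inv_right: "additive D \<Longrightarrow> D 1 = 0 \<Longrightarrow> psdo_mult D A fls_X_inv = fls_X_inv * A"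
  by (rule lseries_eqI) (simp add: psdo_mult_lmonom_right[where n = 1, folded lmonom_X_inv])

lemma psdo_mult_1_right: "additive D \<Longrightarrow> D 1 = 0 \<Longrightarrow> psdo_mult D A 1 = A"
  using lmonom_const[of "1 :: 'a"]
  by (intro lseries_eqI) (metis diff_zero fls_const_1 psdo_mult_lmonom_right)

lemma psdo_mult_X_inv_mult_left:
  assumes D: "additive D" and leib: "\<And>b c. D (b * c) = R b * c + b * D c" and R: "additive R" "R 1 = 0"
  shows "psdo_mult D (fls_X_inv * A) B = psdo_mult D A (psdo_mult D fls_X_inv B)"
  using psdo_mult_assoc[OF D D R(1) leib, of A fls_X_inv B] by (simp add: psdo_mult_X_inv_right R)

lemma fls_map_psdo_mult:
  fixes h :: "'a::comm_ring_1 \<Rightarrow> 'b::comm_ring_1"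
  assumes h: "additive h" "\<And>a b. h (a * b) = h a * h b" "\<And>a. h (D a) = D' (h a)"
    and D: "additive D" "additive D'"
  shows "fls_map h (psdo_mult D A B) = psdo_mult D' (fls_map h A) (fls_map h B)"
proof (rule lseries_eqI)
  fix k
  interpret h: additive h by fact
  obtain N where N: "lbound N B" using lbound_exists by blast
  obtain M where M: "lbound M A" using lbound_exists by blast
  have N': "lbound N (fls_map h B)" and M': "lbound M (fls_map h A)"
    using N M by (auto simp: lbound_def lcoef_fls_map_additive h h.zero)
  define J where "J = nat (M + N - k) + 1"
  have J: "M + N - k < int J" by (simp add: J_def)
  have pow: "h ((D ^^ j) x) = (D' ^^ j) (h x)" for j x
    by (induction j) (auto simp: h)
  have hm: "h (of_int i * a * b) = of_int i * h a * h b" for i a b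
    by (simp add: additive_of_int_mult[OF h(1)] mult.assoc h(2)[symmetric])
  show "lcoef (fls_map h (psdo_mult D A B)) k = lcoef (psdo_mult D' (fls_map h A) (fls_map h B)) k"
    by (simp add: lcoef_psdo_mult_box[OF D(1) M N order_refl order_refl J] pow h.sum
        lcoef_psdo_mult_box[OF D(2) M' N' order_refl order_refl J] lcoef_fls_map_additive h(1) hm)
qed

text \<open>If \<open>X\<close> falls on a coefficient of \<open>A\<close>, then \<open>B\<close> is
  merely transported by \<open>h\<close>. If it falls on a derivative of a coefficient of
  \<open>B\<close>, then X(D^j b) = N^j (X b), so the second product is formed with
  \<open>N\<close>. For N = \<lambda>+\<partial> this is the passage from \<mu>+\<partial> to
  \<lambda>+\<mu>+\<partial>.\<close>

lemma fls_map_psdo_mult_Leibniz: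
  fixes h :: "'a::comm_ring_1 \<Rightarrow> 'b::comm_ring_1"
  assumes X: "additive X" "\<And>a b. X (a * b) = X a * h b + h a * X b" "\<And>a. X (D a) = N (X a)"
    and h: "additive h" "\<And>a. h (D a) = D' (h a)"
    and D: "additive D" "additive D'" "additive N"
  shows "fls_map X (psdo_mult D A B) =
    psdo_mult D' (fls_map X A) (fls_map h B) + psdo_mult N (fls_map h A) (fls_map X B)"
proof (rule lseries_eqI)
  fix k
  interpret h: additive h by fact
  interpret X: additive X by fact
  obtain n where n: "lbound n B" using lbound_exists by blast
  obtain m where m: "lbound m A" using lbound_exists by blast
  have n': "lbound n (fls_map h B)" "lbound n (fls_map X B)"
   and m': "lbound m (fls_map h A)" "lbound m (fls_map X A)"
    using n m by (auto simp: lbound_def lcoef_fls_map_additive h X h.zero X.zero)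
  define J where "J = nat (m + n - k) + 1"
  have J: "m + n - k < int J" by (simp add: J_def)
  have pow: "h ((D ^^ j) x) = (D' ^^ j) (h x)" "X ((D ^^ j) x) = (N ^^ j) (X x)" for j x
    by (induction j) (auto simp: h X)
  have Xm: "X (of_int i * a * b) = of_int i * X a * h b + of_int i * h a * X b" for i a b
    by (simp only: additive_of_int_mult[OF X(1)] mult.assoc X(2)[of a b] distrib_left)
  show "lcoef (fls_map X (psdo_mult D A B)) k = lcoef
    (psdo_mult D' (fls_map X A) (fls_map h B) + psdo_mult N (fls_map h A) (fls_map X B)) k"
    by (simp add: lcoef_psdo_mult_box[OF D(1) m n order_refl order_refl J] pow X.sum
        lcoef_psdo_mult_box[OF D(2) m'(2) n'(1) order_refl order_refl J]
        lcoef_psdo_mult_box[OF D(3) m'(1) n'(2) order_refl order_refl J]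
        lcoef_fls_map_additive h(1) X(1) Xm sum.distrib)
qed

section \<open>Adjoints\<close>

lemma lcoef_psdo_adj_box:
  assumes D: "additive D" and A: "lbound N A" and J: "N - k < int J"
  shows "lcoef (psdo_adj D A) k =
    (\<Sum>j<J. (- 1) ^ nat \<bar>k + int j\<bar> * of_int (ibinom (k + int j) j) * (D ^^ j) (lcoef A (k + int j)))"
proof -
  have "lcoef (psdo_adj D A) k = (\<Sum>j | lcoef A (k + int j) \<noteq> 0.
      (- 1) ^ nat \<bar>k + int j\<bar> * of_int (ibinom (k + int j) j) * (D ^^ j) (lcoef A (k + int j)))"
    unfolding lcoef_psdo_adj
    by (rule sum.reindex_bij_witness[of _ "\<lambda>j. k + int j" "\<lambda>n. nat (n - k)"]) auto
  also have "\<dots> = (\<Sum>j<J. (- 1) ^ nat \<bar>k + int j\<bar> * of_int (ibinom (k + int j) j) * (D ^^ j) (lcoef A (k + int j)))"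
  proof (rule sum.mono_neutral_left)
    have "j < J" if "lcoef A (k + int j) \<noteq> 0" for j
    proof -
      have "k + int j \<le> N" using that A by (meson lboundD not_less)
      then show ?thesis using J by linarith
    qed
    then show "{j. lcoef A (k + int j) \<noteq> 0} \<subseteq> {..<J}" by auto
  qed (use additive.zero[OF additive_funpow[OF D]] in auto)
  finally show ?thesis .
qed

lemma lbound_psdo_adj:
  assumes D: "additive D" and A: "lbound N A"
  shows "lbound N (psdo_adj D A)"
  unfolding lbound_def
proof clarify
  fix k assume "N < k"
  then show "lcoef (psdo_adj D A) k = 0"
    by (subst lcoef_psdo_adj_box[OF D A, of _ 0]) auto
qed

lemma psdo_adj_add:
  assumes D: "additive D"
  shows "psdo_adj D (A + B) = psdo_adj D A + psdo_adj D B"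
proof (rule lseries_eqI)
  fix k
  obtain M N where b: "lbound M A" "lbound N B"
    using lbound_exists by metis
  define m where "m = max M N"
  have b: "lbound m A" "lbound m B" "lbound m (A + B)"
    using b by (auto simp: m_def lbound_def)
  define J where "J = nat (m - k) + 1"
  have J: "m - k < int J" by (simp add: J_def)
  show "lcoef (psdo_adj D (A + B)) k = lcoef (psdo_adj D A + psdo_adj D B) k"
    by (simp add: lcoef_psdo_adj_box[OF D b(1) J] lcoef_psdo_adj_box[OF D b(2) J]
        lcoef_psdo_adj_box[OF D b(3) J] distrib_left sum.distrib additive.add[OF additive_funpow[OF D]])
qed

lemma additive_psdo_adj: "additive D \<Longrightarrow> additive (psdo_adj D)"
  by (simp add: additive_def psdo_adj_add[unfolded additive_def])

lemma psdo_adj_const: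
  assumes D: "additive D"
  shows "psdo_adj D (fls_const a) = fls_const a"
proof (rule lseries_eqI)
  fix k
  have b: "lbound 0 (fls_const a)" by (simp add: lbound_def lcoef_const)
  define J where "J = nat (- k) + 1"
  have J: "0 - k < int J" by (simp add: J_def)
  have "(\<Sum>j<J. (- 1) ^ nat \<bar>k + int j\<bar> * of_int (ibinom (k + int j) j) * (D ^^ j) (lcoef (fls_const a) (k + int j)))
     = (\<Sum>j<J. if k = 0 \<and> j = 0 then a else 0)"
    using additive.zero[OF additive_funpow[OF D]]
    by (intro sum.cong refl) (auto simp: lcoef_const ibinom_0_left)
  then show "lcoef (psdo_adj D (fls_const a)) k = lcoef (fls_const a) k"
    unfolding lcoef_psdo_adj_box[OF D b J] by (cases "k = 0") (auto simp: lcoef_const J_def)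
qed

text \<open>For a derivation, multiplying a symbol by its variable is composing with \<partial> on
  the right, whose adjoint is composition with -\<partial> on the left. In coefficients this is
  Pascal's rule combined with the alternating sign.\<close>

lemma psdo_adj_X_inv_mult:
  assumes D: "additive D"
  shows "psdo_adj D (fls_X_inv * A) = - psdo_mult D fls_X_inv (psdo_adj D A)"
proof (rule lseries_eqI)
  fix k
  interpret D: additive D by fact
  obtain N where N: "lbound N A" using lbound_exists by blast
  then have N': "lbound (N + 1) (fls_X_inv * A)" by (simp add: lbound_def)
  define J where "J = nat (N + 1 - k) + 1"
  have J: "N + 1 - k < int (Suc J)" "N - (k - 1) < int (Suc J)" "N - k < int J" by (simp_all add: J_def)
  let ?s = "\<lambda>n. (- 1) ^ nat \<bar>n :: int\<bar> :: 'a" and ?d = "\<lambda>j. (D ^^ j) (lcoef A (k + int j - 1))"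
  have s: "?s (n - 1) = - ?s n" for n by (rule minus_one_power_pred)
  have Ds: "D (?s n * of_int i * x) = ?s n * of_int i * D x" for n i x
    by (auto simp: minus_one_power_iff D.minus additive_of_int_mult[OF D])
  have 1: "lcoef (psdo_adj D (fls_X_inv * A)) k = (\<Sum>j<Suc J. ?s (k + int j) * of_int (ibinom (k + int j) j) * ?d j)"
    unfolding lcoef_psdo_adj_box[OF D N' J(1)] lcoef_X_inv_mult ..
  have idx: "k - 1 + int j = k + int j - 1" for j by simp
  have 2: "lcoef (psdo_adj D A) (k - 1) = (\<Sum>j<Suc J. - ?s (k + int j) * of_int (ibinom (k + int j - 1) j) * ?d j)"
    unfolding lcoef_psdo_adj_box[OF D N J(2)] idx s ..
  have 3: "D (lcoef (psdo_adj D A) k) = (\<Sum>j<J. ?s (k + int j) * of_int (ibinom (k + int j) j) * ?d (Suc j))"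
    unfolding lcoef_psdo_adj_box[OF D N J(3)] D.sum Ds by simp
  have 4: "ibinom (k + int (Suc j)) (Suc j) = ibinom (k + int j) j + ibinom (k + int j) (Suc j)" for j
    using ibinom_Suc[of "k + int j" j] by (simp add: algebra_simps)
  have 5: "?s (k + int (Suc j)) = - ?s (k + int j)" for j
    using s[of "k + int (Suc j)"] by simp
  have 6: "k + int (Suc j) - 1 = k + int j" for j by simp
  show "lcoef (psdo_adj D (fls_X_inv * A)) k = lcoef (- psdo_mult D fls_X_inv (psdo_adj D A)) k"
    unfolding lcoef_uminus lcoef_psdo_mult_X_inv[OF D] 1 2 3 sum.lessThan_Suc_shift[of _ J] 4 5 6
    by (simp add: sum.distrib sum_negf sum_subtractf distrib_left distrib_right algebra_simps)
qed

lemma fls_map_psdo_adj: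
  fixes h :: "'a::comm_ring_1 \<Rightarrow> 'b::comm_ring_1"
  assumes h: "additive h" "\<And>a. h (D a) = D' (h a)" and D: "additive D" "additive D'"
  shows "fls_map h (psdo_adj D A) = psdo_adj D' (fls_map h A)"
proof (rule lseries_eqI)
  fix k
  interpret h: additive h by fact
  obtain N where N: "lbound N A" using lbound_exists by blast
  have N': "lbound N (fls_map h A)"
    using N by (auto simp: lbound_def lcoef_fls_map_additive h h.zero)
  define J where "J = nat (N - k) + 1"
  have J: "N - k < int J" by (simp add: J_def)
  have pow: "h ((D ^^ j) x) = (D' ^^ j) (h x)" for j x
    by (induction j) (auto simp: h)
  have hs: "h ((-1) ^ n * of_int i * x) = (-1) ^ n * of_int i * h x" for n i x
    by (auto simp: minus_one_power_iff h.minus additive_of_int_mult[OF h(1)])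
  show "lcoef (fls_map h (psdo_adj D A)) k = lcoef (psdo_adj D' (fls_map h A)) k"
    by (simp add: lcoef_psdo_adj_box[OF D(1) N J] pow h.sum hs
        lcoef_psdo_adj_box[OF D(2) N' J] lcoef_fls_map_additive h(1))
qed

text \<open>The substitution of -\<lambda>-\<partial> for \<lambda> is an involution: applied twice
  to \<lambda>A it yields \<lambda>+\<partial> acting on the double adjoint of A, minus \<partial>
  of that double adjoint.\<close>

lemma psdo_adj_adj:
  assumes D: "additive D"
  shows "psdo_adj D (psdo_adj D A) = A"
proof (rule lseries_eqI)
  fix k
  interpret adj: additive "psdo_adj D" by (rule additive_psdo_adj[OF D])
  have X: "psdo_adj D (psdo_adj D (fls_X_inv * A)) = fls_X_inv * psdo_adj D (psdo_adj D A)" for A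
  proof -
    have "psdo_adj D (psdo_adj D (fls_X_inv * A)) =
        psdo_mult D fls_X_inv (psdo_adj D (psdo_adj D A)) - fls_map D (psdo_adj D (psdo_adj D A))"
      by (simp only: psdo_adj_X_inv_mult[OF D] psdo_mult_X_inv[OF D, of "psdo_adj D A"] adj.minus adj.add
          fls_map_psdo_adj[OF D refl D D, symmetric]) simp
    then show ?thesis by (simp add: psdo_mult_X_inv D)
  qed
  have mon: "psdo_adj D (psdo_adj D (lmonom a m)) = lmonom a m" for a m
  proof (induction m rule: int_up_down)
    case 0 show ?case by (simp add: lmonom_const psdo_adj_const D)
  qed (simp_all add: X flip: X_inv_lmonom)
  show "lcoef (psdo_adj D (psdo_adj D A)) k = lcoef A k"
    by (rule fls_local_eq[where S = "\<lambda>A. lcoef (psdo_adj D (psdo_adj D A)) k" and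
          T = "\<lambda>A. lcoef A k" and A = A and e = "k - 1"])
      (auto simp: mon intro: lboundD lbound_psdo_adj[OF D] intro!: lboundD[OF lbound_psdo_adj[OF D lbound_psdo_adj[OF D]]] additive_comp[OF additive_lcoef] additive_lcoef
          additive_comp[OF additive_psdo_adj additive_psdo_adj] D)
qed

lemma psdo_adj_lmonom_1:
  assumes D: "additive D" and D1: "D 1 = 0"
  shows "psdo_adj D (lmonom 1 m) = (if even m then lmonom 1 m else - lmonom 1 m)"
proof (rule lseries_eqI)
  fix k
  have D_pow: "(D ^^ j) (if b then 1 else 0) = (if b \<and> j = 0 then 1 else 0)" for j b
    using additive.zero[OF additive_funpow[OF D]] additive.zero[OF D] D1
    by (cases b; cases j) (simp_all add: funpow_Suc_right del: funpow.simps(2))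
  have "lcoef (psdo_adj D (lmonom 1 m)) k = (\<Sum>j<nat (m - k) + 1.
      (- 1) ^ nat \<bar>k + int j\<bar> * of_int (ibinom (k + int j) j) * (D ^^ j) (lcoef (lmonom 1 m) (k + int j)))"
    by (rule lcoef_psdo_adj_box[OF D, of m]) (auto simp: lbound_def)
  also have "\<dots> = (\<Sum>j<nat (m - k) + 1. if j = 0 \<and> k = m then (- 1) ^ nat \<bar>k\<bar> else 0)"
    by (intro sum.cong refl) (auto simp: D_pow)
  also have "\<dots> = (if k = m then (- 1) ^ nat \<bar>k\<bar> else 0)"
    by (cases "k = m") auto
  finally show "lcoef (psdo_adj D (lmonom 1 m)) k = lcoef (if even m then lmonom 1 m else - lmonom 1 m) k"
    by (auto simp: minus_one_power_iff even_nat_iff)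
qed

text \<open>Antimultiplicativity when \<open>C\<close> has coefficients in a module with connection
  \<open>N\<close> and \<open>A\<close> has scalar coefficients. In the reversed product the scalars
  stand on the right, so there they are differentiated by \<open>D\<close>. With N =
  \<lambda>+\<partial> it converts right actions of operators into left ones.\<close>

lemma psdo_adj_mult:
  assumes N: "additive N" and D: "additive D"
    and leib: "\<And>b c. N (b * c) = D b * c + b * N c" and leibD: "\<And>b c. D (b * c) = D b * c + b * D c"
  shows "psdo_adj N (psdo_mult N A C) = psdo_mult D (psdo_adj N C) (psdo_adj D A)"
proof (rule lseries_eqI)
  fix k
  interpret adj: additive "psdo_adj N" by (rule additive_psdo_adj[OF N])
  have D1: "D 1 = 0" using leibD[of 1 1] by simp
  have leib': "N (b * c) = N b * c + b * D c" for b c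
    using leib[of c b] by (simp add: mult.commute add.commute)
  have assoc: "psdo_mult N A (psdo_mult D B C) = psdo_mult D (psdo_mult N A B) C" for A B C
    by (rule psdo_mult_assoc[OF N D N leib'])
  have minus: "psdo_mult D (- A) B = - psdo_mult D A B" for A B
    using additive.minus[OF additive_psdo_mult_left[OF D]] .
  \<comment> \<open>For a constant \<open>A\<close> the claim is local in \<open>C\<close>. Powers
    of \<partial> come next, and locality in \<open>A\<close> concludes.\<close>
  have const: "psdo_adj N (fls_const a * C) = psdo_mult D (psdo_adj N C) (fls_const a)" for a C
  proof (rule lseries_eqI)
    fix k
    have X: "psdo_adj N (fls_const a * (fls_X_inv * C)) = psdo_mult D (psdo_adj N (fls_X_inv * C)) (fls_const a) \<longleftrightarrow>
        psdo_adj N (fls_const a * C) = psdo_mult D (psdo_adj N C) (fls_const a)" for C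
      using psdo_mult_X_inv_inj[OF N]
      by (auto simp: mult.left_commute[of "fls_const a"] psdo_adj_X_inv_mult N minus
          assoc[symmetric])
    have mon: "psdo_adj N (fls_const a * lmonom b m) = psdo_mult D (psdo_adj N (lmonom b m)) (fls_const a)" for b m
    proof (induction m rule: int_up_down)
      case 0
      show ?case by (simp add: lmonom_const psdo_adj_const N psdo_mult_const_left D mult.commute)
    qed (simp_all add: X flip: X_inv_lmonom)
    have b: "lbound e C \<Longrightarrow> lbound e (fls_const a * C)" for e C by (simp add: lbound_def)
    have b0: "lbound 0 (fls_const a)" by (simp add: lbound_def lcoef_const)
    show "lcoef (psdo_adj N (fls_const a * C)) k = lcoef (psdo_mult D (psdo_adj N C) (fls_const a)) k"
    proof (rule fls_local_eq[where S = "\<lambda>C. lcoef (psdo_adj N (fls_const a * C)) k" and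
          T = "\<lambda>C. lcoef (psdo_mult D (psdo_adj N C) (fls_const a)) k" and A = C and e = "k - 1"])
      show "additive (\<lambda>C. lcoef (psdo_adj N (fls_const a * C)) k)"
        by (simp add: additive_def distrib_left adj.add)
      show "additive (\<lambda>C. lcoef (psdo_mult D (psdo_adj N C) (fls_const a)) k)"
        by (simp add: additive_def adj.add psdo_mult_add_left[OF D])
      show "lcoef (psdo_adj N (fls_const a * A)) k = 0" if "lbound (k - 1) A" for A
        using lbound_psdo_adj[OF N b[OF that]] by (rule lboundD) simp
      show "lcoef (psdo_mult D (psdo_adj N A) (fls_const a)) k = 0" if "lbound (k - 1) A" for A
        using lbound_psdo_mult[OF D lbound_psdo_adj[OF N that] b0] by (rule lboundD) simp
    qed (simp add: mon)
  qed
  have X: "psdo_adj N (psdo_mult N fls_X_inv C) = - (fls_X_inv * psdo_adj N C)" for C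
    using fls_map_psdo_adj[OF N refl N N]
    by (simp add: psdo_mult_X_inv N adj.add psdo_adj_X_inv_mult)
  have Xr: "psdo_mult D B (psdo_adj D (fls_X_inv * A)) = - psdo_mult D (fls_X_inv * B) (psdo_adj D A)" for A B
    using additive.minus[OF additive_psdo_mult_right[OF D], of B]
      psdo_mult_X_inv_mult_left[OF D leibD D D1, of B "psdo_adj D A"]
    by (simp add: psdo_adj_X_inv_mult D)
  have mon: "psdo_adj N (psdo_mult N (lmonom 1 m) C) = psdo_mult D (psdo_adj N C) (psdo_adj D (lmonom 1 m))" for m
  proof -
    have eq: "psdo_adj N (psdo_mult N (lmonom 1 m) C) = psdo_mult D (psdo_adj N C) (psdo_adj D (lmonom 1 m)) \<longleftrightarrow>
       psdo_adj N (psdo_mult N (lmonom 1 (m + 1)) C) = psdo_mult D (psdo_adj N C) (psdo_adj D (lmonom 1 (m + 1)))" for m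
    proof -
      have "psdo_mult D (fls_X_inv * psdo_adj N C) (psdo_adj D (lmonom 1 m)) =
         fls_X_inv * psdo_mult D (psdo_adj N C) (psdo_adj D (lmonom 1 m))"
      proof -
        have "psdo_adj D (lmonom 1 m) = (if even m then lmonom 1 m else - lmonom 1 m)" for m
          by (rule psdo_adj_lmonom_1[OF D D1])
        then show ?thesis
          by (intro lseries_eqI)
            (simp add: psdo_mult_lmonom_right D D1 additive.minus[OF additive_psdo_mult_right[OF D]], simp add: algebra_simps)
      qed
      then show ?thesis
        unfolding psdo_mult_lmonom_Suc'[OF N] X by (simp add: Xr flip: X_inv_lmonom)
    qed
    show ?thesis
    proof (induction m rule: int_up_down)
      case 0 show ?case
        using psdo_adj_const[OF D, of 1] by (simp add: lmonom_const psdo_mult_1_left N psdo_mult_1_right D D1)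
    next
      case (up n) then show ?case using eq by blast
    next
      case (down n) then show ?case using eq by blast
    qed
  qed
  have mon': "psdo_adj N (psdo_mult N (lmonom a m) C) = psdo_mult D (psdo_adj N C) (psdo_adj D (lmonom a m))" for a m
  proof -
    have c1: "psdo_adj D (lmonom a m) = psdo_mult D (psdo_adj D (lmonom 1 m)) (fls_const a)"
    proof -
      have X': "psdo_mult D (psdo_adj D (lmonom 1 (m+1))) (fls_const a) = - psdo_mult D fls_X_inv (psdo_mult D (psdo_adj D (lmonom 1 m)) (fls_const a))" for m
        by (simp add: psdo_adj_X_inv_mult D minus psdo_mult_assoc[OF D D D leibD] flip: X_inv_lmonom)
      show ?thesis
      proof (induction m rule: int_up_down)
        case 0 show ?case using psdo_adj_const[OF D, of 1]
          by (simp add: lmonom_const psdo_adj_const D psdo_mult_1_left)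
      next
        case (up m) then show ?case unfolding X' by (simp add: psdo_adj_X_inv_mult D flip: X_inv_lmonom)
      next
        case (down m)
        then have "psdo_mult D fls_X_inv (psdo_adj D (lmonom a m)) = psdo_mult D fls_X_inv (psdo_mult D (psdo_adj D (lmonom 1 m)) (fls_const a))"
          unfolding X' by (simp add: psdo_adj_X_inv_mult D flip: X_inv_lmonom)
        then show ?case by (rule psdo_mult_X_inv_inj[OF D])
      qed
    qed
    have "psdo_adj N (psdo_mult N (lmonom a m) C) = psdo_mult D (psdo_adj N (psdo_mult N (lmonom 1 m) C)) (fls_const a)"
      using psdo_mult_lmonom_const[OF N, of a 1] by (simp add: const)
    also have "\<dots> = psdo_mult D (psdo_adj N C) (psdo_mult D (psdo_adj D (lmonom 1 m)) (fls_const a))"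
      unfolding mon by (rule psdo_mult_assoc[OF D D D leibD, symmetric])
    finally show ?thesis unfolding c1 .
  qed
  obtain n where n: "lbound n C" using lbound_exists by blast
  show "lcoef (psdo_adj N (psdo_mult N A C)) k = lcoef (psdo_mult D (psdo_adj N C) (psdo_adj D A)) k"
  proof (rule fls_local_eq[where S = "\<lambda>A. lcoef (psdo_adj N (psdo_mult N A C)) k" and
        T = "\<lambda>A. lcoef (psdo_mult D (psdo_adj N C) (psdo_adj D A)) k" and A = A and e = "k - n - 1"])
    show "additive (\<lambda>A. lcoef (psdo_adj N (psdo_mult N A C)) k)"
      by (simp add: additive_def adj.add psdo_mult_add_left[OF N])
    show "additive (\<lambda>A. lcoef (psdo_mult D (psdo_adj N C) (psdo_adj D A)) k)"
      by (simp add: additive_def psdo_adj_add[OF D] psdo_mult_add_right[OF D])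
    show "lcoef (psdo_adj N (psdo_mult N A C)) k = 0" if "lbound (k - n - 1) A" for A
      using lbound_psdo_adj[OF N lbound_psdo_mult[OF N that n]] by (rule lboundD) simp
    show "lcoef (psdo_mult D (psdo_adj N C) (psdo_adj D A)) k = 0" if "lbound (k - n - 1) A" for A
      using lbound_psdo_mult[OF D lbound_psdo_adj[OF N n] lbound_psdo_adj[OF D that]] by (rule lboundD) simp
  qed (simp add: mon')
qed

section \<open>The bracket of a matrix of operators\<close>

lemma psdo_mult_X_inv_mult_right:
  assumes D: "additive D" and leib: "\<And>b c. D (b * c) = D b * c + b * D c"
  shows "psdo_mult D A (fls_X_inv * B) = fls_X_inv * psdo_mult D A B"
proof -
  have D1: "D 1 = 0" using leib[of 1 1] by simp
  show ?thesis
    using psdo_mult_assoc[OF D D D leib, of A B fls_X_inv] by (simp add: psdo_mult_X_inv_right D D1)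
qed

lemma psdo_adj_const_mult:
  assumes D: "additive D" and leib: "\<And>b c. D (b * c) = D b * c + b * D c"
  shows "psdo_adj D (fls_const a * A) = psdo_mult D (psdo_adj D A) (fls_const a)"
  using psdo_adj_mult[OF D D leib leib, of "fls_const a" A]
  by (simp add: psdo_mult_const_left psdo_adj_const D)

text \<open>Taking adjoints brings \<open>a\<close> to the left, where multiplication by
  \<open>a\<close> is coefficientwise and commutes with \<open>D\<close>.\<close>

lemma psdo_mult_constant_right:
  assumes D: "additive D" and leib: "\<And>b c. D (b * c) = D b * c + b * D c" and a: "D a = 0"
  shows "psdo_mult D A (fls_const a) = fls_const a * A"
proof -
  interpret D: additive D by fact
  have h: "additive ((*) a)" by (simp add: additive_def distrib_left)
  have m: "fls_map ((*) a) B = fls_const a * B" for B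
    by (rule lseries_eqI) (simp add: lcoef_fls_map_additive h)
  have "psdo_mult D A (fls_const a) = psdo_adj D (fls_const a * psdo_adj D A)"
    by (simp add: psdo_adj_const_mult[OF D leib] psdo_adj_adj D)
  also have "\<dots> = fls_const a * psdo_adj D (psdo_adj D A)"
    using fls_map_psdo_adj[of "(*) a" D D "psdo_adj D A"] by (simp add: h D m leib a)
  finally show ?thesis by (simp add: psdo_adj_adj D)
qed

context algebra_of_differential_functions
begin

lemma additive_D: "additive D"
  and D_mult: "D (a * b) = D a * b + a * D b"
  and D_scl: "D (scl c a) = scl c (D a)"
  and additive_pd: "additive (pd i n)"
  and pd_mult: "pd i n (a * b) = pd i n a * b + a * pd i n b"
  and pd_scl: "pd i n (scl c a) = scl c (pd i n a)"
  using derivation_D derivation_pd[of i n] unfolding derivation_def Vector_Spaces.linear_iff additive_def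
  by simp_all

sublocale D: additive D by (rule additive_D)

sublocale pd: additive "pd i n" by (rule additive_pd)

lemma D_1: "D 1 = 0"
  using D_mult[of 1 1] by simp

lemma scl_eq_mult: "scl c a = scl c 1 * a"
  using scl_mult[of c 1 a] by simp

lemma D_scl_1: "D (scl c 1) = 0"
  using D_scl[of c 1] by (simp add: D_1)

lemmas psdo_assoc = psdo_mult_assoc[OF additive_D additive_D additive_D D_mult]
lemmas psdo_adj_psdo_mult = psdo_adj_mult[OF additive_D additive_D D_mult D_mult]
lemmas psdo_X_right = psdo_mult_X_inv_mult_right[OF additive_D D_mult]

sublocale psdo_left: additive "\<lambda>A. psdo_mult D A B" by (rule additive_psdo_mult_left[OF additive_D])
sublocale psdo_right: additive "psdo_mult D A" by (rule additive_psdo_mult_right[OF additive_D])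
sublocale psdo_adj: additive "psdo_adj D" by (rule additive_psdo_adj[OF additive_D])

text \<open>\<open>frechet j g\<close> is the operator \<open>\<Sum>n. \<partial>g/\<partial>u\<^sub>j\<^bsup>(n)\<^esup> \<partial>\<^sup>n\<close>.\<close>

definition frechet :: "'i \<Rightarrow> 'v \<Rightarrow> 'v fls" where
  "frechet j g = lseries (\<lambda>n. if 0 \<le> n then pd j (nat n) g else 0)"

lemma pd_bound: obtains M where "\<And>i n. M \<le> n \<Longrightarrow> pd i n f = 0"
proof -
  have "finite (snd ` {(i, n). pd i n f \<noteq> 0})" using finite_pd by blast
  then obtain M where M: "\<forall>n \<in> snd ` {(i, n). pd i n f \<noteq> 0}. n < M"
    using finite_nat_set_iff_bounded by blast
  show ?thesis
  proof (rule that)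
    fix i n assume "M \<le> n"
    with M show "pd i n f = 0" by (force simp: image_iff)
  qed
qed

lemma lcoef_frechet: "lcoef (frechet j g) n = (if 0 \<le> n then pd j (nat n) g else 0)"
proof -
  obtain M where M: "\<And>i n. M \<le> n \<Longrightarrow> pd i n g = 0" using pd_bound[of g] by blast
  show ?thesis unfolding frechet_def
    by (rule lcoef_lseries[where N = "int M"]) (use M in auto)
qed

lemma frechet_eq_sum:
  assumes "\<And>n. n \<notin> I \<Longrightarrow> pd j n g = 0" "finite I"
  shows "frechet j g = (\<Sum>n\<in>I. fls_const (pd j n g) * fls_X_inv ^ n)"
proof (rule lseries_eqI)
  fix k
  have "lcoef (\<Sum>n\<in>I. fls_const (pd j n g) * fls_X_inv ^ n) k = (\<Sum>n\<in>I. if n = nat k \<and> 0 \<le> k then pd j n g else 0)"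
    unfolding lcoef_sum by (intro sum.cong refl) (auto simp: lmonom_X_inv_power)
  also have "\<dots> = lcoef (frechet j g) k"
    using assms by (cases "0 \<le> k") (auto simp: lcoef_frechet)
  finally show "lcoef (frechet j g) k = lcoef (\<Sum>n\<in>I. fls_const (pd j n g) * fls_X_inv ^ n) k" ..
qed

lemma additive_frechet: "additive (frechet j)"
  by (auto simp: additive_def lcoef_frechet pd.add intro!: lseries_eqI)

sublocale frechet: additive "frechet j" by (rule additive_frechet)

lemma frechet_scl: "frechet j (scl c g) = fls_const (scl c 1) * frechet j g"
  by (rule lseries_eqI) (simp add: lcoef_frechet pd_scl flip: scl_eq_mult)

lemma frechet_mult: "frechet j (b * c) = fls_const b * frechet j c + fls_const c * frechet j b"
  by (rule lseries_eqI) (simp add: lcoef_frechet pd_mult)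

text \<open>This is the commutation relation \<open>pd_D\<close>, collected over all orders into one
  identity of operators.\<close>

lemma frechet_D: "frechet j (D g) = psdo_mult D fls_X_inv (frechet j g)"
proof (rule lseries_eqI)
  fix k
  have "pd j n (D g) = D (pd j n g) + (if n = 0 then 0 else pd j (n - 1) g)" for n
    using pd_D[of j n g] by (simp add: algebra_simps)
  then show "lcoef (frechet j (D g)) k = lcoef (psdo_mult D fls_X_inv (frechet j g)) k"
    by (auto simp: lcoef_frechet lcoef_psdo_mult_X_inv additive_D D.zero nat_diff_distrib)
qed

text \<open>Recognises the rightmost factor of the master formula, (-\<lambda>-\<partial>)^m applied
  to a partial derivative, as the adjoint of a term of the Frechet operator.\<close>

lemma psdo_adj_monomial:
  "psdo_adj D (fls_const a * fls_X_inv ^ m) = psdo_mult D ((- fls_X_inv) ^ m) (fls_const a)"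
proof -
  have "psdo_adj D (fls_X_inv ^ m) = (- fls_X_inv) ^ m"
    by (simp add: lmonom_X_inv_power power_minus[of fls_X_inv] psdo_adj_lmonom_1 additive_D D_1 minus_one_power_iff)
  then show ?thesis
    by (simp add: psdo_adj_const_mult[OF additive_D D_mult])
qed

lemma psdo_adj_X_inv: "psdo_adj D fls_X_inv = - fls_X_inv"
  using psdo_adj_monomial[of 1 1] psdo_mult_1_right[OF additive_D D_1] by simp

lemma master_term_eq:
  "master_term D pd H f g i j m n =
    psdo_mult D (fls_const (pd j n g) * fls_X_inv ^ n)
      (psdo_mult D (H $ j $ i) (psdo_adj D (fls_const (pd i m f) * fls_X_inv ^ m)))"
  by (simp add: master_term_def psdo_adj_monomial psdo_mult_const_mult_left additive_D)

lemma master_term_support: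
  "{(m, n). master_term D pd H f g i j m n \<noteq> 0} \<subseteq> {m. pd i m f \<noteq> 0} \<times> {n. pd j n g \<noteq> 0}"
  by (auto simp: master_term_eq psdo_left.zero psdo_right.zero psdo_adj.zero)

lemma finite_pd': "finite {n. pd i n f \<noteq> 0}"
  by (rule finite_subset[OF _ finite_imageI[OF finite_pd[of f], of snd]]) (force simp: image_iff)

lemma finite_master_term: "finite {(m, n). master_term D pd H f g i j m n \<noteq> 0}"
  by (rule finite_subset[OF master_term_support]) (simp add: finite_pd')

lemma master_bracket_eq:
  "master_bracket D pd H f g =
    (\<Sum>i\<in>UNIV. \<Sum>j\<in>UNIV. psdo_mult D (frechet j g) (psdo_mult D (H $ j $ i) (psdo_adj D (frechet i f))))"
proof -
  have "Sum_any (\<lambda>(m, n). master_term D pd H f g i j m n) =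
      psdo_mult D (frechet j g) (psdo_mult D (H $ j $ i) (psdo_adj D (frechet i f)))" for i j
  proof -
    let ?I = "{m. pd i m f \<noteq> 0}" and ?J = "{n. pd j n g \<noteq> 0}"
    have "Sum_any (\<lambda>(m, n). master_term D pd H f g i j m n) =
        (\<Sum>(m, n)\<in>?I \<times> ?J. master_term D pd H f g i j m n)"
      by (rule Sum_any.expand_superset)
        (use master_term_support[of H f g i j] finite_pd' in \<open>auto simp: case_prod_unfold\<close>)
    also have "\<dots> = (\<Sum>n\<in>?J. \<Sum>m\<in>?I. master_term D pd H f g i j m n)"
      by (subst sum.swap) (simp add: sum.cartesian_product)
    also have "\<dots> = psdo_mult D (frechet j g) (psdo_mult D (H $ j $ i) (psdo_adj D (frechet i f)))"
    proof -
      have "frechet i f = (\<Sum>n\<in>?I. fls_const (pd i n f) * fls_X_inv ^ n)"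
          "frechet j g = (\<Sum>n\<in>?J. fls_const (pd j n g) * fls_X_inv ^ n)"
        by (rule frechet_eq_sum; simp add: finite_pd')+
      then show ?thesis
        by (simp add: master_term_eq psdo_left.sum psdo_right.sum psdo_adj.sum) (rule sum.swap)
    qed
    finally show ?thesis .
  qed
  then show ?thesis by (simp add: master_bracket_def)
qed

lemma psdo_scl_right: "psdo_mult D A (fls_const (scl c 1) * B) = fls_const (scl c 1) * psdo_mult D A B"
  using psdo_assoc[of A "fls_const (scl c 1)" B]
  by (simp add: psdo_mult_const_left additive_D psdo_mult_const_mult_left
      psdo_mult_constant_right[OF additive_D D_mult D_scl_1])

lemma additive_scl: "additive (scl c)"
  by (simp add: additive_def scale_right_distrib)

lemma fls_map_scl: "fls_map (scl c) A = fls_const (scl c 1) * A"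
  by (rule lseries_eqI) (simp add: lcoef_fls_map_additive additive_scl flip: scl_eq_mult)

lemma vector_space_fls: "vector_space (\<lambda>c. fls_map (scl c))"
  by unfold_locales
    (auto intro!: lseries_eqI simp: lcoef_fls_map_additive additive_scl scale_right_distrib scale_left_distrib)

section \<open>Bracket axioms and skewsymmetry of the master formula\<close>

theorem nonlocal_lambda_bracket_master: "nonlocal_lambda_bracket scl D (master_bracket D pd H)"
  unfolding nonlocal_lambda_bracket_def
proof (intro conjI allI)
  let ?br = "master_bracket D pd H"
  note br = master_bracket_eq
  have vs: "vector_space scl" ..
  show "Vector_Spaces.linear scl (\<lambda>c. fls_map (scl c)) (?br a)" for a
    unfolding Vector_Spaces.linear_iff
    by (simp add: vs vector_space_fls br frechet.add psdo_left.add sum.distrib frechet_scl fls_map_scl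
        psdo_mult_const_mult_left additive_D sum_distrib_left)
  show "Vector_Spaces.linear scl (\<lambda>c. fls_map (scl c)) (\<lambda>a. ?br a b)" for b
    unfolding Vector_Spaces.linear_iff
    by (simp add: vs vector_space_fls br frechet.add psdo_adj.add psdo_right.add sum.distrib frechet_scl
        fls_map_scl psdo_adj_const_mult[OF additive_D D_mult] psdo_scl_right
        psdo_mult_constant_right[OF additive_D D_mult D_scl_1] additive_D sum_distrib_left)
  \<comment> \<open>The adjoint of \<partial> composed with L is minus the adjoint of L composed
    with \<partial> on the right, and right composition with \<partial> multiplies the symbol by
    \<lambda>.\<close>
  show "?br (D a) b = - (fls_X_inv * ?br a b)" for a b
    by (simp add: br frechet_D psdo_adj_psdo_mult psdo_adj_X_inv psdo_X_right sum_distrib_left sum_negf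
        psdo_right.minus psdo_mult_X_inv_right additive_D D_1)
  show "?br a (D b) = psdo_mult D fls_X_inv (?br a b)" for a b
    by (simp add: br frechet_D psdo_right.sum psdo_assoc)
  show "?br a (b * c) = fls_const b * ?br a c + fls_const c * ?br a b" for a b c
    by (simp add: br frechet_mult psdo_left.add psdo_mult_const_mult_left additive_D sum.distrib sum_distrib_left)
  show "?br (a * b) c = psdo_mult D (?br a c) (fls_const b) + psdo_mult D (?br b c) (fls_const a)" for a b c
    by (simp add: br frechet_mult psdo_adj.add psdo_right.add psdo_adj_const_mult[OF additive_D D_mult]
        psdo_left.sum sum.distrib psdo_assoc add.commute)
qed

lemma psdo_adj_bracket:
  "psdo_adj D (master_bracket D pd H a b) =
    (\<Sum>i\<in>UNIV. \<Sum>j\<in>UNIV. psdo_mult D (frechet i a) (psdo_mult D (psdo_adj D (H $ j $ i)) (psdo_adj D (frechet j b))))"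
  by (simp add: master_bracket_eq psdo_adj.sum psdo_adj_psdo_mult psdo_adj_adj additive_D psdo_assoc)

lemma pd_var: "pd j n (\<iota> (dp_var k m)) = (if j = k \<and> n = m then 1 else 0)"
proof -
  have 0: "\<iota> 0 = 0" using \<iota>_add[of 0 0] by simp
  have 1: "\<iota> 1 = 1" using \<iota>_const[of 1] by (simp add: dp_const_def)
  have "dp_partial j n (dp_var k m :: ('i, 'f) diff_poly) = (if j = k \<and> n = m then 1 else 0)"
    by (auto simp: dp_partial_def dp_var_def lookup_single when_def)
  then show ?thesis unfolding \<iota>_partial[symmetric] by (simp add: 0 1)
qed

lemma frechet_var: "frechet j (\<iota> (dp_var k 0)) = (if j = k then 1 else 0)"
  by (rule lseries_eqI) (auto simp: lcoef_frechet pd_var lcoef_1)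

lemma master_bracket_var_left:
  "master_bracket D pd H (\<iota> (dp_var i 0)) g = (\<Sum>j\<in>UNIV. psdo_mult D (frechet j g) (H $ j $ i))"
proof -
  have "psdo_adj D 1 = 1" using psdo_adj_const[OF additive_D, of 1] by simp
  then have "psdo_mult D (H $ j $ k) (psdo_adj D (if k = i then 1 else 0)) = (if k = i then H $ j $ k else 0)" for j k
    by (simp add: psdo_mult_1_right additive_D D_1 psdo_adj.zero psdo_right.zero)
  then show ?thesis
    unfolding master_bracket_eq frechet_var
    by (subst sum.swap) (simp add: if_distrib[of "psdo_mult D _"] psdo_right.zero cong: if_cong)
qed

text \<open>The entries of \<open>H\<close> are recovered, transposed, from the generators, so
  skewsymmetry on generators already says that \<open>H\<close> is skewadjoint.\<close>

lemma master_bracket_vars: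
  "master_bracket D pd H (\<iota> (dp_var i 0)) (\<iota> (dp_var j 0)) = H $ j $ i"
proof -
  have "psdo_mult D (if k = j then 1 else 0) A = (if k = j then A else 0)" for k A
    by (simp add: psdo_mult_1_left additive_D psdo_left.zero)
  then show ?thesis by (simp add: master_bracket_var_left frechet_var)
qed

theorem skewsymmetric_master:
  "skewsymmetric_bracket D (master_bracket D pd H) \<longleftrightarrow> skewadjoint D H"
proof
  assume "skewsymmetric_bracket D (master_bracket D pd H)"
  then have "master_bracket D pd H (\<iota> (dp_var j 0)) (\<iota> (dp_var i 0)) =
      - psdo_adj D (master_bracket D pd H (\<iota> (dp_var i 0)) (\<iota> (dp_var j 0)))" for i j
    unfolding skewsymmetric_bracket_def by blast
  then have "psdo_adj D (H $ j $ i) = - H $ i $ j" for i j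
    unfolding master_bracket_vars by (metis minus_minus)
  then show "skewadjoint D H"
    by (simp add: skewadjoint_def psdo_mat_adj_def vec_eq_iff)
next
  assume "skewadjoint D H"
  then have "psdo_adj D (H $ j $ i) = - H $ i $ j" for i j
    by (simp add: skewadjoint_def psdo_mat_adj_def vec_eq_iff)
  then have "psdo_adj D (master_bracket D pd H a b) = - (\<Sum>i\<in>UNIV. \<Sum>j\<in>UNIV.
      psdo_mult D (frechet i a) (psdo_mult D (H $ i $ j) (psdo_adj D (frechet j b))))" for a b
    by (simp add: psdo_adj_bracket psdo_left.minus psdo_right.minus sum_negf)
  moreover have "(\<Sum>i\<in>UNIV. \<Sum>j\<in>UNIV.
      psdo_mult D (frechet i a) (psdo_mult D (H $ i $ j) (psdo_adj D (frechet j b)))) = master_bracket D pd H b a" for a b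
    unfolding master_bracket_eq by (rule sum.swap)
  ultimately show "skewsymmetric_bracket D (master_bracket D pd H)"
    by (simp add: skewsymmetric_bracket_def)
qed

end

section \<open>Operations on series in three variables\<close>

definition tri_of :: "(int \<Rightarrow> int \<Rightarrow> int \<Rightarrow> 'v::ab_group_add) \<Rightarrow> 'v tri_series" where
  "tri_of F = Abs_tri_series F"

lemma tcoef_tri_of: "tri_bounded N F \<Longrightarrow> tcoef (tri_of F) = F"
  unfolding tri_of_def tri_bounded_def by (subst Abs_tri_series_inverse) auto

lemma tri_eqI: "(\<And>a b c. tcoef f a b c = tcoef g a b c) \<Longrightarrow> f = g"
  by (simp add: tcoef_inject[symmetric] fun_eq_iff)

lemma tcoef_simps [simp]:
  "tcoef 0 a b c = 0" "tcoef (f + g) a b c = tcoef f a b c + tcoef g a b c"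
  "tcoef (f - g) a b c = tcoef f a b c - tcoef g a b c" "tcoef (- f) a b c = - tcoef f a b c"
  by (simp_all add: zero_tri_series.rep_eq plus_tri_series.rep_eq minus_tri_series.rep_eq uminus_tri_series.rep_eq)

lemma tri_boundedD: "tri_bounded N F \<Longrightarrow> N < a \<or> N < b \<or> N < c \<Longrightarrow> F a b c = 0"
  unfolding tri_bounded_def by blast

definition tri_x :: "'v::ab_group_add tri_series \<Rightarrow> 'v tri_series" where
  "tri_x f = tri_of (\<lambda>a b c. tcoef f (a - 1) b c)"

definition tri_y :: "'v::ab_group_add tri_series \<Rightarrow> 'v tri_series" where
  "tri_y f = tri_of (\<lambda>a b c. tcoef f a (b - 1) c)"

definition tri_z :: "'v::ab_group_add tri_series \<Rightarrow> 'v tri_series" where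
  "tri_z f = tri_of (\<lambda>a b c. tcoef f a b (c - 1))"

definition tri_map :: "('v::ab_group_add \<Rightarrow> 'w::ab_group_add) \<Rightarrow> 'v tri_series \<Rightarrow> 'w tri_series" where
  "tri_map h f = tri_of (\<lambda>a b c. h (tcoef f a b c))"

definition tri_swap12 :: "'v::ab_group_add tri_series \<Rightarrow> 'v tri_series" where
  "tri_swap12 f = tri_of (\<lambda>a b c. tcoef f b a c)"

definition tri_swap23 :: "'v::ab_group_add tri_series \<Rightarrow> 'v tri_series" where
  "tri_swap23 f = tri_of (\<lambda>a b c. tcoef f a c b)"

definition tri_monom :: "'v::ab_group_add \<Rightarrow> int \<Rightarrow> int \<Rightarrow> int \<Rightarrow> 'v tri_series" where
  "tri_monom v i j k = tri_of (\<lambda>a b c. if a = i \<and> b = j \<and> c = k then v else 0)"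

lemma tcoef_tri_xyz [simp]:
  "tcoef (tri_x f) a b c = tcoef f (a - 1) b c"
  "tcoef (tri_y f) a b c = tcoef f a (b - 1) c"
  "tcoef (tri_z f) a b c = tcoef f a b (c - 1)"
proof -
  obtain N where N: "tri_bounded N (tcoef f)" using tri_bounded_tcoef by blast
  then have *: "tri_bounded (N + 1) (\<lambda>a b c. tcoef f (a - 1) b c)"
    "tri_bounded (N + 1) (\<lambda>a b c. tcoef f a (b - 1) c)"
    "tri_bounded (N + 1) (\<lambda>a b c. tcoef f a b (c - 1))"
    by (simp_all add: tri_bounded_def)
  show "tcoef (tri_x f) a b c = tcoef f (a - 1) b c"
    "tcoef (tri_y f) a b c = tcoef f a (b - 1) c"
    "tcoef (tri_z f) a b c = tcoef f a b (c - 1)"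
    by (simp_all add: tri_x_def tri_y_def tri_z_def *[THEN tcoef_tri_of])
qed

lemma tcoef_tri_swap [simp]:
  "tcoef (tri_swap12 f) a b c = tcoef f b a c"
  "tcoef (tri_swap23 f) a b c = tcoef f a c b"
proof -
  obtain N where N: "tri_bounded N (tcoef f)" using tri_bounded_tcoef by blast
  then have *: "tri_bounded N (\<lambda>a b c. tcoef f b a c)" "tri_bounded N (\<lambda>a b c. tcoef f a c b)"
    by (auto simp: tri_bounded_def)
  show "tcoef (tri_swap12 f) a b c = tcoef f b a c" "tcoef (tri_swap23 f) a b c = tcoef f a c b"
    by (simp_all add: tri_swap12_def tri_swap23_def *[THEN tcoef_tri_of])
qed

lemma tcoef_tri_map:
  assumes "additive h"
  shows "tcoef (tri_map h f) a b c = h (tcoef f a b c)"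
proof -
  obtain N where N: "tri_bounded N (tcoef f)" using tri_bounded_tcoef by blast
  then have "tri_bounded N (\<lambda>a b c. h (tcoef f a b c))"
    by (simp add: tri_bounded_def additive.zero[OF assms])
  then show ?thesis by (simp add: tri_map_def tcoef_tri_of)
qed

lemma tcoef_tri_monom [simp]:
  "tcoef (tri_monom v i j k) a b c = (if a = i \<and> b = j \<and> c = k then v else 0)"
  unfolding tri_monom_def
  by (subst tcoef_tri_of[where N = "max i (max j k)"]) (auto simp: tri_bounded_def)

lemma tcoef_fun:
  "tcoef (tri_x f) = (\<lambda>a b c. tcoef f (a - 1) b c)"
  "tcoef (tri_y f) = (\<lambda>a b c. tcoef f a (b - 1) c)"
  "tcoef (tri_z f) = (\<lambda>a b c. tcoef f a b (c - 1))"
  "tcoef (tri_swap12 f) = (\<lambda>a b c. tcoef f b a c)"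
  "tcoef (tri_monom v i j k) = (\<lambda>a b c. if a = i \<and> b = j \<and> c = k then v else 0)"
  "additive h \<Longrightarrow> tcoef (tri_map h f) = (\<lambda>a b c. h (tcoef f a b c))"
  by (simp_all add: fun_eq_iff tcoef_tri_map)

lemma tri_rel_eq: "tri_rel f = tri_z f - tri_x f - tri_y f"
  by (rule tri_eqI) (simp add: tri_rel.rep_eq)

definition tri_slice :: "'v::ab_group_add tri_series \<Rightarrow> int \<Rightarrow> int \<Rightarrow> 'v fls" where
  "tri_slice f a b = lseries (tcoef f a b)"

lemma lcoef_tri_slice [simp]: "lcoef (tri_slice f a b) c = tcoef f a b c"
proof -
  obtain N where N: "tri_bounded N (tcoef f)" using tri_bounded_tcoef by blast
  show ?thesis unfolding tri_slice_def
    by (rule lcoef_lseries[where N = N]) (use N in \<open>auto simp: tri_bounded_def\<close>)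
qed

lemma tri_slice_add: "tri_slice (f + g) a b = tri_slice f a b + tri_slice g a b"
  by (rule lseries_eqI) simp

text \<open>\<open>T\<close> acts on the series in \<nu>, the exponents of \<lambda> and \<mu> being
  parameters. With \<open>psdo_mult D A\<close> for \<open>T\<close> this is the action of
  A(\<nu>+\<partial>), that is, of A(\<lambda>+\<mu>+\<partial>) in the quotient.\<close>

definition tri_op :: "('v fls \<Rightarrow> 'v fls) \<Rightarrow> 'v::ab_group_add tri_series \<Rightarrow> 'v tri_series" where
  "tri_op T f = tri_of (\<lambda>a b c. lcoef (T (tri_slice f a b)) c)"

lemma tcoef_tri_op:
  assumes "additive T" "\<And>N A. lbound N A \<Longrightarrow> lbound (N + M) (T A)"
  shows "tcoef (tri_op T f) a b c = lcoef (T (tri_slice f a b)) c"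
proof -
  obtain N where N: "tri_bounded N (tcoef f)" using tri_bounded_tcoef by blast
  have "lbound (N + M) (T (tri_slice f a b))" for a b
    by (rule assms(2)) (use N in \<open>auto simp: lbound_def tri_bounded_def\<close>)
  moreover have "tri_slice f a b = 0" if "N < a \<or> N < b" for a b
    by (rule lseries_eqI) (use N that in \<open>auto simp: tri_bounded_def\<close>)
  ultimately have "tri_bounded (max N (N + M)) (\<lambda>a b c. lcoef (T (tri_slice f a b)) c)"
    by (auto simp: tri_bounded_def lbound_def additive.zero[OF assms(1)])
  then show ?thesis by (simp add: tri_op_def tcoef_tri_of)
qed

lemma tcoef_tri_op_adj:
  "additive D \<Longrightarrow> tcoef (tri_op (psdo_adj D) f) a b c = lcoef (psdo_adj D (tri_slice f a b)) c"
  by (rule tcoef_tri_op[where M = 0]) (auto intro: additive_psdo_adj lbound_psdo_adj)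

lemma tcoef_tri_op_mult:
  assumes D: "additive D"
  shows "tcoef (tri_op (psdo_mult D A) f) a b c = lcoef (psdo_mult D A (tri_slice f a b)) c"
proof -
  obtain M where "lbound M A" using lbound_exists by blast
  then show ?thesis
    by (intro tcoef_tri_op[where M = M])
      (auto intro: additive_psdo_mult_right[OF D] simp: add.commute[of _ M] lbound_psdo_mult[OF D])
qed

text \<open>
  The substitution of \<open>-\<nu>-\<partial>\<close> for \<open>\<mu>\<close> and of \<open>-\<mu>-\<partial>\<close> for \<open>\<nu>\<close>, with \<open>\<partial>\<close> acting on the coefficients.
  It exchanges the last two arguments of the triple brackets of a skewsymmetric bracket.
\<close>

definition tri_adj :: "('v::comm_ring_1 \<Rightarrow> 'v) \<Rightarrow> 'v tri_series \<Rightarrow> 'v tri_series" where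
  "tri_adj D f = tri_op (psdo_adj D) (tri_swap23 (tri_op (psdo_adj D) f))"

lemma additive_tri_op_adj: "additive D \<Longrightarrow> additive (tri_op (psdo_adj D))"
  unfolding additive_def[of "tri_op _"]
  by (auto intro!: tri_eqI simp: tcoef_tri_op_adj tri_slice_add psdo_adj_add)

lemma additive_tri_swap: "additive tri_swap12" "additive tri_swap23"
  by (auto simp: additive_def intro!: tri_eqI)

lemma additive_tri_adj: "additive D \<Longrightarrow> additive (tri_adj D)"
  by (simp add: additive_def[of "tri_adj D"] tri_adj_def additive.add[OF additive_tri_op_adj]
      additive.add[OF additive_tri_swap(2)])

lemma tri_op_adj_xyz:
  assumes D: "additive D"
  shows "tri_op (psdo_adj D) (tri_x f) = tri_x (tri_op (psdo_adj D) f)"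
    "tri_op (psdo_adj D) (tri_y f) = tri_y (tri_op (psdo_adj D) f)"
    "tri_op (psdo_adj D) (tri_z f) = - (tri_z (tri_op (psdo_adj D) f) + tri_map D (tri_op (psdo_adj D) f))"
    "tri_op (psdo_adj D) (tri_map D f) = tri_map D (tri_op (psdo_adj D) f)"
proof -
  have "tri_slice (tri_x f) a b = tri_slice f (a - 1) b" "tri_slice (tri_y f) a b = tri_slice f a (b - 1)"
    "tri_slice (tri_z f) a b = fls_X_inv * tri_slice f a b"
    "tri_slice (tri_map D f) a b = fls_map D (tri_slice f a b)" for a b
    by (auto intro!: lseries_eqI simp: tcoef_tri_map D lcoef_fls_map_additive)
  note slice = this
  show "tri_op (psdo_adj D) (tri_x f) = tri_x (tri_op (psdo_adj D) f)"
    "tri_op (psdo_adj D) (tri_y f) = tri_y (tri_op (psdo_adj D) f)"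
    "tri_op (psdo_adj D) (tri_z f) = - (tri_z (tri_op (psdo_adj D) f) + tri_map D (tri_op (psdo_adj D) f))"
    "tri_op (psdo_adj D) (tri_map D f) = tri_map D (tri_op (psdo_adj D) f)"
    by (auto intro!: tri_eqI simp: tcoef_tri_op_adj D slice psdo_adj_X_inv_mult lcoef_psdo_mult_X_inv
        tcoef_tri_map lcoef_fls_map_additive fls_map_psdo_adj[OF D refl D D, symmetric])
qed

lemma tri_op_adj_adj: "additive D \<Longrightarrow> tri_op (psdo_adj D) (tri_op (psdo_adj D) f) = f"
proof (rule tri_eqI)
  fix a b c
  assume D: "additive D"
  have "tri_slice (tri_op (psdo_adj D) f) a b = psdo_adj D (tri_slice f a b)"
    by (rule lseries_eqI) (simp add: tcoef_tri_op_adj D)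
  then show "tcoef (tri_op (psdo_adj D) (tri_op (psdo_adj D) f)) a b c = tcoef f a b c"
    by (simp add: tcoef_tri_op_adj D psdo_adj_adj)
qed

lemma tri_swap_swap [simp]: "tri_swap12 (tri_swap12 f) = f" "tri_swap23 (tri_swap23 f) = f"
  by (auto intro!: tri_eqI)

lemma tri_adj_adj: "additive D \<Longrightarrow> tri_adj D (tri_adj D f) = f"
  by (simp add: tri_adj_def tri_op_adj_adj)

lemma tri_swap_xyz:
  "tri_swap12 (tri_x f) = tri_y (tri_swap12 f)" "tri_swap12 (tri_y f) = tri_x (tri_swap12 f)"
  "tri_swap12 (tri_z f) = tri_z (tri_swap12 f)" "tri_swap23 (tri_x f) = tri_x (tri_swap23 f)"
  "tri_swap23 (tri_y f) = tri_z (tri_swap23 f)" "tri_swap23 (tri_z f) = tri_y (tri_swap23 f)"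
  by (auto intro!: tri_eqI)

lemma tri_swap_map:
  assumes "additive D"
  shows "tri_swap12 (tri_map D f) = tri_map D (tri_swap12 f)" "tri_swap23 (tri_map D f) = tri_map D (tri_swap23 f)"
  by (auto intro!: tri_eqI simp: tcoef_tri_map assms)

lemma tri_adj_xyz:
  assumes D: "additive D"
  shows "tri_adj D (tri_x f) = tri_x (tri_adj D f)"
    "tri_adj D (tri_y f) = - (tri_z (tri_adj D f) + tri_map D (tri_adj D f))"
    "tri_adj D (tri_z f) = - (tri_y (tri_adj D f) + tri_map D (tri_adj D f))"
  by (simp_all add: tri_adj_def tri_op_adj_xyz D tri_swap_xyz tri_swap_map
      additive.minus[OF additive_tri_op_adj[OF D]] additive.diff[OF additive_tri_op_adj[OF D]]
      additive.minus[OF additive_tri_swap(2)] additive.diff[OF additive_tri_swap(2)])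

text \<open>The substitution fixes \<nu>-\<lambda>-\<mu>, since (-\<mu>-\<partial>) - \<lambda> -
  (-\<nu>-\<partial>) is the same element; hence it descends to the quotient.\<close>

lemma tri_adj_rel:
  assumes D: "additive D"
  shows "tri_adj D (tri_rel f) = tri_rel (tri_adj D f)"
  using additive.diff[OF additive_tri_adj[OF D]]
  by (simp add: tri_rel_eq tri_adj_xyz D)

lemma tri_adj_monom:
  assumes D: "additive D"
  shows "tri_adj D (tri_monom v 0 0 0) = tri_monom v 0 0 0"
proof -
  have "tri_slice (tri_monom v 0 0 0) a b = (if a = 0 \<and> b = 0 then fls_const v else 0)" for a b
    by (auto intro!: lseries_eqI simp: lcoef_const)
  then have *: "tri_op (psdo_adj D) (tri_monom v 0 0 0) = tri_monom v 0 0 0"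
    by (auto intro!: tri_eqI simp: tcoef_tri_op_adj D psdo_adj_const lcoef_const additive.zero[OF additive_psdo_adj])
  have "tri_swap23 (tri_monom v 0 0 0) = tri_monom v 0 0 0"
    by (auto intro!: tri_eqI)
  then show ?thesis by (simp add: tri_adj_def *)
qed

text \<open>Total degree below \<open>e\<close>. Expanding \<nu> as \<lambda>+\<mu> preserves the
  total degree, and each derivative of a coefficient comes with a lower power, so this is the
  grading in which locality is stated.\<close>

definition tri_low :: "int \<Rightarrow> 'v::ab_group_add tri_series \<Rightarrow> bool" where
  "tri_low e f \<longleftrightarrow> (\<forall>a b c. e \<le> a + b + c \<longrightarrow> tcoef f a b c = 0)"

lemma tri_low_swap: "tri_low e f \<Longrightarrow> tri_low e (tri_swap12 f)" "tri_low e f \<Longrightarrow> tri_low e (tri_swap23 f)"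
  by (auto simp: tri_low_def algebra_simps)

lemma lcoef_psdo_adj_eq_0: "(\<And>n. k \<le> n \<Longrightarrow> lcoef A n = 0) \<Longrightarrow> lcoef (psdo_adj D A) k = 0"
  unfolding lcoef_psdo_adj by (rule sum.neutral) auto

lemma tri_low_adj: "additive D \<Longrightarrow> tri_low e f \<Longrightarrow> tri_low e (tri_adj D f)"
proof -
  assume D: "additive D"
  have "tri_low e (tri_op (psdo_adj D) f)" if "tri_low e f" for f
    unfolding tri_low_def
  proof (intro allI impI)
    fix a b c assume "e \<le> a + b + c"
    with that show "tcoef (tri_op (psdo_adj D) f) a b c = 0"
      unfolding tcoef_tri_op_adj[OF D] by (intro lcoef_psdo_adj_eq_0) (simp add: tri_low_def)
  qed
  then show "tri_low e f \<Longrightarrow> tri_low e (tri_adj D f)"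
    by (simp add: tri_adj_def tri_low_swap)
qed

lemma tri_decomp:
  obtains I B where "finite I" "tri_low e B"
    "f = (\<Sum>(a, b, c)\<in>I. tri_monom (tcoef f a b c) a b c) + (B :: 'v::ab_group_add tri_series)"
proof -
  obtain N where N: "tri_bounded N (tcoef f)" using tri_bounded_tcoef by blast
  \<comment> \<open>When all three exponents are at most \<open>N\<close> and their sum is at least
    \<open>e\<close>, each of them is at least e - 2N.\<close>
  define L where "L = e - 2 * N"
  let ?I = "{L..N} \<times> {L..N} \<times> {L..N}"
  let ?B = "f - (\<Sum>(a, b, c)\<in>?I. tri_monom (tcoef f a b c) a b c)"
  have tsum: "tcoef (sum g I) a b c = (\<Sum>i\<in>I. tcoef (g i) a b c)" for g :: "int \<times> int \<times> int \<Rightarrow> 'v tri_series" and I a b c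
    by (induction I rule: infinite_finite_induct) auto
  have "tri_low e ?B"
    unfolding tri_low_def
  proof (intro allI impI)
    fix a b c assume e: "e \<le> a + b + c"
    have "tcoef (\<Sum>(a, b, c)\<in>?I. tri_monom (tcoef f a b c) a b c) a b c =
        (\<Sum>i\<in>?I. if i = (a, b, c) then tcoef f a b c else 0)"
      unfolding tsum by (intro sum.cong refl) (auto split: if_splits)
    also have "\<dots> = (if (a, b, c) \<in> ?I then tcoef f a b c else 0)" by (simp add: sum.delta)
    also have "\<dots> = tcoef f a b c"
      using e tri_boundedD[OF N, of a b c] by (cases "N < a \<or> N < b \<or> N < c") (auto simp: L_def)
    finally show "tcoef ?B a b c = 0" by simp
  qed
  then show thesis by (intro that[of ?I ?B]) auto
qed

lemma tri_local_eq:
  fixes S T :: "'v::ab_group_add tri_series \<Rightarrow> 'b::ab_group_add"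
  assumes S: "additive S" and T: "additive T"
    and eq: "\<And>v a b c. S (tri_monom v a b c) = T (tri_monom v a b c)"
    and "\<And>f. tri_low e f \<Longrightarrow> S f = 0" "\<And>f. tri_low e f \<Longrightarrow> T f = 0"
  shows "S f = T f"
proof -
  obtain I B where I: "finite I" "tri_low e B" and f: "f = (\<Sum>(a, b, c)\<in>I. tri_monom (tcoef f a b c) a b c) + B"
    by (rule tri_decomp)
  have "S f = S (\<Sum>(a, b, c)\<in>I. tri_monom (tcoef f a b c) a b c) + S B"
    using f additive.add[OF S] by metis
  moreover have "T f = T (\<Sum>(a, b, c)\<in>I. tri_monom (tcoef f a b c) a b c) + T B"
    using f additive.add[OF T] by metis
  ultimately show ?thesis
    using I assms(4,5) by (simp add: additive.sum[OF S] additive.sum[OF T] case_prod_unfold eq)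
qed

text \<open>
  Induction on the exponents, where injectivity gives the downward steps, reduces the claim for monomials
  to constants; by locality in the total degree a general series reduces to monomials.
\<close>

lemma tri_intertwine_eq:
  fixes S T :: "'v::ab_group_add tri_series \<Rightarrow> 'b::ab_group_add fls fls"
  assumes S: "additive S" and T: "additive T"
    and x: "\<And>f. S (tri_x f) = X (S f)" "\<And>f. T (tri_x f) = X (T f)" "inj X"
    and y: "\<And>f. S (tri_y f) = Y (S f)" "\<And>f. T (tri_y f) = Y (T f)" "inj Y"
    and z: "\<And>f. S (tri_z f) = Z (S f)" "\<And>f. T (tri_z f) = Z (T f)" "inj Z"
    and const: "\<And>v. S (tri_monom v 0 0 0) = T (tri_monom v 0 0 0)"
    and low: "\<And>p q f. tri_low (p + q) f \<Longrightarrow> lcoef (lcoef (S f) q) p = 0"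
      "\<And>p q f. tri_low (p + q) f \<Longrightarrow> lcoef (lcoef (T f) q) p = 0"
  shows "S f = T f"
proof -
  have monom: "tri_monom v (a + 1) b c = tri_x (tri_monom v a b c)"
    "tri_monom v a (b + 1) c = tri_y (tri_monom v a b c)"
    "tri_monom v a b (c + 1) = tri_z (tri_monom v a b c)" for v :: 'v and a b c
    by (auto intro!: tri_eqI)
  have 1: "S (tri_monom v a 0 0) = T (tri_monom v a 0 0)" for v a
    by (induction a rule: int_up_down) (simp_all add: const monom x injD[OF x(3)] inj_eq[OF x(3)])
  have 2: "S (tri_monom v a b 0) = T (tri_monom v a b 0)" for v a b
    by (induction b rule: int_up_down) (simp_all add: 1 monom y inj_eq[OF y(3)])
  have 3: "S (tri_monom v a b c) = T (tri_monom v a b c)" for v a b c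
    by (induction c rule: int_up_down) (simp_all add: 2 monom z inj_eq[OF z(3)])
  show ?thesis
  proof (intro lseries_eqI)
    fix p q
    show "lcoef (lcoef (S f) q) p = lcoef (lcoef (T f) q) p"
      by (rule tri_local_eq[where S = "\<lambda>f. lcoef (lcoef (S f) q) p" and
            T = "\<lambda>f. lcoef (lcoef (T f) q) p" and f = f and e = "p + q"])
        (auto intro!: additive_comp[OF additive_lcoef] S T simp: 3 low)
  qed
qed

section \<open>The three expansions\<close>

lemma additive_tri_expand:
  assumes "\<And>f q p. lcoef (lcoef (E f) q) p = s q * xy_expand (\<lambda>a b c. G a b c f) p q"
    and "\<And>f. \<exists>N. tri_bounded N (\<lambda>a b c. G a b c f)"
    and "\<And>f g a b c. G a b c (f - g) = G a b c f - G a b c g"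
  shows "additive (E :: 'v::comm_ring_1 tri_series \<Rightarrow> 'v fls fls)"
proof -
  have diff: "E (f - g) = E f - E g" for f g
  proof (intro lseries_eqI)
    fix p q
    obtain M N where "tri_bounded M (\<lambda>a b c. G a b c f)" "tri_bounded N (\<lambda>a b c. G a b c g)"
      using assms(2) by blast
    then show "lcoef (lcoef (E (f - g)) q) p = lcoef (lcoef (E f - E g) q) p"
      by (simp add: assms(1,3) xy_expand_diff right_diff_distrib)
  qed
  show ?thesis
    unfolding additive_def
  proof (intro allI)
    fix f g
    show "E (f + g) = E f + E g"
      using diff[of f "0 - g"] diff[of 0 g] diff[of 0 0] by simp
  qed
qed

lemma additive_tri_lm: "additive tri_lm"
  by (rule additive_tri_expand[where s = "\<lambda>_. 1" and G = "\<lambda>a b c f. tcoef f a b c"])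
    (simp_all add: lcoef_tri_lm tri_bounded_tcoef)

lemma additive_tri_nl: "additive tri_nl"
  by (rule additive_tri_expand[where s = "\<lambda>p. (- 1) ^ nat \<bar>p\<bar>" and G = "\<lambda>c a b f. (- 1) ^ nat \<bar>a\<bar> * tcoef f a b c"])
    (use tri_bounded_tcoef tri_bounded_perm(2) in \<open>auto simp: lcoef_tri_nl right_diff_distrib, blast\<close>)

lemma tri_ml_eq: "tri_ml f = tri_lm (tri_swap12 f)"
  by (intro lseries_eqI) (simp add: lcoef_tri_ml lcoef_tri_lm tcoef_fun)

lemma xy_expand_shift:
  "xy_expand (\<lambda>a b c. G (a - 1) b c) p q = xy_expand G (p - 1) q"
  "xy_expand (\<lambda>a b c. G a (b - 1) c) p q = xy_expand G p (q - 1)"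
  by (simp_all add: xy_expand_def algebra_simps)

lemma xy_expand_map:
  fixes h :: "'v::comm_ring_1 \<Rightarrow> 'w::comm_ring_1"
  assumes h: "additive h" and N: "tri_bounded N G"
  shows "xy_expand (\<lambda>a b c. h (G a b c)) p q = h (xy_expand G p q)"
proof -
  have N': "tri_bounded N (\<lambda>a b c. h (G a b c))"
    using N by (simp add: tri_bounded_def additive.zero[OF h])
  define K where "K = nat (2 * N - q) + 1"
  have K: "2 * N - q < int K" by (simp add: K_def)
  show ?thesis
    by (simp add: xy_expand_box[OF N K order_refl order_refl] xy_expand_box[OF N' K order_refl order_refl]
        additive.sum[OF h] additive_of_int_mult[OF h])
qed

lemma xy_expand_low:
  assumes "\<And>a b c. a + b + c = p + q \<Longrightarrow> G a b c = 0"
  shows "xy_expand G p q = 0"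
  unfolding xy_expand_def by (rule sum.neutral) (use assms in auto)

lemma xy_expand_monom:
  "xy_expand (\<lambda>a b c. if a = 0 \<and> b = 0 \<and> c = 0 then v else 0) p q = (if p = 0 \<and> q = 0 then v else 0)"
proof -
  let ?G = "\<lambda>a b c. if a = 0 \<and> b = 0 \<and> c = 0 then v else (0 :: 'a)"
  \<comment> \<open>The only index that can contribute has c = 0 and k = p; the coefficient
    binom(0,p) then leaves just p = 0.\<close>
  have "xy_expand ?G p q = (\<Sum>(k, c)\<in>(if 0 \<le> p \<and> q = - p \<and> v \<noteq> 0 then {(nat p, 0)} else {}).
      of_int (ibinom c k) * ?G (p - int k) (q + int k - c) c)"
    unfolding xy_expand_def by (rule sum.cong) (auto split: if_splits)
  then show ?thesis by (auto simp: ibinom_0_left)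
qed

definition inner_x :: "'v::comm_ring_1 fls fls \<Rightarrow> 'v fls fls" where
  "inner_x g = fls_map ((*) fls_X_inv) g"

lemma additive_times: "additive ((*) (a :: 'a::comm_ring_1))"
  by (simp add: additive_def distrib_left)

lemma lcoef_inner_x [simp]: "lcoef (inner_x g) q = fls_X_inv * lcoef g q"
  by (simp add: inner_x_def lcoef_fls_map_additive additive_times)

lemma tri_lm_xyz:
  "tri_lm (tri_x f) = inner_x (tri_lm f)"
  "tri_lm (tri_y f) = fls_X_inv * tri_lm f"
  "tri_lm (tri_z f) = inner_x (tri_lm f) + fls_X_inv * tri_lm f"
proof -
  show 1: "tri_lm (tri_x f) = inner_x (tri_lm f)"
    by (intro lseries_eqI) (simp add: lcoef_tri_lm tcoef_fun xy_expand_shift[of "tcoef f"])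
  show 2: "tri_lm (tri_y f) = fls_X_inv * tri_lm f"
    by (intro lseries_eqI) (simp add: lcoef_tri_lm tcoef_fun xy_expand_shift(2)[of "tcoef f"])
  \<comment> \<open>The expansion is constant on classes, so it kills \<nu>-\<lambda>-\<mu>, and
    \<nu> acts as \<lambda>+\<mu> without a binomial computation.\<close>
  have "tri_equiv (tri_rel f) 0"
    unfolding tri_equiv_def by (intro exI[of _ f]) simp
  then have "tri_lm (tri_rel f) = tri_lm 0"
    by (intro lseries_eqI) (simp only: lcoef_tri_lm xy_expand_equiv(1))
  then show "tri_lm (tri_z f) = inner_x (tri_lm f) + fls_X_inv * tri_lm f"
    by (simp add: tri_rel_eq additive.diff[OF additive_tri_lm] additive.add[OF additive_tri_lm] additive.zero[OF additive_tri_lm] 1 2 algebra_simps)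
qed

lemma tri_nl_xyz:
  "tri_nl (tri_x f) = fls_X_inv * tri_nl f"
  "tri_nl (tri_y f) = inner_x (tri_nl f) - fls_X_inv * tri_nl f"
  "tri_nl (tri_z f) = inner_x (tri_nl f)"
proof -
  let ?G = "\<lambda>c a b. (- 1) ^ nat \<bar>a\<bar> * tcoef f a b c"
  show 1: "tri_nl (tri_x f) = fls_X_inv * tri_nl f"
  proof (intro lseries_eqI)
    fix r p
    \<comment> \<open>Shifting the exponent of \<lambda> changes the inner sign; the outer sign,
      taken at p instead of p - 1, compensates for it.\<close>
    have "(\<lambda>c a b. (- 1) ^ nat \<bar>a\<bar> * tcoef (tri_x f) a b c) = (\<lambda>c a b. - ?G c (a - 1) b)"
      by (simp add: fun_eq_iff minus_one_power_pred)
    then have "xy_expand (\<lambda>c a b. (- 1) ^ nat \<bar>a\<bar> * tcoef (tri_x f) a b c) r p = - xy_expand ?G r (p - 1)"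
      using xy_expand_shift(2)[of ?G r p] by (simp only: xy_expand_uminus)
    then show "lcoef (lcoef (tri_nl (tri_x f)) p) r = lcoef (lcoef (fls_X_inv * tri_nl f) p) r"
      by (simp only: lcoef_tri_nl lcoef_X_inv_mult minus_one_power_pred) simp
  qed
  show 3: "tri_nl (tri_z f) = inner_x (tri_nl f)"
    using xy_expand_shift(1)[of ?G]
    by (intro lseries_eqI) (simp add: lcoef_tri_nl)
  have "tri_equiv (tri_rel f) 0"
    unfolding tri_equiv_def by (intro exI[of _ f]) simp
  then have "tri_nl (tri_rel f) = tri_nl 0"
    by (intro lseries_eqI) (simp only: lcoef_tri_nl xy_expand_equiv(3))
  then show "tri_nl (tri_y f) = inner_x (tri_nl f) - fls_X_inv * tri_nl f"
    by (simp add: tri_rel_eq additive.diff[OF additive_tri_nl] additive.add[OF additive_tri_nl] additive.zero[OF additive_tri_nl] 1 3 algebra_simps)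
qed

lemma tri_ml_xyz:
  "tri_ml (tri_x f) = fls_X_inv * tri_ml f"
  "tri_ml (tri_y f) = inner_x (tri_ml f)"
  "tri_ml (tri_z f) = inner_x (tri_ml f) + fls_X_inv * tri_ml f"
  by (simp_all add: tri_ml_eq tri_swap_xyz tri_lm_xyz)

lemma tri_lm_map:
  fixes h :: "'v::comm_ring_1 \<Rightarrow> 'w::comm_ring_1"
  assumes h: "additive h"
  shows "tri_lm (tri_map h f) = fls_map (fls_map h) (tri_lm f)"
proof (intro lseries_eqI)
  fix p q
  obtain N where N: "tri_bounded N (tcoef f)" using tri_bounded_tcoef by blast
  show "lcoef (lcoef (tri_lm (tri_map h f)) q) p = lcoef (lcoef (fls_map (fls_map h) (tri_lm f)) q) p"
    using xy_expand_map[OF h N]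
    by (simp add: lcoef_tri_lm lcoef_fls_map_additive additive_fls_map h tcoef_fun)
qed

lemma tri_nl_map:
  fixes h :: "'v::comm_ring_1 \<Rightarrow> 'v"
  assumes h: "additive h"
  shows "tri_nl (tri_map h f) = fls_map (fls_map h) (tri_nl f)"
proof (intro lseries_eqI)
  fix p q
  obtain N where N: "tri_bounded N (tcoef f)" using tri_bounded_tcoef by blast
  have s: "h ((- 1) ^ n * x) = (- 1) ^ n * h x" for n x
    by (auto simp: minus_one_power_iff additive.minus[OF h])
  show "lcoef (lcoef (tri_nl (tri_map h f)) q) p = lcoef (lcoef (fls_map (fls_map h) (tri_nl f)) q) p"
    using xy_expand_map[OF h tri_bounded_perm(2)[OF N]]
    by (simp add: lcoef_tri_nl lcoef_fls_map_additive additive_fls_map h tcoef_tri_map s)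
qed

lemma tri_lm_low: "tri_low (p + q) f \<Longrightarrow> lcoef (lcoef (tri_lm f) q) p = 0"
  unfolding lcoef_tri_lm by (rule xy_expand_low) (simp add: tri_low_def)

lemma tri_nl_low: "tri_low (p + q) f \<Longrightarrow> lcoef (lcoef (tri_nl f) q) p = 0"
  unfolding lcoef_tri_nl by (subst xy_expand_low) (simp_all add: tri_low_def algebra_simps)

lemma tri_lm_monom: "tri_lm (tri_monom v 0 0 0) = fls_const (fls_const v)"
  by (intro lseries_eqI) (simp add: lcoef_tri_lm tcoef_fun xy_expand_monom lcoef_const)

lemma tri_nl_monom: "tri_nl (tri_monom v 0 0 0) = fls_const (fls_const v)"
proof (intro lseries_eqI)
  fix r p
  have "(\<lambda>c a b. (- 1) ^ nat \<bar>a\<bar> * tcoef (tri_monom v 0 0 0) a b c) =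
      (\<lambda>a b c. if a = 0 \<and> b = 0 \<and> c = 0 then v else 0)"
    by (auto simp: fun_eq_iff)
  then show "lcoef (lcoef (tri_nl (tri_monom v 0 0 0)) p) r = lcoef (lcoef (fls_const (fls_const v)) p) r"
    unfolding lcoef_tri_nl by (simp add: xy_expand_monom lcoef_const)
qed

section \<open>Compatibility of the expansions with the operations\<close>

text \<open>\<open>nabla D\<close> is the operator \<open>\<lambda>+\<partial>\<close> on \<open>V((\<lambda>\<inverse>))\<close>.\<close>

abbreviation nabla :: "('v::comm_ring_1 \<Rightarrow> 'v) \<Rightarrow> 'v fls \<Rightarrow> 'v fls" where
  "nabla D \<equiv> psdo_mult D fls_X_inv"

lemma additive_fls_const: "additive fls_const"
  by (simp add: additive_def fls_plus_const)

lemma inj_inner_x: "inj inner_x"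
proof (rule injI)
  fix g h :: "'a fls fls" assume "inner_x g = inner_x h"
  then have "fls_X_inv * lcoef g q = fls_X_inv * lcoef h q" for q
    by (metis lcoef_inner_x)
  then show "g = h" by (intro lseries_eqI) (simp del: lcoef_X_inv_mult)
qed

lemma fls_map_nabla:
  assumes D: "additive D"
  shows "fls_map (psdo_mult D fls_X_inv) g = inner_x g + fls_map (fls_map D) g"
  by (rule lseries_eqI)
    (simp add: lcoef_fls_map_additive additive_psdo_mult_right D additive_fls_map psdo_mult_X_inv)

lemma inj_psdo_mult_X_inv: "additive D \<Longrightarrow> inj (psdo_mult D fls_X_inv)"
  by (auto intro: injI psdo_mult_X_inv_inj)

lemma inj_uminus_comp: "inj f \<Longrightarrow> inj (\<lambda>x. - f x :: 'b::ab_group_add)"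
  by (auto simp: inj_def)

lemma inj_fls_map: "additive f \<Longrightarrow> inj f \<Longrightarrow> inj (fls_map f)"
  by (rule injI) (metis injD lcoef_fls_map_additive lseries_eqI)

lemma tri_low_mono: "tri_low e f \<Longrightarrow> e \<le> e' \<Longrightarrow> tri_low e' f"
  unfolding tri_low_def by auto

definition xy_low :: "int \<Rightarrow> 'v::zero fls fls \<Rightarrow> bool" where
  "xy_low e g \<longleftrightarrow> (\<forall>p q. e \<le> p + q \<longrightarrow> lcoef (lcoef g q) p = 0)"

lemma xy_low_tri_lm: "tri_low e f \<Longrightarrow> xy_low e (tri_lm f)"
  and xy_low_tri_nl: "tri_low e f \<Longrightarrow> xy_low e (tri_nl f)"
  unfolding xy_low_def by (blast intro: tri_lm_low tri_nl_low tri_low_mono)+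

lemma lcoef_sign_mult: "lcoef ((- 1) ^ n * of_int i * A) p = (- 1) ^ n * of_int i * lcoef (A :: 'a::comm_ring_1 fls) p"
  by (auto simp: minus_one_power_iff additive_of_int_mult[OF additive_lcoef])

lemma lbound_funpow:
  fixes N :: "'a::zero fls \<Rightarrow> 'a fls"
  assumes "\<And>A k. lbound k A \<Longrightarrow> lbound (k + 1) (N A)" and "lbound k A"
  shows "lbound (k + int j) ((N ^^ j) A)"
proof (induction j)
  case (Suc j)
  from assms(1)[OF this] show ?case by (simp add: algebra_simps)
qed (use assms in simp)

lemma lbound_nabla: "additive D \<Longrightarrow> lbound k A \<Longrightarrow> lbound (k + 1) (psdo_mult D fls_X_inv A)"
  by (simp add: lbound_def lcoef_psdo_mult_X_inv additive.zero)

lemma xy_low_lbound: "xy_low e g \<longleftrightarrow> (\<forall>q. lbound (e - q - 1) (lcoef g q))"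
  by (simp add: xy_low_def lbound_def) (smt (verit))

text \<open>In the coefficient of index q, the power N^j meets the coefficient of index q + j: the
  inner degree rises by at most j while the outer one drops by j.\<close>

lemma xy_low_psdo_adj:
  assumes N: "additive N"
    and low: "\<And>A k. lbound k A \<Longrightarrow> lbound (k + 1) (N A)"
    and g: "xy_low e g"
  shows "xy_low e (psdo_adj N g)"
  unfolding xy_low_def
proof (intro allI impI)
  fix p q assume e: "e \<le> p + q"
  obtain M where M: "lbound M g" using lbound_exists by blast
  define J where "J = nat (M - q) + 1"
  have J: "M - q < int J" by (simp add: J_def)
  have "lcoef ((N ^^ j) (lcoef g (q + int j))) p = 0" for j
  proof -
    have "lbound (e - (q + int j) - 1) (lcoef g (q + int j))" using g by (simp add: xy_low_lbound)
    from lbound_funpow[OF low this] show ?thesis by (rule lboundD) (use e in auto)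
  qed
  then show "lcoef (lcoef (psdo_adj N g) q) p = 0"
    unfolding lcoef_psdo_adj_box[OF N M J] lcoef_sum lcoef_sign_mult by simp
qed

lemma xy_low_nabla_mult:
  assumes D: "additive D" and g: "xy_low e g" and A: "lbound m A"
  shows "xy_low (e + m) (psdo_mult (psdo_mult D fls_X_inv) (fls_map fls_const A) g)"
  unfolding xy_low_def
proof (intro allI impI)
  fix p q assume e: "e + m \<le> p + q"
  let ?N = "psdo_mult D fls_X_inv"
  have N: "additive ?N" by (rule additive_psdo_mult_right[OF D])
  obtain M where M: "lbound M g" using lbound_exists by blast
  have A': "lbound m (fls_map fls_const A)"
    using A by (simp add: lbound_def lcoef_fls_map_additive additive_fls_const)
  define J where "J = nat (m + M - q) + 1"
  have J: "m + M - q < int J" by (simp add: J_def)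
  have "lcoef ((?N ^^ j) (lcoef g (q - i + int j))) p = 0" if "i \<le> m" for i j
  proof -
    have "lbound (e - (q - i + int j) - 1) (lcoef g (q - i + int j))" using g by (simp add: xy_low_lbound)
    from lbound_funpow[OF lbound_nabla[OF D] this] show ?thesis by (rule lboundD) (use e that in auto)
  qed
  then show "lcoef (lcoef (psdo_mult ?N (fls_map fls_const A) g) q) p = 0"
    unfolding lcoef_psdo_mult_box[OF N A' M order_refl order_refl J] lcoef_sum mult.assoc
      additive_of_int_mult[OF additive_lcoef]
    by (simp add: lcoef_fls_map_additive additive_fls_const)
qed

text \<open>In the outer variable \<mu>, the adjoint for the connection \<lambda>+\<partial>
  substitutes -\<mu>-(\<lambda>+\<partial>) for \<mu>. As \<nu> = \<lambda>+\<mu>, this sends \<mu>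
  to -\<nu>-\<partial> and \<nu> to -\<mu>-\<partial>.\<close>

lemma tri_lm_adj:
  assumes D: "additive D"
  shows "tri_lm (tri_adj D f) = psdo_adj (psdo_mult D fls_X_inv) (tri_lm f)"
proof -
  let ?N = "psdo_mult D fls_X_inv"
  have N: "additive ?N" by (rule additive_psdo_mult_right[OF D])
  have x: "psdo_adj ?N (inner_x g) = inner_x (psdo_adj ?N g)" for g
    unfolding inner_x_def
    by (rule fls_map_psdo_adj[OF additive_times _ N N, symmetric])
      (simp add: psdo_mult_X_inv D fls_map_X_inv_mult distrib_left)
  note lm = additive.add[OF additive_tri_lm] additive.minus[OF additive_tri_lm] additive.diff[OF additive_tri_lm]
  show ?thesis
  proof (rule tri_intertwine_eq[where S = "\<lambda>f. tri_lm (tri_adj D f)" and T = "\<lambda>f. psdo_adj ?N (tri_lm f)"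
        and X = inner_x and Y = "\<lambda>g. - psdo_mult ?N fls_X_inv g"
        and Z = "\<lambda>g. - psdo_mult (fls_map D) fls_X_inv g"])
    show "additive (\<lambda>f. tri_lm (tri_adj D f))"
      by (rule additive_comp[OF additive_tri_lm additive_tri_adj[OF D]])
    show "additive (\<lambda>f. psdo_adj ?N (tri_lm f))"
      by (rule additive_comp[OF additive_psdo_adj[OF N] additive_tri_lm])
    show "inj inner_x" by (rule inj_inner_x)
    show "inj (\<lambda>g. - psdo_mult ?N fls_X_inv g)"
      by (intro inj_uminus_comp inj_psdo_mult_X_inv N)
    show "inj (\<lambda>g. - psdo_mult (fls_map D) fls_X_inv g)"
      by (intro inj_uminus_comp inj_psdo_mult_X_inv additive_fls_map D)
    show "tri_lm (tri_adj D (tri_x f)) = inner_x (tri_lm (tri_adj D f))" for f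
      by (simp add: tri_adj_xyz D tri_lm_xyz)
    show "tri_lm (tri_adj D (tri_y f)) = - psdo_mult ?N fls_X_inv (tri_lm (tri_adj D f))" for f
      by (simp add: tri_adj_xyz D tri_lm_xyz lm tri_lm_map psdo_mult_X_inv[OF N] fls_map_nabla)
    show "tri_lm (tri_adj D (tri_z f)) = - psdo_mult (fls_map D) fls_X_inv (tri_lm (tri_adj D f))" for f
      by (simp add: tri_adj_xyz D tri_lm_xyz lm tri_lm_map psdo_mult_X_inv additive_fls_map)
    show "psdo_adj ?N (tri_lm (tri_x f)) = inner_x (psdo_adj ?N (tri_lm f))" for f
      by (simp add: tri_lm_xyz x)
    show "psdo_adj ?N (tri_lm (tri_y f)) = - psdo_mult ?N fls_X_inv (psdo_adj ?N (tri_lm f))" for f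
      by (simp add: tri_lm_xyz psdo_adj_X_inv_mult N)
    show "psdo_adj ?N (tri_lm (tri_z f)) = - psdo_mult (fls_map D) fls_X_inv (psdo_adj ?N (tri_lm f))" for f
      by (simp add: tri_lm_xyz psdo_adj_add[OF N] x psdo_adj_X_inv_mult N psdo_mult_X_inv[OF N] fls_map_nabla D
          psdo_mult_X_inv[OF additive_fls_map[OF D]])
    show "tri_lm (tri_adj D (tri_monom v 0 0 0)) = psdo_adj ?N (tri_lm (tri_monom v 0 0 0))" for v
      by (simp add: tri_adj_monom D tri_lm_monom psdo_adj_const N)
    show "lcoef (lcoef (tri_lm (tri_adj D f)) q) p = 0" if "tri_low (p + q) f" for p q f
      by (rule tri_lm_low[OF tri_low_adj[OF D that]])
    show "lcoef (lcoef (psdo_adj ?N (tri_lm f)) q) p = 0" if "tri_low (p + q) f" for p q f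
      using xy_low_psdo_adj[OF N lbound_nabla[OF D] xy_low_tri_lm[OF that]] by (simp add: xy_low_def)
  qed
qed

text \<open>Both expansions have \<lambda> outside. The substitution turns the inner variable \<mu>
  of one into the inner variable \<nu> of the other, so it acts on each coefficient
  separately.\<close>

lemma tri_nl_adj:
  assumes D: "additive D"
  shows "tri_nl (tri_adj D f) = fls_map (psdo_adj D) (tri_ml f)"
proof -
  let ?N = "psdo_mult D fls_X_inv" and ?A = "fls_map (psdo_adj D)"
  have N: "additive ?N" by (rule additive_psdo_mult_right[OF D])
  have A: "additive (psdo_adj D)" by (rule additive_psdo_adj[OF D])
  have N': "additive (\<lambda>h. - ?N h)" using N by (simp add: additive_def)
  have x: "?A (inner_x g) = - fls_map ?N (?A g)" for g
    by (rule lseries_eqI) (simp add: lcoef_fls_map_additive A N psdo_adj_X_inv_mult D)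
  have ml: "additive tri_ml"
    unfolding tri_ml_eq[abs_def] by (rule additive_comp[OF additive_tri_lm additive_tri_swap(1)])
  note nl = additive.add[OF additive_tri_nl] additive.minus[OF additive_tri_nl] additive.diff[OF additive_tri_nl]
  \<comment> \<open>This operator is \<lambda>-\<nu>-\<partial>, which is -\<mu>-\<partial> with
    \<mu> = \<nu>-\<lambda>. Written as a composition for the additive map -(\<nu>+\<partial>), it
    is injective by the general lemma.\<close>
  have Z: "psdo_mult (\<lambda>h. - ?N h) fls_X_inv g = fls_X_inv * g - fls_map ?N g" for g
    unfolding psdo_mult_X_inv[OF N'] by (rule lseries_eqI) (simp add: lcoef_fls_map_additive N N')
  show ?thesis
  proof (rule tri_intertwine_eq[where S = "\<lambda>f. tri_nl (tri_adj D f)" and T = "\<lambda>f. ?A (tri_ml f)"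
        and X = "\<lambda>g. fls_X_inv * g" and Y = "\<lambda>g. - fls_map ?N g"
        and Z = "psdo_mult (\<lambda>h. - ?N h) fls_X_inv"])
    show "additive (\<lambda>f. tri_nl (tri_adj D f))"
      by (rule additive_comp[OF additive_tri_nl additive_tri_adj[OF D]])
    show "additive (\<lambda>f. ?A (tri_ml f))"
      by (rule additive_comp[OF additive_fls_map[OF A] ml])
    show "inj (\<lambda>g. fls_X_inv * g :: 'a fls fls)" by (simp add: inj_def)
    show "inj (\<lambda>g. - fls_map ?N g)"
      by (intro inj_uminus_comp inj_fls_map inj_psdo_mult_X_inv N D)
    show "inj (psdo_mult (\<lambda>h. - ?N h) fls_X_inv)"
      by (intro inj_psdo_mult_X_inv N')
    show "tri_nl (tri_adj D (tri_x f)) = fls_X_inv * (tri_nl (tri_adj D f))" for f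
      by (simp add: tri_adj_xyz D tri_nl_xyz)
    show "tri_nl (tri_adj D (tri_y f)) = - fls_map ?N (tri_nl (tri_adj D f))" for f
      by (simp add: tri_adj_xyz D tri_nl_xyz nl tri_nl_map fls_map_nabla)
    show "tri_nl (tri_adj D (tri_z f)) = psdo_mult (\<lambda>h. - ?N h) fls_X_inv (tri_nl (tri_adj D f))" for f
      by (simp add: Z tri_adj_xyz D tri_nl_xyz nl tri_nl_map fls_map_nabla)
    show "?A (tri_ml (tri_x f)) = fls_X_inv * ?A (tri_ml f)" for f
      by (simp add: tri_ml_xyz fls_map_X_inv_mult A)
    show "?A (tri_ml (tri_y f)) = - fls_map ?N (?A (tri_ml f))" for f
      by (simp add: tri_ml_xyz x)
    show "?A (tri_ml (tri_z f)) = psdo_mult (\<lambda>h. - ?N h) fls_X_inv (?A (tri_ml f))" for f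
      by (simp add: Z tri_ml_xyz additive.add[OF additive_fls_map[OF A]] x fls_map_X_inv_mult A)
    show "tri_nl (tri_adj D (tri_monom v 0 0 0)) = ?A (tri_ml (tri_monom v 0 0 0))" for v
    proof -
      have "tri_swap12 (tri_monom v 0 0 0) = tri_monom v 0 0 0" by (auto intro!: tri_eqI)
      then show ?thesis
        by (simp add: tri_adj_monom D tri_nl_monom tri_ml_eq tri_lm_monom fls_map_const A psdo_adj_const)
    qed
    show "lcoef (lcoef (tri_nl (tri_adj D f)) q) p = 0" if "tri_low (p + q) f" for p q f
      by (rule tri_nl_low[OF tri_low_adj[OF D that]])
    show "lcoef (lcoef (?A (tri_ml f)) q) p = 0" if "tri_low (p + q) f" for p q f
    proof -
      have "xy_low (p + q) (tri_ml f)"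
        unfolding tri_ml_eq by (rule xy_low_tri_lm[OF tri_low_swap(1)[OF that]])
      then show ?thesis
        by (simp add: lcoef_fls_map_additive A) (rule lcoef_psdo_adj_eq_0, simp add: xy_low_def)
    qed
  qed
qed

lemma tri_ml_adj:
  assumes D: "additive D"
  shows "tri_ml (tri_adj D f) = fls_map (psdo_adj D) (tri_nl f)"
proof -
  have "fls_map (psdo_adj D) (tri_nl f) = fls_map (psdo_adj D) (tri_nl (tri_adj D (tri_adj D f)))"
    by (simp add: tri_adj_adj D)
  also have "\<dots> = tri_ml (tri_adj D f)"
    unfolding tri_nl_adj[OF D]
    by (rule lseries_eqI) (simp add: lcoef_fls_map_additive additive_psdo_adj D psdo_adj_adj)
  finally show ?thesis ..
qed

text \<open>With \<nu> fixed, exchanging \<lambda> and \<mu> means replacing \<lambda> by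
  \<nu>-\<lambda>, which is the adjoint substitution with multiplication by -\<nu> in the place of
  \<partial>.\<close>

lemma tri_nl_swap12: "tri_nl (tri_swap12 f) = psdo_adj (\<lambda>h. - (fls_X_inv * h)) (tri_nl f)"
proof -
  let ?N = "\<lambda>h. - (fls_X_inv * h) :: 'a fls"
  have N: "additive ?N" by (simp add: additive_def distrib_left)
  have x: "psdo_adj ?N (inner_x g) = inner_x (psdo_adj ?N g)" for g
    unfolding inner_x_def
    by (rule fls_map_psdo_adj[OF additive_times _ N N, symmetric]) simp
  have NX: "psdo_mult ?N fls_X_inv g = fls_X_inv * g - inner_x g" for g
    unfolding psdo_mult_X_inv[OF N] by (rule lseries_eqI) (simp add: lcoef_fls_map_additive N)
  show ?thesis
  proof (rule tri_intertwine_eq[where S = "\<lambda>f. tri_nl (tri_swap12 f)" and T = "\<lambda>f. psdo_adj ?N (tri_nl f)"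
        and X = "\<lambda>g. - psdo_mult ?N fls_X_inv g" and Y = "\<lambda>g. fls_X_inv * g"
        and Z = inner_x])
    show "additive (\<lambda>f. tri_nl (tri_swap12 f))"
      by (rule additive_comp[OF additive_tri_nl additive_tri_swap(1)])
    show "additive (\<lambda>f. psdo_adj ?N (tri_nl f))"
      by (rule additive_comp[OF additive_psdo_adj[OF N] additive_tri_nl])
    show "inj inner_x" by (rule inj_inner_x)
    show "inj (\<lambda>g. fls_X_inv * g :: 'a fls fls)" by (simp add: inj_def)
    show "inj (\<lambda>g. - psdo_mult ?N fls_X_inv g)"
      by (intro inj_uminus_comp inj_psdo_mult_X_inv N)
    show "tri_nl (tri_swap12 (tri_x f)) = - psdo_mult ?N fls_X_inv (tri_nl (tri_swap12 f))" for f :: "'a tri_series"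
      by (simp add: tri_swap_xyz tri_nl_xyz NX)
    show "tri_nl (tri_swap12 (tri_y f)) = fls_X_inv * tri_nl (tri_swap12 f)" for f :: "'a tri_series"
      by (simp add: tri_swap_xyz tri_nl_xyz)
    show "tri_nl (tri_swap12 (tri_z f)) = inner_x (tri_nl (tri_swap12 f))" for f :: "'a tri_series"
      by (simp add: tri_swap_xyz tri_nl_xyz)
    show "psdo_adj ?N (tri_nl (tri_x f)) = - psdo_mult ?N fls_X_inv (psdo_adj ?N (tri_nl f))" for f
      by (simp add: tri_nl_xyz psdo_adj_X_inv_mult N)
    show "psdo_adj ?N (tri_nl (tri_y f)) = fls_X_inv * psdo_adj ?N (tri_nl f)" for f
      by (simp add: tri_nl_xyz additive.diff[OF additive_psdo_adj[OF N]] psdo_adj_X_inv_mult N x NX)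
    show "psdo_adj ?N (tri_nl (tri_z f)) = inner_x (psdo_adj ?N (tri_nl f))" for f
      by (simp add: tri_nl_xyz x)
    show "tri_nl (tri_swap12 (tri_monom v 0 0 0)) = psdo_adj ?N (tri_nl (tri_monom v 0 0 0))" for v
    proof -
      have "tri_swap12 (tri_monom v 0 0 0) = tri_monom v 0 0 0" by (auto intro!: tri_eqI)
      then show ?thesis by (simp add: tri_nl_monom psdo_adj_const N)
    qed
    show "lcoef (lcoef (tri_nl (tri_swap12 f)) q) p = 0" if "tri_low (p + q) f" for p q and f :: "'a tri_series"
      by (rule tri_nl_low[OF tri_low_swap(1)[OF that]])
    show "lcoef (lcoef (psdo_adj ?N (tri_nl f)) q) p = 0" if "tri_low (p + q) f" for p q f
      using xy_low_psdo_adj[OF N _ xy_low_tri_nl[OF that]] by (simp add: xy_low_def lbound_def)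
  qed
qed

section \<open>Actions of operators through \<nu>, and their expansions\<close>

lemma tri_op_mult_lmonom:
  assumes D: "additive D"
  shows "tri_op (psdo_mult D (lmonom 1 0)) f = f"
    "tri_op (psdo_mult D (lmonom 1 (m + 1))) f =
      tri_z (tri_op (psdo_mult D (lmonom 1 m)) f) + tri_map D (tri_op (psdo_mult D (lmonom 1 m)) f)"
    "tri_op (psdo_mult D (lmonom a m)) f = tri_map ((*) a) (tri_op (psdo_mult D (lmonom 1 m)) f)"
  using psdo_mult_lmonom_const[OF D, of a 1 m]
  by (auto intro!: tri_eqI simp: tcoef_tri_op_mult D lmonom_const psdo_mult_1_left psdo_mult_lmonom_Suc'
      lcoef_psdo_mult_X_inv tcoef_tri_map additive_times)

lemma tri_op_mult_add:
  assumes D: "additive D"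
  shows "tri_op (psdo_mult D (A + B)) f = tri_op (psdo_mult D A) f + tri_op (psdo_mult D B) f"
    and "tri_op (psdo_mult D A) (f + g) = tri_op (psdo_mult D A) f + tri_op (psdo_mult D A) g"
  by (auto intro!: tri_eqI simp: tcoef_tri_op_mult D psdo_mult_add_left[OF D] psdo_mult_add_right[OF D] tri_slice_add)

lemma tri_low_bounded: "tri_bounded N (tcoef f) \<Longrightarrow> tri_low (3 * N + 1) f"
  unfolding tri_low_def by (auto intro!: tri_boundedD[of N])

lemma tri_low_op_mult:
  assumes D: "additive D" and f: "tri_low e f" and A: "lbound m A"
  shows "tri_low (e + m) (tri_op (psdo_mult D A) f)"
  unfolding tri_low_def
proof (intro allI impI)
  fix a b c assume e: "e + m \<le> a + b + c"
  have "lbound (e - a - b - 1) (tri_slice f a b)"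
    using f by (auto simp: lbound_def tri_low_def)
  from lbound_psdo_mult[OF D A this] show "tcoef (tri_op (psdo_mult D A) f) a b c = 0"
    unfolding tcoef_tri_op_mult[OF D] by (rule lboundD) (use e in auto)
qed

text \<open>After \<nu> = \<lambda>+\<mu> the operator \<nu>+\<partial> becomes
  \<mu>+(\<lambda>+\<partial>), so the action is a composition in \<mu> for the connection
  \<lambda>+\<partial>.\<close>

lemma tri_lm_op_mult:
  assumes D: "additive D"
  shows "tri_lm (tri_op (psdo_mult D A) f) =
    psdo_mult (psdo_mult D fls_X_inv) (fls_map fls_const A) (tri_lm f)"
proof (intro lseries_eqI)
  fix p q
  let ?N = "psdo_mult D fls_X_inv"
  have N: "additive ?N" by (rule additive_psdo_mult_right[OF D])
  note lm = additive.add[OF additive_tri_lm]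
  have eq: "tri_lm (tri_op (psdo_mult D (lmonom 1 (m + 1))) f) = psdo_mult ?N (lmonom 1 (m + 1)) (tri_lm f) \<longleftrightarrow>
      tri_lm (tri_op (psdo_mult D (lmonom 1 m)) f) = psdo_mult ?N (lmonom 1 m) (tri_lm f)" for m
  proof -
    have "tri_lm (tri_op (psdo_mult D (lmonom 1 (m + 1))) f) =
        psdo_mult ?N fls_X_inv (tri_lm (tri_op (psdo_mult D (lmonom 1 m)) f))"
      by (simp add: tri_op_mult_lmonom(2) D lm tri_lm_xyz tri_lm_map psdo_mult_X_inv[OF N] fls_map_nabla)
    then show ?thesis
      using inj_eq[OF inj_psdo_mult_X_inv[OF N]] by (simp add: psdo_mult_lmonom_Suc'[OF N])
  qed
  have 1: "tri_lm (tri_op (psdo_mult D (lmonom 1 m)) f) = psdo_mult ?N (lmonom 1 m) (tri_lm f)" for m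
  proof (induction m rule: int_up_down)
    case 0 show ?case by (simp add: tri_op_mult_lmonom(1) D) (simp add: lmonom_const psdo_mult_1_left N)
  qed (simp_all add: eq)
  have 2: "tri_lm (tri_op (psdo_mult D (lmonom a m)) f) = psdo_mult ?N (lmonom (fls_const a) m) (tri_lm f)" for a m
    unfolding tri_op_mult_lmonom(3)[OF D, of a] tri_lm_map[OF additive_times] 1
    using psdo_mult_lmonom_const[OF N, of "fls_const a" 1 m "tri_lm f"]
    by (intro lseries_eqI) (simp add: lcoef_fls_map_additive additive_fls_map additive_times)
  obtain n where n: "tri_bounded n (tcoef f)" using tri_bounded_tcoef by blast
  note low = tri_low_bounded[OF n]
  show "lcoef (lcoef (tri_lm (tri_op (psdo_mult D A) f)) q) p =
      lcoef (lcoef (psdo_mult ?N (fls_map fls_const A) (tri_lm f)) q) p"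
  proof (rule fls_local_eq[where S = "\<lambda>A. lcoef (lcoef (tri_lm (tri_op (psdo_mult D A) f)) q) p" and
        T = "\<lambda>A. lcoef (lcoef (psdo_mult ?N (fls_map fls_const A) (tri_lm f)) q) p"
        \<comment> \<open>Exponents at most n give total degree at most 3n, so with this bound on
          \<open>A\<close> the result has total degree below p + q.\<close>
        and A = A and e = "p + q - 3 * n - 1"])
    show "additive (\<lambda>A. lcoef (lcoef (tri_lm (tri_op (psdo_mult D A) f)) q) p)"
      unfolding additive_def by (simp add: tri_op_mult_add[OF D] lm)
    show "additive (\<lambda>A. lcoef (lcoef (psdo_mult ?N (fls_map fls_const A) (tri_lm f)) q) p)"
      unfolding additive_def by (simp add: additive.add[OF additive_fls_map[OF additive_fls_const]] psdo_mult_add_left[OF N])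
    show "lcoef (lcoef (tri_lm (tri_op (psdo_mult D (lmonom a m)) f)) q) p =
        lcoef (lcoef (psdo_mult ?N (fls_map fls_const (lmonom a m)) (tri_lm f)) q) p" for a m
      by (simp add: 2 fls_map_lmonom additive_fls_const)
    show "lcoef (lcoef (tri_lm (tri_op (psdo_mult D A) f)) q) p = 0" if "lbound (p + q - 3 * n - 1) A" for A
      using tri_low_op_mult[OF D low that] by (intro tri_lm_low) simp
    show "lcoef (lcoef (psdo_mult ?N (fls_map fls_const A) (tri_lm f)) q) p = 0" if "lbound (p + q - 3 * n - 1) A" for A
      using xy_low_nabla_mult[OF D xy_low_tri_lm[OF low] that] by (simp add: xy_low_def)
  qed
qed

text \<open>Here \<nu> is itself the variable of the coefficient series, so the action is
  coefficientwise.\<close>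

lemma tri_nl_op_mult:
  assumes D: "additive D"
  shows "tri_nl (tri_op (psdo_mult D A) f) = fls_map (psdo_mult D A) (tri_nl f)"
proof (intro lseries_eqI)
  fix p q
  note nl = additive.add[OF additive_tri_nl]
  have add: "additive (psdo_mult D A)" for A by (rule additive_psdo_mult_right[OF D])
  have eq: "tri_nl (tri_op (psdo_mult D (lmonom 1 (m + 1))) f) = fls_map (psdo_mult D (lmonom 1 (m + 1))) (tri_nl f) \<longleftrightarrow>
      tri_nl (tri_op (psdo_mult D (lmonom 1 m)) f) = fls_map (psdo_mult D (lmonom 1 m)) (tri_nl f)" for m
  proof -
    have *: "fls_map (psdo_mult D (lmonom 1 (m + 1))) (tri_nl f) =
        fls_map (psdo_mult D fls_X_inv) (fls_map (psdo_mult D (lmonom 1 m)) (tri_nl f))"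
      by (simp add: fls_map_comp add psdo_mult_lmonom_Suc'[OF D, abs_def, of m])
    have "tri_nl (tri_op (psdo_mult D (lmonom 1 (m + 1))) f) =
        fls_map (psdo_mult D fls_X_inv) (tri_nl (tri_op (psdo_mult D (lmonom 1 m)) f))"
      by (simp add: tri_op_mult_lmonom(2) D nl tri_nl_xyz tri_nl_map fls_map_nabla)
    with * show ?thesis
      using inj_eq[OF inj_fls_map[OF add inj_psdo_mult_X_inv[OF D]]] by simp
  qed
  have 1: "tri_nl (tri_op (psdo_mult D (lmonom 1 m)) f) = fls_map (psdo_mult D (lmonom 1 m)) (tri_nl f)" for m
  proof (induction m rule: int_up_down)
    case 0
    have "psdo_mult D (lmonom 1 0) = (\<lambda>A. A)"
      by (simp add: lmonom_const psdo_mult_1_left D fun_eq_iff)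
    then show ?case
      using tri_op_mult_lmonom(1)[OF D, of f] by (intro lseries_eqI) (simp add: lcoef_fls_map)
  qed (simp_all add: eq)
  have 2: "tri_nl (tri_op (psdo_mult D (lmonom a m)) f) = fls_map (psdo_mult D (lmonom a m)) (tri_nl f)" for a m
    unfolding tri_op_mult_lmonom(3)[OF D, of a] tri_nl_map[OF additive_times] 1
    using psdo_mult_lmonom_const[OF D, of a 1 m]
    by (intro lseries_eqI) (simp add: lcoef_fls_map_additive additive_fls_map additive_times add)
  obtain n where n: "tri_bounded n (tcoef f)" using tri_bounded_tcoef by blast
  note low = tri_low_bounded[OF n]
  show "lcoef (lcoef (tri_nl (tri_op (psdo_mult D A) f)) q) p =
      lcoef (lcoef (fls_map (psdo_mult D A) (tri_nl f)) q) p"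
  proof (rule fls_local_eq[where S = "\<lambda>A. lcoef (lcoef (tri_nl (tri_op (psdo_mult D A) f)) q) p" and
        T = "\<lambda>A. lcoef (lcoef (fls_map (psdo_mult D A) (tri_nl f)) q) p"
        and A = A and e = "p + q - 3 * n - 1"])
    show "additive (\<lambda>A. lcoef (lcoef (tri_nl (tri_op (psdo_mult D A) f)) q) p)"
      unfolding additive_def by (simp add: tri_op_mult_add[OF D] nl)
    show "additive (\<lambda>A. lcoef (lcoef (fls_map (psdo_mult D A) (tri_nl f)) q) p)"
      unfolding additive_def by (simp add: lcoef_fls_map_additive add psdo_mult_add_left[OF D])
    show "lcoef (lcoef (tri_nl (tri_op (psdo_mult D (lmonom a m)) f)) q) p =
        lcoef (lcoef (fls_map (psdo_mult D (lmonom a m)) (tri_nl f)) q) p" for a m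
      by (simp add: 2)
    show "lcoef (lcoef (tri_nl (tri_op (psdo_mult D A) f)) q) p = 0" if "lbound (p + q - 3 * n - 1) A" for A
      using tri_low_op_mult[OF D low that] by (intro tri_nl_low) simp
    show "lcoef (lcoef (fls_map (psdo_mult D A) (tri_nl f)) q) p = 0" if "lbound (p + q - 3 * n - 1) A" for A
    proof -
      have "lbound (3 * n - q) (lcoef (tri_nl f) q)"
        using xy_low_tri_nl[OF low] by (auto simp: xy_low_def lbound_def)
      from lbound_psdo_mult[OF D that this] show ?thesis
        unfolding lcoef_fls_map_additive[OF add] by (rule lboundD) simp
    qed
  qed
qed

section \<open>The Jacobi identity\<close>

text \<open>Passes from classes to representatives, on which the swaps, the adjoint substitution and
  the operator actions are defined.\<close>

lemma jacobi_identity_iff: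
  "jacobi_identity br a b c \<longleftrightarrow>
    (\<exists>f g h k. tri_lm f = bracket_lm br a b c \<and> tri_ml g = bracket_ml br a b c \<and>
      tri_nl h = bracket_nl br a b c \<and> f - g - h = tri_rel k)" (is "_ \<longleftrightarrow> ?R")
proof -
  have surj: "\<exists>f. P = abs_lm_space f" for P :: "'a lm_space"
    by (metis Quotient3_abs_rep Quotient3_lm_space)
  have "jacobi_identity br a b c \<longleftrightarrow> (\<exists>f g h.
      embed_lm (abs_lm_space f) = bracket_lm br a b c \<and> embed_ml (abs_lm_space g) = bracket_ml br a b c \<and>
      embed_nl (abs_lm_space h) = bracket_nl br a b c \<and>
      abs_lm_space f - abs_lm_space g = abs_lm_space h)"
    unfolding jacobi_identity_def using surj by metis
  also have "\<dots> \<longleftrightarrow> ?R"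
    by (simp add: embed_lm.abs_eq embed_ml.abs_eq embed_nl.abs_eq minus_lm_space.abs_eq
        lm_space.abs_eq_iff tri_equiv_def)
  finally show ?thesis .
qed

lemma tri_swap12_rel: "tri_swap12 (tri_rel k) = tri_rel (tri_swap12 k)"
  by (rule tri_eqI) (simp add: tri_rel_eq)

lemma tri_rel_uminus: "tri_rel (- k) = - tri_rel k"
  by (rule tri_eqI) (simp add: tri_rel_eq)

section \<open>Symmetries of the Jacobi identity for a skewsymmetric bracket\<close>

context
  fixes D :: "'v::comm_ring_1 \<Rightarrow> 'v" and br :: "'v \<Rightarrow> 'v \<Rightarrow> 'v fls"
  assumes D: "additive D"
    and left: "\<And>b. additive (\<lambda>a. br a b)" and right: "\<And>a. additive (br a)"
    and D_left: "\<And>a b. br (D a) b = - (fls_X_inv * br a b)"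
    and D_right: "\<And>a b. br a (D b) = psdo_mult D fls_X_inv (br a b)"
    and skew: "\<And>a b. br b a = - psdo_adj D (br a b)"
begin

text \<open>The first two brackets trade places under \<lambda> <-> \<mu>. In the third,
  skewsymmetry puts -\<lambda>-\<partial> for \<lambda> in the inner bracket, and \<partial> in a
  first argument acts as -\<nu>; together they give \<nu>-\<lambda>, which is \<mu>.\<close>

lemma jacobi_identity_swap12:
  assumes "jacobi_identity br a b c"
  shows "jacobi_identity br b a c"
proof -
  obtain f g h k where *: "tri_lm f = bracket_lm br a b c" "tri_ml g = bracket_ml br a b c"
      "tri_nl h = bracket_nl br a b c" "f - g - h = tri_rel k"
    using assms unfolding jacobi_identity_iff by blast
  let ?N = "\<lambda>h. - (fls_X_inv * h) :: 'v fls"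
  have N: "additive ?N" by (simp add: additive_def distrib_left)
  have nl: "bracket_nl br b a c = - psdo_adj ?N (bracket_nl br a b c)"
    unfolding bracket_nl_def skew[where a = a and b = b]
    using additive.minus[OF additive_fls_map[OF left[of c]]]
      fls_map_psdo_adj[OF left[of c] D_left[of _ c] D N, of "br a b"] by simp
  show ?thesis
    unfolding jacobi_identity_iff
  proof (intro exI conjI)
    show "tri_lm (tri_swap12 g) = bracket_lm br b a c"
      using *(2) by (simp add: bracket_lm_def bracket_ml_def tri_ml_eq)
    show "tri_ml (tri_swap12 f) = bracket_ml br b a c"
      using *(1) by (simp add: bracket_lm_def bracket_ml_def tri_ml_eq)
    show "tri_nl (- tri_swap12 h) = bracket_nl br b a c"
      by (simp add: additive.minus[OF additive_tri_nl] tri_nl_swap12 *(3) nl)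
    have "tri_swap12 g - tri_swap12 f - - tri_swap12 h = - tri_swap12 (f - g - h)"
      by (rule tri_eqI) simp
    then show "tri_swap12 g - tri_swap12 f - - tri_swap12 h = tri_rel (- tri_swap12 k)"
      by (simp only: *(4) tri_swap12_rel tri_rel_uminus)
  qed
qed

text \<open>Skewsymmetry of {b_\<mu> c} is carried through {a_\<lambda> .}, which turns \<partial>
  into \<lambda>+\<partial>; the first bracket thus goes to minus its adjoint for that connection.
  The other two brackets differ by skewsymmetry of the outer bracket and are interchanged, whence
  the crossed witnesses.\<close>

lemma jacobi_identity_swap23:
  assumes "jacobi_identity br a b c"
  shows "jacobi_identity br a c b"
proof -
  obtain f g h k where *: "tri_lm f = bracket_lm br a b c" "tri_ml g = bracket_ml br a b c"
      "tri_nl h = bracket_nl br a b c" "f - g - h = tri_rel k"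
    using assms unfolding jacobi_identity_iff by blast
  let ?N = "psdo_mult D fls_X_inv"
  have N: "additive ?N" by (rule additive_psdo_mult_right[OF D])
  have A: "additive (psdo_adj D)" by (rule additive_psdo_adj[OF D])
  have lm: "bracket_lm br a c b = - psdo_adj ?N (bracket_lm br a b c)"
    unfolding bracket_lm_def skew[where a = b and b = c]
    using additive.minus[OF additive_fls_map[OF right[of a]]]
      fls_map_psdo_adj[OF right[of a] D_right[of a] D N, of "br b c"] by simp
  have ml: "bracket_ml br a c b = - fls_map (psdo_adj D) (bracket_nl br a b c)"
    unfolding bracket_ml_def bracket_nl_def
    by (rule lseries_eqI) (simp add: lcoef_fls_map_additive left right A, rule skew)
  have nl: "bracket_nl br a c b = - fls_map (psdo_adj D) (bracket_ml br a b c)"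
    unfolding bracket_ml_def bracket_nl_def
    by (rule lseries_eqI) (simp add: lcoef_fls_map_additive left right A, rule skew)
  show ?thesis
    unfolding jacobi_identity_iff
  proof (intro exI conjI)
    show "tri_lm (- tri_adj D f) = bracket_lm br a c b"
      by (simp add: additive.minus[OF additive_tri_lm] tri_lm_adj D * lm)
    show "tri_ml (- tri_adj D h) = bracket_ml br a c b"
      by (simp add: tri_ml_eq additive.minus[OF additive_tri_swap(1)] additive.minus[OF additive_tri_lm]
           tri_ml_adj[unfolded tri_ml_eq] D * ml)
    show "tri_nl (- tri_adj D g) = bracket_nl br a c b"
      by (simp add: additive.minus[OF additive_tri_nl] tri_nl_adj D * nl)
    have "- tri_adj D f - - tri_adj D h - - tri_adj D g = - tri_adj D (f - g - h)"
      by (simp add: additive.diff[OF additive_tri_adj[OF D]])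
    then show "- tri_adj D f - - tri_adj D h - - tri_adj D g = tri_rel (- tri_adj D k)"
      by (simp only: *(4) tri_adj_rel[OF D] tri_rel_uminus)
  qed
qed

end

lemma additive_tri_rel: "additive tri_rel"
  by (simp add: additive_def tri_rel_add)

lemma const_mult_X_inv_power: "fls_const a * fls_X_inv ^ n = lmonom (a :: 'a::comm_ring_1) (int n)"
  using lmonom_eq_const_mult[of a "int n"] by (simp add: lmonom_X_inv_power)

lemma sum_swap_pairs:
  "(\<Sum>k\<in>A. \<Sum>n\<in>B. \<Sum>j\<in>C. \<Sum>p\<in>E. g k n j p) = (\<Sum>j\<in>C. \<Sum>p\<in>E. \<Sum>k\<in>A. \<Sum>n\<in>B. g k n j p)"
proof -
  have "(\<Sum>x\<in>A \<times> B. \<Sum>y\<in>C \<times> E. g (fst x) (snd x) (fst y) (snd y)) =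
      (\<Sum>y\<in>C \<times> E. \<Sum>x\<in>A \<times> B. g (fst x) (snd x) (fst y) (snd y))"
    by (rule sum.swap)
  then show ?thesis by (simp add: sum.cartesian_product')
qed

definition tri_prod :: "'v::comm_ring_1 fls \<Rightarrow> 'v fls \<Rightarrow> 'v tri_series" where
  "tri_prod F G = tri_of (\<lambda>a b c. if c = 0 then lcoef F a * lcoef G b else 0)"

lemma tri_bounded_prod:
  fixes F G :: "'v::comm_ring_1 fls"
  assumes "lbound M F" "lbound N G"
  shows "tri_bounded (max 0 (max M N)) (\<lambda>a b c. if c = 0 then lcoef F a * lcoef G b else 0)"
  using assms by (auto simp: tri_bounded_def lbound_def)

lemma tcoef_tri_prod: "tcoef (tri_prod F G) = (\<lambda>a b c. if c = 0 then lcoef F a * lcoef G b else 0)"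
  unfolding tri_prod_def by (metis lbound_exists tcoef_tri_of tri_bounded_prod)

lemma tri_prod_swap: "tri_swap12 (tri_prod F G) = tri_prod G F"
  by (rule tri_eqI) (simp add: tcoef_tri_prod mult.commute)

lemma xy_expand_two_variables:
  assumes N: "tri_bounded N (\<lambda>a b c. if c = 0 then g a b else 0)"
  shows "xy_expand (\<lambda>a b c. if c = 0 then g a b else 0) p q = g p q"
proof -
  \<comment> \<open>The range is widened to contain c = 0, the only exponent of \<nu> that
    occurs.\<close>
  define K L U where "K = nat (2 * N - q) + 1" and "L = min 0 (q - N)" and "U = max 0 N"
  have "xy_expand (\<lambda>a b c. if c = 0 then g a b else 0) p q =
      (\<Sum>k<K. \<Sum>c=L..U. of_int (ibinom c k) * (if c = 0 then g (p - int k) (q + int k - c) else 0))"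
    by (rule xy_expand_box[OF N]) (auto simp: K_def L_def U_def)
  also have "\<dots> = (\<Sum>k<K. \<Sum>c=L..U. if c = 0 then (if k = 0 then g p q else 0) else 0)"
    by (intro sum.cong refl) (simp add: ibinom_0_left)
  also have "\<dots> = g p q"
    by (simp add: K_def L_def U_def)
  finally show ?thesis .
qed

lemma tri_lm_prod: "tri_lm (tri_prod F G) = fls_const F * fls_map fls_const G"
proof (intro lseries_eqI)
  fix p q
  obtain M N where "lbound M F" "lbound N G" using lbound_exists by metis
  note b = tri_bounded_prod[OF this]
  show "lcoef (lcoef (tri_lm (tri_prod F G)) q) p = lcoef (lcoef (fls_const F * fls_map fls_const G) q) p"
    using lcoef_const_mult[of "lcoef G q" F p]
    by (simp add: lcoef_tri_lm tcoef_tri_prod xy_expand_two_variables[OF b] lcoef_fls_map_additive additive_fls_const mult.commute)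
qed

section \<open>The Jacobi identity for the master bracket: reduction to generators\<close>

context algebra_of_differential_functions
begin

lemma master_bracket_right:
  "master_bracket D pd H a c = (\<Sum>k\<in>UNIV. psdo_mult D (frechet k c) (master_bracket D pd H a (\<iota> (dp_var k 0))))"
proof -
  have "psdo_mult D (if k = j then 1 else 0) A = (if k = j then A else 0)" for k j :: 'i and A
    by (simp add: psdo_mult_1_left additive_D psdo_left.zero)
  then show ?thesis
    unfolding master_bracket_eq[of H a] frechet_var
    by (subst sum.swap) (simp add: psdo_right.sum)
qed

lemma additive_fls_map_D: "additive (fls_map D)"
  by (rule additive_fls_map[OF additive_D])

text \<open>Multiplication by \<nu> is right composition with \<partial>, which commutes with left
  composition by \<open>A\<close>, and \<lambda>, \<mu> are mere parameters; the action therefore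
  descends to the quotient.\<close>

lemma tri_op_rel: "tri_op (psdo_mult D A) (tri_rel k) = tri_rel (tri_op (psdo_mult D A) k)"
proof (rule tri_eqI)
  fix a b c
  have "tri_slice (tri_rel k) a b = fls_X_inv * tri_slice k a b - tri_slice k (a - 1) b - tri_slice k a (b - 1)"
    by (rule lseries_eqI) (simp add: tri_rel_eq)
  then show "tcoef (tri_op (psdo_mult D A) (tri_rel k)) a b c = tcoef (tri_rel (tri_op (psdo_mult D A) k)) a b c"
    by (simp add: tri_rel_eq tcoef_tri_op_mult additive_D psdo_right.diff psdo_X_right)
qed

context
  fixes H :: "'v fls ^ 'i ^ 'i"
begin

abbreviation (input) "br \<equiv> master_bracket D pd H"
abbreviation (input) "u k \<equiv> \<iota> (dp_var k 0)"

lemma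
  shows br_add_right: "br a (b + c) = br a b + br a c"
    and br_add_left: "br (a + b) c = br a c + br b c"
    and br_D_left: "br (D a) b = - (fls_X_inv * br a b)"
    and br_D_right: "br a (D b) = nabla D (br a b)"
    and br_mult_right: "br a (b * c) = fls_const b * br a c + fls_const c * br a b"
  using nonlocal_lambda_bracket_master[of H]
  unfolding nonlocal_lambda_bracket_def Vector_Spaces.linear_iff by blast+

lemma additive_br: "additive (br a)" "additive (\<lambda>a. br a b)"
  by (simp_all add: additive_def br_add_left br_add_right)

text \<open>By sesquilinearity this is the bracket of \<open>a\<close> with the n-th derivative of
  the k-th generator.\<close>

definition br_deriv :: "'v \<Rightarrow> 'i \<Rightarrow> nat \<Rightarrow> 'v fls" where
  "br_deriv a k n = psdo_mult D (fls_X_inv ^ n) (br a (u k))"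

lemma br_eq_sum:
  assumes "\<And>k n. M \<le> n \<Longrightarrow> pd k n c = 0"
  shows "br a c = (\<Sum>k\<in>UNIV. \<Sum>n<M. fls_const (pd k n c) * br_deriv a k n)"
proof -
  have "frechet k c = (\<Sum>n<M. fls_const (pd k n c) * fls_X_inv ^ n)" for k
    by (rule frechet_eq_sum) (use assms in auto)
  then show ?thesis
    by (simp add: master_bracket_right[of H a c] psdo_left.sum psdo_mult_const_mult_left additive_D br_deriv_def)
qed

text \<open>The product rule for {a_\<lambda> .} applied to {b_\<mu> c} = \<Sum> L_k(c) {b_\<mu>
  u_k}: one part differentiates the coefficients of the Frechet operator of \<open>c\<close>,
  producing second derivatives, and the other acts on the brackets with generators.\<close>

lemma bracket_lm_right:
  "bracket_lm br a b c = (\<Sum>k\<in>UNIV.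
     psdo_mult (fls_map D) (fls_map (br a) (frechet k c)) (fls_map fls_const (br b (u k))) +
     psdo_mult (nabla D) (fls_map fls_const (frechet k c)) (bracket_lm br a b (u k)))"
proof -
  have nabla: "additive (nabla D)" by (rule additive_psdo_mult_right[OF additive_D])
  have "fls_map (br a) (psdo_mult D A B) =
      psdo_mult (fls_map D) (fls_map (br a) A) (fls_map fls_const B) +
      psdo_mult (nabla D) (fls_map fls_const A) (fls_map (br a) B)" for A B
    by (rule fls_map_psdo_mult_Leibniz[OF additive_br(1) _ br_D_right additive_fls_const _ additive_D
          additive_fls_map_D nabla])
      (simp_all add: br_mult_right mult.commute fls_map_const additive_D)
  then show ?thesis
    by (simp add: bracket_lm_def master_bracket_right[of H b c] additive.sum[OF additive_fls_map[OF additive_br(1)]])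
qed

lemma fls_map_const_X_inv_power: "fls_map fls_const (fls_X_inv ^ n :: 'v fls) = fls_X_inv ^ n"
  by (simp add: lmonom_X_inv_power fls_map_lmonom additive_fls_const)

text \<open>The Hessian of \<open>c\<close> paired with the brackets {a_\<lambda> .} and {b_\<mu> .}
  of the differentiated generators. \<open>M\<close> cuts off the orders of both
  derivatives.\<close>

definition jacobi_symmetric_part :: "'v \<Rightarrow> 'v \<Rightarrow> 'v \<Rightarrow> nat \<Rightarrow> 'v tri_series" where
  "jacobi_symmetric_part a b c M = (\<Sum>k\<in>UNIV. \<Sum>n<M. \<Sum>j\<in>UNIV. \<Sum>p<M.
     tri_prod (fls_const (pd j p (pd k n c)) * br_deriv a j p) (br_deriv b k n))"

lemma tri_lm_jacobi_symmetric_part: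
  assumes M: "\<And>k n. M \<le> n \<Longrightarrow> pd k n c = 0"
  shows "tri_lm (jacobi_symmetric_part a b c M) =
    (\<Sum>k\<in>UNIV. psdo_mult (fls_map D) (fls_map (br a) (frechet k c)) (fls_map fls_const (br b (u k))))"
proof -
  \<comment> \<open>Commuting the derivations lets the one of order p act on \<open>c\<close> first,
    so the same bound serves both sums.\<close>
  have M': "pd j p (pd k n c) = 0" if "M \<le> p" for j p k n
    using that M[of p j] by (subst pd_commute) (simp add: pd.zero)
  have 1: "fls_map (br a) (frechet k c) = (\<Sum>n<M. fls_const (br a (pd k n c)) * fls_X_inv ^ n)" for k
  proof -
    have "frechet k c = (\<Sum>n<M. fls_const (pd k n c) * fls_X_inv ^ n)"
      by (rule frechet_eq_sum) (use M in auto)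
    then show ?thesis
      by (simp add: const_mult_X_inv_power additive.sum[OF additive_fls_map[OF additive_br(1)]] fls_map_lmonom additive_br)
  qed
  have 2: "psdo_mult (fls_map D) (fls_X_inv ^ n) (fls_map fls_const (br b (u k))) = fls_map fls_const (br_deriv b k n)" for k n
    using fls_map_psdo_mult[OF additive_fls_const, of D "fls_map D" "fls_X_inv ^ n" "br b (u k)"]
    by (simp add: fls_map_const additive_D additive_fls_map_D fls_map_const_X_inv_power br_deriv_def
        fls_const_mult_const)
  have "psdo_mult (fls_map D) (fls_map (br a) (frechet k c)) (fls_map fls_const (br b (u k))) =
      (\<Sum>n<M. fls_const (br a (pd k n c)) * fls_map fls_const (br_deriv b k n))" for k
    unfolding 1
    by (simp add: additive.sum[OF additive_psdo_mult_left[OF additive_fls_map_D]]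
        psdo_mult_const_mult_left additive_fls_map_D 2)
  moreover have "br a (pd k n c) = (\<Sum>j\<in>UNIV. \<Sum>p<M. fls_const (pd j p (pd k n c)) * br_deriv a j p)" for k n
    by (rule br_eq_sum[OF M'])
  ultimately show ?thesis
    by (simp add: jacobi_symmetric_part_def additive.sum[OF additive_tri_lm] tri_lm_prod
        additive.sum[OF additive_fls_const] sum_distrib_right)
qed

lemma tri_swap12_jacobi_symmetric_part:
  "tri_swap12 (jacobi_symmetric_part a b c M) = jacobi_symmetric_part b a c M"
proof -
  have *: "tri_prod (br_deriv b k n) (fls_const (pd j p (pd k n c)) * br_deriv a j p) =
      tri_prod (fls_const (pd k n (pd j p c)) * br_deriv b k n) (br_deriv a j p)" for k n j p
    by (rule tri_eqI) (simp add: tcoef_tri_prod pd_commute mult_ac)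
  show ?thesis
    unfolding jacobi_symmetric_part_def
    by (simp add: additive.sum[OF additive_tri_swap(1)] tri_prod_swap *) (rule sum_swap_pairs)
qed

text \<open>
  The second derivatives of \<open>c\<close> contribute the same symmetric series to \<open>{a\<^sub>\<lambda> {b\<^sub>\<mu> c}}\<close> and \<open>{b\<^sub>\<mu> {a\<^sub>\<lambda> c}}\<close>,
  and the remaining terms are obtained from the triple brackets with the generators in place of \<open>c\<close>
  by the action of the Frechet derivative of \<open>c\<close>.
\<close>

lemma jacobi_identity_extend:
  assumes "\<And>k. jacobi_identity br a b (u k)"
  shows "jacobi_identity br a b c"
proof -
  have "\<forall>k. \<exists>f g h r. tri_lm f = bracket_lm br a b (u k) \<and> tri_ml g = bracket_ml br a b (u k) \<and>
      tri_nl h = bracket_nl br a b (u k) \<and> f - g - h = tri_rel r"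
    using assms unfolding jacobi_identity_iff by blast
  then obtain f g h r where *: "\<And>k. tri_lm (f k) = bracket_lm br a b (u k)"
      "\<And>k. tri_ml (g k) = bracket_ml br a b (u k)" "\<And>k. tri_nl (h k) = bracket_nl br a b (u k)"
      "\<And>k. f k - g k - h k = tri_rel (r k)"
    by metis
  obtain M where M: "\<And>i n. M \<le> n \<Longrightarrow> pd i n c = 0"
    using pd_bound[of c] by blast
  let ?L = "\<lambda>k. tri_op (psdo_mult D (frechet k c))"
  have L: "additive (?L k)" for k
    by (simp add: additive_def tri_op_mult_add[OF additive_D])
  show ?thesis
    unfolding jacobi_identity_iff
  proof (intro exI conjI)
    show "tri_lm ((\<Sum>k\<in>UNIV. ?L k (f k)) + jacobi_symmetric_part a b c M) = bracket_lm br a b c"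
      by (simp add: additive.add[OF additive_tri_lm] additive.sum[OF additive_tri_lm] tri_lm_op_mult additive_D
          * tri_lm_jacobi_symmetric_part[OF M] bracket_lm_right[of a b c] sum.distrib)
    have "tri_swap12 (?L k f) = ?L k (tri_swap12 f)" for k f
      by (rule tri_eqI) (simp add: tcoef_tri_op_mult additive_D,
          metis lcoef_tri_slice lseries_eqI tcoef_tri_swap(1))
    moreover have "bracket_ml br a b x = bracket_lm br b a x" for x
      by (simp add: bracket_lm_def bracket_ml_def)
    ultimately show "tri_ml ((\<Sum>k\<in>UNIV. ?L k (g k)) + jacobi_symmetric_part a b c M) = bracket_ml br a b c"
      using *(2)
      by (simp add: tri_ml_eq additive.add[OF additive_tri_swap(1)] additive.sum[OF additive_tri_swap(1)]
          additive.add[OF additive_tri_lm] additive.sum[OF additive_tri_lm] tri_lm_op_mult additive_D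
          tri_swap12_jacobi_symmetric_part tri_lm_jacobi_symmetric_part[OF M]
          bracket_lm_right[of b a c] sum.distrib)
    show "tri_nl (\<Sum>k\<in>UNIV. ?L k (h k)) = bracket_nl br a b c"
    proof (rule lseries_eqI)
      fix p
      show "lcoef (tri_nl (\<Sum>k\<in>UNIV. ?L k (h k))) p = lcoef (bracket_nl br a b c) p"
        by (simp add: additive.sum[OF additive_tri_nl] tri_nl_op_mult additive_D * bracket_nl_def
            lcoef_fls_map_additive additive_br lcoef_sum psdo_right.additive_axioms
            master_bracket_right[of H _ c, symmetric])
    qed
    have "(\<Sum>k\<in>UNIV. ?L k (f k)) + jacobi_symmetric_part a b c M -
        ((\<Sum>k\<in>UNIV. ?L k (g k)) + jacobi_symmetric_part a b c M) - (\<Sum>k\<in>UNIV. ?L k (h k)) =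
        (\<Sum>k\<in>UNIV. ?L k (f k - g k - h k))"
      by (simp add: additive.diff[OF L] sum_subtractf)
    also have "\<dots> = tri_rel (\<Sum>k\<in>UNIV. ?L k (r k))"
      by (simp add: * tri_op_rel additive.sum[OF additive_tri_rel])
    finally show "(\<Sum>k\<in>UNIV. ?L k (f k)) + jacobi_symmetric_part a b c M -
        ((\<Sum>k\<in>UNIV. ?L k (g k)) + jacobi_symmetric_part a b c M) - (\<Sum>k\<in>UNIV. ?L k (h k)) =
        tri_rel (\<Sum>k\<in>UNIV. ?L k (r k))" .
  qed
qed

text \<open>Only the last argument can be extended directly, so permutations bring the arguments
  into last place one after another.\<close>

theorem jacobi_identity_from_generators:
  assumes "skewadjoint D H" and gen: "\<And>i j k. jacobi_identity br (u i) (u j) (u k)"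
  shows "jacobi_identity br a b c"
proof -
  have "br b a = - psdo_adj D (br a b)" for a b
    using assms(1) skewsymmetric_master[of H] unfolding skewsymmetric_bracket_def by blast
  note swap12 = jacobi_identity_swap12[OF additive_D additive_br(2) additive_br(1) br_D_left br_D_right this]
    and swap23 = jacobi_identity_swap23[OF additive_D additive_br(2) additive_br(1) br_D_left br_D_right this]
  have "jacobi_identity br (u i) b (u k)" for i k b
    by (rule swap23, rule jacobi_identity_extend, rule gen)
  then have "jacobi_identity br (u i) b c" for i b c
    by (rule jacobi_identity_extend)
  \<comment> \<open>The two swaps compose to a cyclic permutation that moves the remaining generator
    from the first place to the last.\<close>
  then have "jacobi_identity br a b (u k)" for a b k
    by (rule swap23[OF swap12])
  then show ?thesis by (rule jacobi_identity_extend)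
qed

end

end

section \<open>Extension of derivations to the field of fractions\<close>

lemma fract_rep: obtains a b where "b \<noteq> 0" "q * to_fract b = to_fract (a :: 'v::idom)"
proof (cases q)
  case (Fract a b)
  then show ?thesis by (intro that[of b a]) (simp_all add: Fract_conv_to_fract)
qed

lemma eq_Fract_iff: "b \<noteq> 0 \<Longrightarrow> q = Fract a b \<longleftrightarrow> q * to_fract b = to_fract a"
  by (auto simp: Fract_conv_to_fract eq_divide_eq)

text \<open>The ring homomorphism \<open>j\<close> makes the codomain of the derivation \<open>d\<close> a module over the field of fractions.\<close>

definition fract_ext :: "('v::idom fract \<Rightarrow> 'w::comm_ring_1) \<Rightarrow> ('v \<Rightarrow> 'w) \<Rightarrow> 'v fract \<Rightarrow> 'w" where
  "fract_ext j d q = (SOME y. \<exists>a b. b \<noteq> 0 \<and> q = Fract a b \<and>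
     y = j (inverse (to_fract b)) * (d a - j q * d b))"

context
  fixes j :: "'v::idom fract \<Rightarrow> 'w::comm_ring_1" and d :: "'v \<Rightarrow> 'w"
  assumes j: "additive j" "\<And>x y. j (x * y) = j x * j y" "j 1 = 1"
    and d: "additive d" "\<And>a b. d (a * b) = d a * j (to_fract b) + j (to_fract a) * d b"
begin

lemma fract_unit: "b \<noteq> 0 \<Longrightarrow> j (inverse (to_fract b)) * j (to_fract b) = 1"
  by (simp add: j(2)[symmetric] j(3))

lemma fract_cancel: "b \<noteq> 0 \<Longrightarrow> j (to_fract b) * x = j (to_fract b) * y \<longleftrightarrow> x = y"
  by (metis fract_unit mult.assoc mult.left_neutral)

text \<open>Independence of the chosen fraction: for two fractions a/b = a'/b', applying
  \<open>d\<close> to a'b = ab' equates the two quotient rules. The rule is kept free of division,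
  since only denominators become units in the codomain.\<close>

lemma fract_ext_eq:
  assumes b: "b \<noteq> 0" and q: "q * to_fract b = to_fract a"
  shows "j (to_fract b) * fract_ext j d q = d a - j q * d b"
proof -
  have "\<exists>y a b. b \<noteq> 0 \<and> q = Fract a b \<and> y = j (inverse (to_fract b)) * (d a - j q * d b)"
    using b q eq_Fract_iff by blast
  from someI_ex[OF this] obtain a' b' where b': "b' \<noteq> 0" and "q = Fract a' b'"
    and e: "fract_ext j d q = j (inverse (to_fract b')) * (d a' - j q * d b')"
    unfolding fract_ext_def by blast
  then have q': "q * to_fract b' = to_fract a'" by (simp add: eq_Fract_iff)
  have "to_fract (a' * b) = to_fract (a * b')"
    by (simp add: q[symmetric] q'[symmetric] mult_ac)
  then have "d (a' * b) = d (a * b')" by (simp only: to_fract_eq_iff)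
  then have 1: "d a' * j (to_fract b) + j q * j (to_fract b') * d b =
      d a * j (to_fract b') + j q * j (to_fract b) * d b'"
    by (simp add: d(2) q[symmetric] q'[symmetric] j(2))
  have "j (to_fract b) * (d a' - j q * d b') = j (to_fract b') * (d a - j q * d b)"
    using 1 by (simp add: algebra_simps)
  then have "j (to_fract b) * fract_ext j d q = (j (inverse (to_fract b')) * j (to_fract b')) * (d a - j q * d b)"
    unfolding e by (metis mult.assoc mult.left_commute)
  then show ?thesis by (simp add: fract_unit b')
qed

lemma fract_ext_unique:
  assumes "b \<noteq> 0" "q * to_fract b = to_fract a" "j (to_fract b) * y = d a - j q * d b"
  shows "fract_ext j d q = y"
  using fract_ext_eq[OF assms(1,2)] assms(3) fract_cancel[OF assms(1)] by metis

lemma fract_ext_to_fract: "fract_ext j d (to_fract a) = d a"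
proof (rule fract_ext_unique[of 1])
  have "d 1 = 0" using d(2)[of 1 1] j(3) by simp
  then show "j (to_fract 1) * d a = d a - j (to_fract a) * d 1" by (simp add: j(3))
qed simp_all

lemma fract_ext_add: "fract_ext j d (q + r) = fract_ext j d q + fract_ext j d r"
proof -
  obtain a b c e where b: "b \<noteq> 0" "q * to_fract b = to_fract a" and e: "e \<noteq> 0" "r * to_fract e = to_fract c"
    using fract_rep by metis
  let ?x = "fract_ext j d q" and ?y = "fract_ext j d r"
  have x: "d a = j (to_fract b) * ?x + j q * d b" using fract_ext_eq[OF b] by simp
  have y: "d c = j (to_fract e) * ?y + j r * d e" using fract_ext_eq[OF e] by simp
  show ?thesis
  proof (rule fract_ext_unique)
    show "b * e \<noteq> 0" using b e by simp
    show "(q + r) * to_fract (b * e) = to_fract (a * e + c * b)"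
      by (simp add: b(2)[symmetric] e(2)[symmetric] algebra_simps)
    show "j (to_fract (b * e)) * (?x + ?y) = d (a * e + c * b) - j (q + r) * d (b * e)"
      by (simp add: additive.add[OF d(1)] d(2) additive.add[OF j(1)] j(2) x y b(2)[symmetric] e(2)[symmetric] algebra_simps)
  qed
qed

lemma fract_ext_mult: "fract_ext j d (q * r) = fract_ext j d q * j r + j q * fract_ext j d r"
proof -
  obtain a b c e where b: "b \<noteq> 0" "q * to_fract b = to_fract a" and e: "e \<noteq> 0" "r * to_fract e = to_fract c"
    using fract_rep by metis
  let ?x = "fract_ext j d q" and ?y = "fract_ext j d r"
  have x: "d a = j (to_fract b) * ?x + j q * d b" using fract_ext_eq[OF b] by simp
  have y: "d c = j (to_fract e) * ?y + j r * d e" using fract_ext_eq[OF e] by simp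
  show ?thesis
  proof (rule fract_ext_unique)
    show "b * e \<noteq> 0" using b e by simp
    show "(q * r) * to_fract (b * e) = to_fract (a * c)"
      by (simp add: b(2)[symmetric] e(2)[symmetric] algebra_simps)
    show "j (to_fract (b * e)) * (?x * j r + j q * ?y) = d (a * c) - j (q * r) * d (b * e)"
      by (simp add: d(2) j(2) x y b(2)[symmetric] e(2)[symmetric] algebra_simps)
  qed
qed

end

text \<open>The definite description in \<open>fract_deriv\<close> needs every fraction to give the
  same value, and the extension along the identity supplies that value.\<close>

lemma fract_deriv_eq_fract_ext:
  assumes D: "additive D" "\<And>a b :: 'v::idom. D (a * b) = D a * b + a * D b"
  shows "fract_deriv D q = fract_ext (\<lambda>x. x) (\<lambda>a. to_fract (D a)) q"
proof -
  let ?d = "\<lambda>a. to_fract (D a)"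
  have j: "additive (\<lambda>x :: 'v fract. x)" by (simp add: additive_def)
  have d: "additive ?d" using D(1) by (simp add: additive_def)
  have dm: "?d (a * b) = ?d a * to_fract b + to_fract a * ?d b" for a b by (simp add: D(2))
  obtain a b where b: "b \<noteq> 0" "q * to_fract b = to_fract a" by (rule fract_rep)
  have rep: "Fract (D a * b - a * D b) (b * b) = fract_ext (\<lambda>x. x) ?d q"
    if b: "b \<noteq> 0" "q * to_fract b = to_fract a" for a b
  proof -
    have "to_fract b * fract_ext (\<lambda>x. x) ?d q = ?d a - q * ?d b"
      by (rule fract_ext_eq[OF j _ _ d dm b]) simp_all
    then have "to_fract b * to_fract b * fract_ext (\<lambda>x. x) ?d q = to_fract b * (?d a - q * ?d b)"
      by (simp only: mult.assoc)
    also have "\<dots> = to_fract (D a * b - a * D b)"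
      by (simp add: b(2)[symmetric] algebra_simps)
    finally have "to_fract b * to_fract b * fract_ext (\<lambda>x. x) ?d q = to_fract (D a * b - a * D b)" .
    then show ?thesis
      using b(1) by (simp add: Fract_conv_to_fract divide_eq_eq mult_ac)
  qed
  show ?thesis
    unfolding fract_deriv_def
  proof (rule the_equality)
    show "\<exists>a b. b \<noteq> 0 \<and> q = Fract a b \<and> fract_ext (\<lambda>x. x) ?d q = Fract (D a * b - a * D b) (b * b)"
      using b rep[OF b] eq_Fract_iff by metis
    show "r = fract_ext (\<lambda>x. x) ?d q"
      if "\<exists>a b. b \<noteq> 0 \<and> q = Fract a b \<and> r = Fract (D a * b - a * D b) (b * b)" for r
      using that rep eq_Fract_iff by metis
  qed
qed

section \<open>Inverses of pseudodifferential operators over a field\<close>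

text \<open>The preimage is found from the top degree downwards: \<open>T\<close> multiplies the
  leading coefficient by a \<noteq> 0, and lower terms do not reach the corresponding
  degree.\<close>

lemma fls_triangular_surj:
  fixes T :: "'k::field fls \<Rightarrow> 'k fls"
  assumes T: "additive T" and bound: "\<And>N B. lbound N B \<Longrightarrow> lbound (N + M) (T B)"
    and lead: "\<And>N B. lbound N B \<Longrightarrow> lcoef (T B) (N + M) = a * lcoef B N" and a: "a \<noteq> 0"
  shows "\<exists>B. T B = C"
proof -
  interpret T: additive T by fact
  obtain K where K: "lbound K C" using lbound_exists by blast
  define N where "N = K - M"
  \<comment> \<open>Stage i chooses the coefficient of degree N - i so that the image agrees with
    \<open>C\<close> in degree K - i. Later stages change neither, so the coefficients of the limit
    \<open>B\<close> can be read off from finite stages.\<close>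
  define S where "S = rec_nat 0 (\<lambda>i s. s + lmonom ((lcoef C (K - int i) - lcoef (T s) (K - int i)) / a) (N - int i))"
  have S0: "S 0 = 0" and SS: "S (Suc i) = S i + lmonom ((lcoef C (K - int i) - lcoef (T (S i)) (K - int i)) / a) (N - int i)" for i
    by (simp_all add: S_def)
  define B where "B = lseries (\<lambda>n. if n \<le> N then lcoef (S (Suc (nat (N - n)))) n else 0)"
  have lB: "lcoef B n = (if n \<le> N then lcoef (S (Suc (nat (N - n)))) n else 0)" for n
    unfolding B_def by (rule lcoef_lseries[where N = N]) auto
  have stable: "lcoef (S (Suc k + m)) (N - int k) = lcoef (S (Suc k)) (N - int k)" for k m
    by (induction m) (simp_all add: SS)
  have above: "lcoef (S i) n = 0" if "N < n" for i n
    by (induction i) (use that in \<open>simp_all add: S0 SS\<close>)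
  have BS: "lbound (N - int i) (B - S i)" for i
    unfolding lbound_def
  proof (intro allI impI)
    fix n assume n: "N - int i < n"
    show "lcoef (B - S i) n = 0"
    proof (cases "n \<le> N")
      case True
      define k where "k = nat (N - n)"
      have "k < i" and nk: "n = N - int k" using n True by (auto simp: k_def)
      then obtain m where "i = Suc k + m" using less_iff_Suc_add by auto
      then have "lcoef (S i) n = lcoef (S (Suc k)) n" unfolding nk by (simp only: stable)
      then show ?thesis using True by (simp add: lB k_def)
    next
      case False then show ?thesis by (simp add: lB above)
    qed
  qed
  have "lcoef (T B) n = lcoef C n" for n
  proof (cases "n \<le> K")
    case True
    define i where "i = nat (K - n)"
    have n: "n = K - int i" using True by (simp add: i_def)
    have "lcoef (T B) n = lcoef (T (S (Suc i))) n + lcoef (T (B - S (Suc i))) n"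
      by (simp add: T.diff)
    also have "lcoef (T (B - S (Suc i))) n = 0"
      by (rule lboundD[OF bound[OF BS[of "Suc i"]]]) (simp add: n N_def)
    also have "lcoef (T (S (Suc i))) n = lcoef (T (S i)) n +
        lcoef (T (lmonom ((lcoef C n - lcoef (T (S i)) n) / a) (N - int i))) n"
      by (simp add: SS T.add n)
    also have "lcoef (T (lmonom x (N - int i))) n = a * x" for x
    proof -
      have "lbound (N - int i) (lmonom x (N - int i))" by (simp add: lbound_def)
      from lead[OF this] show ?thesis by (simp add: n N_def)
    qed
    finally show ?thesis using a by simp
  next
    case False
    have "lbound N B" by (simp add: lbound_def lB)
    from bound[OF this] have "lbound K (T B)" by (simp add: N_def)
    then show ?thesis using False K by (simp add: lbound_def)
  qed
  then show ?thesis by (blast intro: lseries_eqI)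
qed

lemma psdo_right_inverse:
  fixes A :: "'k::field fls"
  assumes D: "additive D" and A: "A \<noteq> 0"
  shows "\<exists>B. psdo_mult D A B = 1"
proof -
  obtain n where n: "lcoef A n \<noteq> 0" using A lseries_eqI[of A 0] by auto
  obtain K where K: "lbound K A" using lbound_exists by blast
  \<comment> \<open>The exact top degree of \<open>A\<close>; truncating at a degree n with nonzero
    coefficient makes the set finite and nonempty.\<close>
  define M where "M = Max {m \<in> {n..K}. lcoef A m \<noteq> 0}"
  have "n \<le> K" using n K by (meson lboundD not_less)
  then have ne: "{m \<in> {n..K}. lcoef A m \<noteq> 0} \<noteq> {}" using n by auto
  have fin: "finite {m \<in> {n..K}. lcoef A m \<noteq> 0}" by (rule finite_subset[of _ "{n..K}"]) auto
  have M: "lcoef A M \<noteq> 0" "n \<le> M"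
    using Max_in[OF fin ne] by (auto simp: M_def)
  have MA: "lbound M A"
    unfolding lbound_def
  proof (intro allI impI, rule ccontr)
    fix m assume "M < m" "lcoef A m \<noteq> 0"
    moreover from this have "m \<le> K" using K by (meson lboundD not_less)
    ultimately have "m \<in> {m \<in> {n..K}. lcoef A m \<noteq> 0}" using M(2) by auto
    then have "m \<le> M" unfolding M_def by (rule Max_ge[OF fin])
    with \<open>M < m\<close> show False by simp
  qed
  show ?thesis
  proof (rule fls_triangular_surj[where M = M and a = "lcoef A M"])
    show "additive (psdo_mult D A)" by (rule additive_psdo_mult_right[OF D])
    show "lbound (N + M) (psdo_mult D A B)" if "lbound N B" for N B
      using lbound_psdo_mult[OF D MA that] by (simp add: add.commute)
    show "lcoef (psdo_mult D A B) (N + M) = lcoef A M * lcoef B N" if "lbound N B" for N B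
      using lcoef_psdo_mult_box[OF D MA that, of M "N + M" M 1] by simp
  qed (use M in simp)
qed

text \<open>Since every nonzero operator has a right inverse, the right inverse \<open>B\<close> of
  \<open>A\<close> has a right inverse of its own, and associativity identifies that one with
  \<open>A\<close>.\<close>

lemma psdo_inverse:
  fixes A :: "'k::field fls"
  assumes D: "additive D" "\<And>a b. D (a * b) = D a * b + a * D b" and A: "A \<noteq> 0"
  obtains B where "psdo_mult D A B = 1" "psdo_mult D B A = 1"
proof -
  have D1: "D 1 = 0" using D(2)[of 1 1] by (metis add_cancel_right_right mult.right_neutral mult_1)
  obtain B where B: "psdo_mult D A B = 1" using psdo_right_inverse[OF D(1) A] by blast
  then have "B \<noteq> 0" using additive.zero[OF additive_psdo_mult_right[OF D(1)]] by auto
  then obtain C where C: "psdo_mult D B C = 1" using psdo_right_inverse[OF D(1)] by blast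
  have "A = psdo_mult D A (psdo_mult D B C)" by (simp add: C psdo_mult_1_right D D1)
  also have "\<dots> = C"
    unfolding psdo_mult_assoc[OF D(1) D(1) D(1) D(2)] B by (rule psdo_mult_1_left[OF D(1)])
  finally show thesis using B C that by blast
qed

section \<open>Admissibility\<close>

lemma lbound_subdegree: "lbound N A \<Longrightarrow> A \<noteq> 0 \<Longrightarrow> - N \<le> fls_subdegree A"
  by (rule fls_subdegree_geI) (auto simp: lbound_def lcoef_def, metis minus_less_iff minus_minus)

lemma lbound_times:
  fixes A B :: "'a::comm_ring_1 fls"
  assumes "lbound M A" "lbound N B"
  shows "lbound (M + N) (A * B)"
proof (cases "A = 0 \<or> B = 0")
  case False
  then have "- M \<le> fls_subdegree A" "- N \<le> fls_subdegree B"
    using assms by (auto intro: lbound_subdegree)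
  then show ?thesis
    unfolding lbound_def lcoef_def by (intro allI impI fls_times_nth_eq0) simp
qed (auto simp: lbound_def)

text \<open>Presents the commutative product of symbols as a composition, so that the general
  product rule yields the Leibniz rule for the coefficientwise derivation.\<close>

lemma psdo_mult_zero_derivation: "psdo_mult (\<lambda>_. 0) A B = A * (B :: 'a::comm_ring_1 fls)"
proof (rule lseries_eqI)
  fix k
  have z: "additive (\<lambda>_ :: 'a. 0 :: 'a)" by (simp add: additive_def)
  have 0: "fls_map (\<lambda>_ :: 'a. 0 :: 'a) C = 0" for C by (rule lseries_eqI) (simp add: lcoef_fls_map)
  have 1: "psdo_mult (\<lambda>_. 0) (lmonom 1 m) B = lmonom 1 m * B" for m
  proof (induction m rule: int_up_down)
    case 0 show ?case by (simp add: lmonom_const) (simp add: psdo_mult_1_left z)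
  next
    case (up m)
    then show ?case
      unfolding psdo_mult_lmonom_Suc'[OF z] psdo_mult_X_inv[OF z] 0 by (simp add: mult.assoc flip: X_inv_lmonom)
  next
    case (down m)
    then have "fls_X_inv * psdo_mult (\<lambda>_. 0) (lmonom 1 m) B = fls_X_inv * (lmonom 1 m * B)"
      unfolding psdo_mult_lmonom_Suc'[OF z] psdo_mult_X_inv[OF z] 0 by (simp add: mult.assoc flip: X_inv_lmonom)
    then show ?case by (simp only: X_inv_mult_cancel)
  qed
  obtain N where N: "lbound N B" using lbound_exists by blast
  show "lcoef (psdo_mult (\<lambda>_. 0) A B) k = lcoef (A * B) k"
  proof (rule fls_local_eq[where S = "\<lambda>A. lcoef (psdo_mult (\<lambda>_. 0) A B) k" and T = "\<lambda>A. lcoef (A * B) k"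
        and A = A and e = "k - N - 1"])
    show "additive (\<lambda>A. lcoef (psdo_mult (\<lambda>_. 0) A B) k)"
      by (rule additive_comp[OF additive_lcoef additive_psdo_mult_left[OF z]])
    show "additive (\<lambda>A. lcoef (A * B) k)" by (simp add: additive_def distrib_right)
    show "lcoef (psdo_mult (\<lambda>_. 0) (lmonom a m) B) k = lcoef (lmonom a m * B) k" for a m
      using psdo_mult_lmonom_const[OF z, of a 1 m B] lmonom_eq_const_mult[of a m]
      by (simp add: 1 mult.assoc)
    show "lcoef (psdo_mult (\<lambda>_. 0) A B) k = 0" if "lbound (k - N - 1) A" for A
      using lbound_psdo_mult[OF z that N] by (rule lboundD) simp
    show "lcoef (A * B) k = 0" if "lbound (k - N - 1) A" for A
      using lbound_times[OF that N] by (rule lboundD) simp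
  qed
qed

lemma fls_map_Leibniz:
  fixes D :: "'a::comm_ring_1 \<Rightarrow> 'a"
  assumes D: "additive D" "\<And>a b. D (a * b) = D a * b + a * D b"
  shows "fls_map D (A * B) = fls_map D A * B + A * fls_map D B"
proof -
  have "additive (\<lambda>_ :: 'a. 0 :: 'a)" "additive (\<lambda>x :: 'a. x)" by (simp_all add: additive_def)
  moreover have "fls_map (\<lambda>x. x) C = C" for C :: "'a fls" by (rule lseries_eqI) (simp add: lcoef_fls_map)
  ultimately show ?thesis
    using fls_map_psdo_mult_Leibniz[of D "\<lambda>x. x" "\<lambda>_. 0" "\<lambda>_. 0" "\<lambda>_. 0" A B] D
    by (simp add: psdo_mult_zero_derivation additive.zero)
qed

text \<open>For \<open>X = {a\<^sub>\<lambda> \<cdot>}\<close> the symbol \<open>{b\<^sub>\<mu> c}\<close> belongs to this set iff \<open>{a\<^sub>\<lambda> {b\<^sub>\<mu> c}}\<close> lies in \<open>V\<^bsub>\<lambda>,\<mu>\<^esub>\<close>.\<close>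

definition tri_admissible :: "('v::comm_ring_1 \<Rightarrow> 'v fls) \<Rightarrow> 'v fls set" where
  "tri_admissible X = {A. fls_map X A \<in> range tri_lm}"

context
  fixes D :: "'v::comm_ring_1 \<Rightarrow> 'v" and X :: "'v \<Rightarrow> 'v fls"
  assumes D: "additive D" "\<And>a b. D (a * b) = D a * b + a * D b"
    and X: "additive X" "\<And>a b. X (a * b) = X a * fls_const b + fls_const a * X b"
      "\<And>a. X (D a) = psdo_mult D fls_X_inv (X a)"
begin

lemmas additive_nabla = additive_psdo_mult_right[OF D(1), of fls_X_inv]

lemmas additive_coefficientwise = additive_fls_map[OF D(1)]

lemma nabla_Leibniz: "nabla D (A * B) = fls_map D A * B + A * nabla D B"
  by (simp add: psdo_mult_X_inv D(1) fls_map_Leibniz[OF D] algebra_simps)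

lemma tri_admissible_diff: "A \<in> tri_admissible X \<Longrightarrow> B \<in> tri_admissible X \<Longrightarrow> A - B \<in> tri_admissible X"
  unfolding tri_admissible_def
  by (auto simp: additive.diff[OF additive_fls_map[OF X(1)]] additive.diff[OF additive_tri_lm, symmetric])

text \<open>Right composition by \<open>B\<close> acts through \<mu>+\<partial> on the left factor,
  not through \<nu>+\<partial>. Conjugating with the adjoint turns it into left composition by the
  adjoint of \<open>B\<close>, which is an action through \<nu>; all three operations stay within
  the space of series in \<lambda>, \<mu>, \<nu>.\<close>

lemma tri_lm_right_action:
  "psdo_mult (fls_map D) (tri_lm f) (fls_map fls_const B) =
    tri_lm (tri_adj D (tri_op (psdo_mult D (psdo_adj D B)) (tri_adj D f)))"
proof -
  have "psdo_adj (nabla D) (psdo_mult (nabla D) (fls_map fls_const (psdo_adj D B)) (psdo_adj (nabla D) (tri_lm f))) =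
      psdo_mult (fls_map D) (psdo_adj (nabla D) (psdo_adj (nabla D) (tri_lm f))) (psdo_adj (fls_map D) (fls_map fls_const (psdo_adj D B)))"
    by (rule psdo_adj_mult[OF additive_nabla additive_coefficientwise nabla_Leibniz fls_map_Leibniz[OF D]])
  also have "psdo_adj (fls_map D) (fls_map fls_const (psdo_adj D B)) = fls_map fls_const B"
    using fls_map_psdo_adj[OF additive_fls_const, of D "fls_map D" "psdo_adj D B"]
    by (simp add: fls_map_const D additive_coefficientwise psdo_adj_adj)
  finally show ?thesis
    by (simp add: psdo_adj_adj additive_nabla tri_lm_adj D(1) tri_lm_op_mult)
qed

lemma fls_map_X_psdo_mult:
  "fls_map X (psdo_mult D A B) =
    psdo_mult (fls_map D) (fls_map X A) (fls_map fls_const B) + psdo_mult (nabla D) (fls_map fls_const A) (fls_map X B)"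
  by (rule fls_map_psdo_mult_Leibniz[OF X additive_fls_const _ D(1) additive_coefficientwise additive_nabla]) (simp add: fls_map_const D)

lemma tri_admissible_mult:
  assumes "A \<in> tri_admissible X" "B \<in> tri_admissible X"
  shows "psdo_mult D A B \<in> tri_admissible X"
proof -
  obtain f g where "fls_map X A = tri_lm f" "fls_map X B = tri_lm g"
    using assms by (auto simp: tri_admissible_def)
  then have "fls_map X (psdo_mult D A B) =
      tri_lm (tri_adj D (tri_op (psdo_mult D (psdo_adj D B)) (tri_adj D f)) + tri_op (psdo_mult D A) g)"
    by (simp add: fls_map_X_psdo_mult tri_lm_right_action additive.add[OF additive_tri_lm] tri_lm_op_mult D(1))
  then show ?thesis by (auto simp: tri_admissible_def)
qed

text \<open>Applying \<open>X\<close> to \<open>A \<circ> B = 1\<close> and solving for \<open>X(B)\<close>.\<close>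

lemma tri_admissible_inverse:
  assumes A: "A \<in> tri_admissible X" and "psdo_mult D A B = 1" "psdo_mult D B A = 1"
  shows "B \<in> tri_admissible X"
proof -
  obtain f where f: "fls_map X A = tri_lm f"
    using A by (auto simp: tri_admissible_def)
  define g where "g = tri_adj D (tri_op (psdo_mult D (psdo_adj D B)) (tri_adj D f))"
  let ?c = "fls_map fls_const"
  have X1: "X 1 = 0" using X(2)[of 1 1] by simp
  have "fls_map X 1 = 0"
    using fls_map_const[OF X(1), of 1] by (simp add: X1)
  then have "tri_lm g + psdo_mult (nabla D) (?c A) (fls_map X B) = 0"
    using fls_map_X_psdo_mult[of A B] by (simp add: assms(2) f tri_lm_right_action g_def)
  then have "psdo_mult (nabla D) (?c A) (fls_map X B) = tri_lm (- g)"
    by (simp add: additive.minus[OF additive_tri_lm] eq_neg_iff_add_eq_0 add.commute)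
  \<comment> \<open>Acting with \<open>B\<close> on the left cancels \<open>A\<close>, by
    associativity of the action on the module with connection \<lambda>+\<partial>.\<close>
  then have "psdo_mult (nabla D) (?c B) (psdo_mult (nabla D) (?c A) (fls_map X B)) = tri_lm (tri_op (psdo_mult D B) (- g))"
    by (simp add: tri_lm_op_mult D(1))
  moreover have "psdo_mult (nabla D) (?c B) (psdo_mult (nabla D) (?c A) (fls_map X B)) =
      psdo_mult (nabla D) (psdo_mult (fls_map D) (?c B) (?c A)) (fls_map X B)"
    by (rule psdo_mult_assoc[OF additive_nabla additive_nabla additive_coefficientwise nabla_Leibniz])
  moreover have "psdo_mult (fls_map D) (?c B) (?c A) = ?c (psdo_mult D B A)"
    by (rule fls_map_psdo_mult[symmetric])
      (simp_all add: additive_fls_const fls_map_const D additive_coefficientwise fls_const_mult_const)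
  moreover have "?c (1 :: 'v fls) = 1"
    using fls_map_const[OF additive_fls_const, of "1 :: 'v"] by simp
  ultimately have "fls_map X B = tri_lm (tri_op (psdo_mult D B) (- g))"
    by (simp add: assms(3) psdo_mult_1_left additive_nabla)
  then show ?thesis by (auto simp: tri_admissible_def)
qed

lemma tri_admissible_lmonom: "lmonom a n \<in> tri_admissible X"
proof -
  have "fls_map X (lmonom a n) = lmonom (X a) n" by (rule fls_map_lmonom[OF X(1)])
  also have "\<dots> = tri_lm (tri_prod (X a) (lmonom 1 n))"
    using lmonom_eq_const_mult[of "X a" n] by (simp add: tri_lm_prod fls_map_lmonom additive_fls_const)
  finally show ?thesis by (auto simp: tri_admissible_def)
qed

end

section \<open>Admissibility of the master bracket through the field of fractions\<close>

lemma additive_closed_sum: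
  fixes S :: "'a::ab_group_add set"
  assumes "\<forall>a\<in>S. \<forall>b\<in>S. a - b \<in> S" "0 \<in> S" "\<And>i. i \<in> I \<Longrightarrow> f i \<in> S"
  shows "sum f I \<in> S"
proof -
  have add: "a + b \<in> S" if "a \<in> S" "b \<in> S" for a b
    using assms(1,2) that by (metis diff_0 diff_minus_eq_add)
  show ?thesis using assms(3)
    by (induction I rule: infinite_finite_induct) (auto simp: assms(2) add)
qed

lemma differential_operator_eq_sum:
  assumes "A \<in> differential_operators"
  shows "\<exists>N. A = (\<Sum>n=0..N. lmonom (lcoef A n) n)"
proof -
  obtain N where N: "lbound N A" using lbound_exists by blast
  have "A = (\<Sum>n=0..N. lmonom (lcoef A n) n)"
    using assms N by (intro lseries_eqI) (auto simp: lcoef_sum differential_operators_def lbound_def not_le)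
  then show ?thesis by blast
qed

lemma subskewfield_tri_admissible:
  fixes D :: "'k::field \<Rightarrow> 'k"
  assumes D: "additive D" "\<And>a b. D (a * b) = D a * b + a * D b"
    and X: "additive X" "\<And>a b. X (a * b) = X a * fls_const b + fls_const a * X b"
      "\<And>a. X (D a) = psdo_mult D fls_X_inv (X a)"
  shows "subskewfield D (tri_admissible X)"
  unfolding subskewfield_def
proof (intro conjI ballI impI)
  show "1 \<in> tri_admissible X"
    using tri_admissible_lmonom[OF D X, of 1 0] by (simp add: lmonom_const)
  fix A assume A: "A \<in> tri_admissible X"
  show "A - B \<in> tri_admissible X" "psdo_mult D A B \<in> tri_admissible X" if "B \<in> tri_admissible X" for B
    using tri_admissible_diff[OF D X A that] tri_admissible_mult[OF D X A that] by auto
  assume "A \<noteq> 0"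
  then obtain B where "psdo_mult D A B = 1" "psdo_mult D B A = 1" by (rule psdo_inverse[OF D])
  then show "\<exists>B\<in>tri_admissible X. psdo_mult D A B = 1 \<and> psdo_mult D B A = 1"
    using tri_admissible_inverse[OF D X A] by blast
qed

lemma additive_to_fract: "additive to_fract"
  by (simp add: additive_def)

text \<open>An injective linear map has a linear left inverse. The homomorphism \<open>h\<close>
  embeds the scalars into the target field and so makes that field a vector space.\<close>

lemma (in vector_space) fract_retraction:
  fixes emb :: "'b \<Rightarrow> 'c::field"
  assumes "additive emb" "inj emb" "\<And>c x. emb (scale c x) = h c * emb x"
    and h: "\<And>c d. h (c + d) = h c + h d" "\<And>c d. h (c * d) = h c * h d" "h 1 = 1"
  obtains r where "additive r" "\<And>x. r (emb x) = x"
proof -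
  have vs: "vector_space (\<lambda>c x. h c * x :: 'c)"
    by unfold_locales (simp_all add: h algebra_simps)
  interpret vector_space_pair scale "\<lambda>c x. h c * x :: 'c"
    by (intro vector_space_pair.intro vs vector_space_axioms)
  have "Vector_Spaces.linear scale (\<lambda>c x. h c * x) emb"
    using assms by (simp add: Vector_Spaces.linear_iff vs vector_space_axioms additive_def)
  from linear_injective_left_inverse[OF this assms(2)]
  obtain r where r: "Vector_Spaces.linear (\<lambda>c x. h c * x) scale r" "r \<circ> emb = id" by blast
  show thesis
  proof (rule that)
    show "additive r" using r(1) by (simp add: Vector_Spaces.linear_iff additive_def)
    show "r (emb x) = x" for x using r(2) by (simp add: fun_eq_iff)
  qed
qed

text \<open>
  An additive retraction of the field of fractions onto the algebra, applied to all coefficients, turns a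
  series over the field of fractions into one over the algebra without changing an expansion that has
  coefficients in the algebra.
\<close>

lemma admissible_master_bracket:
  fixes scl :: "'f::field_char_0 \<Rightarrow> 'v::idom \<Rightarrow> 'v"
    and \<iota> :: "('i::finite, 'f) diff_poly \<Rightarrow> 'v"
  assumes "algebra_of_differential_functions scl D \<iota> pd" and H: "H \<in> rational_mat_psdo D"
  shows "admissible_bracket (master_bracket D pd H)"
  unfolding admissible_bracket_def
proof (intro allI)
  fix a b c
  interpret algebra_of_differential_functions scl D \<iota> pd by fact
  let ?br = "master_bracket D pd H"
  let ?D = "fract_deriv D" and ?j = "fls_const :: 'v fract \<Rightarrow> _"
  let ?F = "fls_map to_fract :: 'v fls \<Rightarrow> 'v fract fls"
  \<comment> \<open>The bracket is pushed into K((\<lambda>^-1)), on which the fraction field K acts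
    by constants, so that it can be extended to K as a derivation.\<close>
  define d where "d v = ?F (?br a v)" for v
  define X where "X = fract_ext ?j d"
  have F: "additive ?F" by (rule additive_fls_map[OF additive_to_fract])
  have br: "additive (?br a)" by (rule additive_br(1))
  have id: "additive (\<lambda>x :: 'v fract. x)" "additive (\<lambda>a. to_fract (D a))"
    by (simp_all add: additive_def D.add)
  have D_eq: "?D = fract_ext (\<lambda>x. x) (\<lambda>a. to_fract (D a))"
    by (rule ext) (rule fract_deriv_eq_fract_ext[OF additive_D D_mult])
  have D_leib: "to_fract (D (a * b)) = to_fract (D a) * to_fract b + to_fract a * to_fract (D b)" for a b
    by (simp add: D_mult)
  note fD = fract_ext_add[OF id(1) _ _ id(2) D_leib] fract_ext_mult[OF id(1) _ _ id(2) D_leib]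
    fract_ext_to_fract[OF id(1) _ _ id(2) D_leib]
  have D: "additive ?D" and D_mult': "?D (q * r) = ?D q * r + q * ?D r" and D_to: "?D (to_fract v) = to_fract (D v)" for q r v
    unfolding D_eq additive_def by (simp_all add: fD)
  have N: "additive (psdo_mult ?D fls_X_inv)" by (rule additive_psdo_mult_right[OF D])
  have d: "additive d" unfolding d_def by (rule additive_comp[OF F br])
  have d_mult: "d (x * y) = d x * ?j (to_fract y) + ?j (to_fract x) * d y" for x y
    using fls_map_const_mult[OF additive_to_fract, of x "to_fract x" "?br a y"]
      fls_map_const_mult[OF additive_to_fract, of y "to_fract y" "?br a x"]
    by (simp add: d_def br_mult_right additive.add[OF F] mult.commute)
  have d_D: "d (D x) = psdo_mult ?D fls_X_inv (d x)" for x
    unfolding d_def br_D_right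
    by (rule lseries_eqI)
      (simp add: lcoef_fls_map_additive additive_to_fract lcoef_psdo_mult_X_inv additive_D D D_to)
  have j: "additive ?j" "?j (x * y) = ?j x * ?j y" "?j 1 = 1" for x y
    by (simp_all add: additive_fls_const fls_const_mult_const)
  note X_add = fract_ext_add[OF j d d_mult, folded X_def]
    and X_mult = fract_ext_mult[OF j d d_mult, folded X_def]
    and X_to = fract_ext_to_fract[OF j d d_mult, folded X_def]
  have X: "additive X" by (simp add: additive_def X_add)
  \<comment> \<open>With q = x/y, apply X to (Dq) y + q (Dy) = Dx, and \<lambda>+\<partial> to y
    X(q) + q d(y) = d(x). Comparing the results leaves y times the claim, and y is a unit.\<close>
  have X_D: "X (?D q) = psdo_mult ?D fls_X_inv (X q)" for q
  proof -
    let ?N = "psdo_mult ?D fls_X_inv"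
    have NL: "?N (A * B) = fls_map ?D A * B + A * ?N B" for A B
      by (simp add: psdo_mult_X_inv D fls_map_Leibniz[OF D D_mult'] algebra_simps)
    have Dj: "fls_map ?D (?j x) = ?j (?D x)" for x by (rule fls_map_const[OF D])
    obtain x y where y: "y \<noteq> 0" "q * to_fract y = to_fract x" by (rule fract_rep)
    have "?D q * to_fract y + q * to_fract (D y) = to_fract (D x)"
      using arg_cong[OF y(2), of ?D] by (simp add: D_mult' D_to)
    from arg_cong[OF this, of X]
    have 1: "X (?D q) * ?j (to_fract y) + ?j (?D q) * d y + X q * ?j (to_fract (D y)) + ?j q * ?N (d y) = ?N (d x)"
      by (simp add: X_add X_mult X_to d_D add.assoc)
    have "?j (to_fract y) * X q + ?j q * d y = d x"
      using arg_cong[OF y(2), of X] by (simp add: X_mult X_to mult.commute)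
    from arg_cong[OF this, of ?N]
    have 2: "?j (to_fract (D y)) * X q + ?j (to_fract y) * ?N (X q) + (?j (?D q) * d y + ?j q * ?N (d y)) = ?N (d x)"
      by (simp add: additive.add[OF N] NL Dj D_to)
    have "?j (to_fract y) * X (?D q) = ?j (to_fract y) * ?N (X q)"
      using trans[OF 1 2[symmetric]] by (simp add: algebra_simps)
    then show ?thesis using fract_cancel[OF j d d_mult y(1)] by simp
  qed
  define S where "S = tri_admissible X"
  have S: "subskewfield ?D S"
    unfolding S_def by (rule subskewfield_tri_admissible[OF D D_mult' X X_mult X_D])
  then have S_diff: "A - B \<in> S" and S_mult: "psdo_mult ?D A B \<in> S" if "A \<in> S" "B \<in> S" for A B
    using that by (auto simp: subskewfield_def)
  have S_0: "0 \<in> S"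
    using S S_diff[of 1 1] by (simp add: subskewfield_def)
  have S_lmonom: "lmonom x n \<in> S" for x n
    unfolding S_def by (rule tri_admissible_lmonom[OF D D_mult' X X_mult X_D])
  have "\<forall>A\<in>S. \<forall>B\<in>S. A - B \<in> S" using S_diff by blast
  note S_sum = additive_closed_sum[OF this S_0]
  have F_mult: "?F (psdo_mult D A B) = psdo_mult ?D (?F A) (?F B)" for A B
    by (rule fls_map_psdo_mult[OF additive_to_fract]) (simp_all add: D_to additive_D D)
  have F_lmonom: "?F (lmonom x n) = lmonom (to_fract x) n" for x n
    by (rule fls_map_lmonom[OF additive_to_fract])
  have diffop: "?F A \<in> S" if A: "A \<in> differential_operators" for A
  proof -
    obtain n where "A = (\<Sum>m=0..n. lmonom (lcoef A m) m)"
      using differential_operator_eq_sum[OF A] by blast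
    then have "?F A = (\<Sum>m=0..n. lmonom (to_fract (lcoef A m)) m)"
      by (metis (no_types, lifting) F_lmonom additive.sum[OF F] sum.cong)
    also have "\<dots> \<in> S" by (rule S_sum) (rule S_lmonom)
    finally show ?thesis .
  qed
  \<comment> \<open>\<open>S\<close> is one of the subskewfields whose intersection defines the
    rational operators.\<close>
  have "rational_psdo_fract D \<subseteq> S"
    unfolding rational_psdo_fract_def using S diffop by auto
  then have H: "?F (H $ j $ i) \<in> S" for i j
    using H by (auto simp: rational_mat_psdo_def rational_psdo_def)
  have frechet: "?F (frechet j x) \<in> S" for j x
    by (rule diffop) (simp add: differential_operators_def lcoef_frechet)
  \<comment> \<open>The adjoint is a finite sum of products of (-\<partial>)^n with a function, so
    closure under composition and sums suffices.\<close>
  have adj: "?F (psdo_adj D (frechet j x)) \<in> S" for j x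
  proof -
    have "frechet j x = (\<Sum>n | pd j n x \<noteq> 0. fls_const (pd j n x) * fls_X_inv ^ n)"
      by (rule frechet_eq_sum) (auto simp: finite_pd')
    moreover have "(- fls_X_inv) ^ n = lmonom ((- 1) ^ n :: 'v) (int n)" for n
      by (rule lseries_eqI) (simp add: power_minus[of fls_X_inv] lmonom_X_inv_power minus_one_power_iff)
    ultimately have "?F (psdo_adj D (frechet j x)) = (\<Sum>n | pd j n x \<noteq> 0.
        psdo_mult ?D (lmonom (to_fract ((- 1) ^ n)) (int n)) (lmonom (to_fract (pd j n x)) 0))"
      by (simp add: psdo_adj.sum additive.sum[OF F] psdo_adj_monomial F_mult F_lmonom
          F_lmonom[of _ 0, unfolded lmonom_const] lmonom_const)
    also have "\<dots> \<in> S" by (intro S_sum S_mult S_lmonom)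
    finally show ?thesis .
  qed
  have "?F (?br b c) \<in> S"
    unfolding master_bracket_eq additive.sum[OF F] F_mult by (intro S_sum S_mult frechet H adj)
  then obtain f where f: "fls_map X (?F (?br b c)) = tri_lm f"
    by (auto simp: S_def tri_admissible_def)
  have X_F: "fls_map X (?F (?br b c)) = fls_map ?F (bracket_lm ?br a b c)"
    unfolding bracket_lm_def
    by (rule lseries_eqI) (simp add: lcoef_fls_map_additive X F br additive_to_fract X_to d_def)
  have inj: "inj (to_fract :: 'v \<Rightarrow> _)" by (simp add: inj_def)
  have scl1: "to_fract (scl k x) = to_fract (scl k 1) * to_fract x" for k x
    by (subst scl_eq_mult) simp
  have scl2: "to_fract (scl (k * l) 1) = to_fract (scl k 1) * to_fract (scl l 1)" for k l
    by (simp flip: to_fract_mult scl_eq_mult)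
  obtain r where r: "additive r" "\<And>x. r (to_fract x) = (x :: 'v)"
    by (rule fract_retraction[where h = "\<lambda>k. to_fract (scl k 1)", OF additive_to_fract inj scl1])
      (simp_all add: scale_left_distrib scl2)
  have "tri_lm (tri_map r f) = fls_map (fls_map r) (fls_map ?F (bracket_lm ?br a b c))"
    by (simp add: tri_lm_map[OF r(1)] X_F flip: f)
  also have "\<dots> = bracket_lm ?br a b c"
    by (intro lseries_eqI) (simp add: lcoef_fls_map_additive additive_fls_map r F additive_to_fract)
  finally show "bracket_lm ?br a b c \<in> range embed_lm"
    using embed_lm.abs_eq by (metis rangeI)
qed

theorem theorem4p1:
  fixes scl :: "'f::field_char_0 \<Rightarrow> 'v::idom \<Rightarrow> 'v"
    and D :: "'v \<Rightarrow> 'v"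
    and \<iota> :: "('i::finite, 'f) diff_poly \<Rightarrow> 'v"
    and pd :: "'i \<Rightarrow> nat \<Rightarrow> 'v \<Rightarrow> 'v"
    and H :: "'v fls ^ 'i ^ 'i"
  assumes "algebra_of_differential_functions scl D \<iota> pd"
  shows
    "((\<forall>f g i j. finite {(m, n). master_term D pd H f g i j m n \<noteq> 0}) \<and>
        nonlocal_lambda_bracket scl D (master_bracket D pd H)) \<and>
     (skewsymmetric_bracket D (master_bracket D pd H) \<longleftrightarrow> skewadjoint D H) \<and>
     (H \<in> rational_mat_psdo D \<longrightarrow> admissible_bracket (master_bracket D pd H)) \<and>
     (H \<in> rational_mat_psdo D \<and> skewadjoint D H \<longrightarrow>
        (poisson_bracket scl D (master_bracket D pd H) \<longleftrightarrow>
          (\<forall>i j k. jacobi_identity (master_bracket D pd H)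
             (\<iota> (dp_var i 0)) (\<iota> (dp_var j 0)) (\<iota> (dp_var k 0)))))"
proof -
  interpret algebra_of_differential_functions scl D \<iota> pd by fact
  note admissible = admissible_master_bracket[OF assms]
  show ?thesis
    unfolding poisson_bracket_def
    by (auto simp: finite_master_term nonlocal_lambda_bracket_master skewsymmetric_master admissible
        intro: jacobi_identity_from_generators)
qed

end
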